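(* Let $2<p\le4$ and let $(f_i)_{i=1}^\infty\subseteq L_p(\mathbb{R})$ be an unconditional basis for a closed subspace $X\subseteq L_p(\mathbb{R})$, where all $f_i$ are translates of some fixed $f\in L_p(\mathbb{R})$. Then $X$ embeds isomorphically into $\ell_p$.
   Context: The translate of $f$ by $\lambda$ is $f_{(\lambda)}(x)=f(x-\lambda)$. $X$ embeds isomorphically into $\ell_p$ if there is a bounded linear injection $T:X\to\ell_p$ with bounded inverse on its range. *)

theory Defs
  imports "HOL-Analysis.Analysis"
begin

text \<open>Real-valued L_p(R), with respect to Lebesgue (Borel) measure. Elements are
represented by functions; a.e.-equality is handled through the Lp seminorm.\<close>

definition Lp :: "real \<Rightarrow> (real \<Rightarrow> real) set" where
  "Lp p = {f. f \<in> borel_measurable lborel \<and> integrable lborel (\<lambda>x. \<bar>f x\<bar> powr p)}"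

definition Lp_norm :: "real \<Rightarrow> (real \<Rightarrow> real) \<Rightarrow> real" where
  "Lp_norm p f = (\<integral>x. \<bar>f x\<bar> powr p \<partial>lborel) powr (1 / p)"

definition lp_seq :: "real \<Rightarrow> (nat \<Rightarrow> real) set" where
  "lp_seq p = {a. summable (\<lambda>n. \<bar>a n\<bar> powr p)}"

definition lp_norm :: "real \<Rightarrow> (nat \<Rightarrow> real) \<Rightarrow> real" where
  "lp_norm p a = (\<Sum>n. \<bar>a n\<bar> powr p) powr (1 / p)"

definition translate :: "(real \<Rightarrow> real) \<Rightarrow> real \<Rightarrow> (real \<Rightarrow> real)" where
  "translate f lam = (\<lambda>x. f (x - lam))"

definition closed_subspace_Lp :: "real \<Rightarrow> (real \<Rightarrow> real) set \<Rightarrow> bool" where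
  "closed_subspace_Lp p X \<longleftrightarrow>
     X \<subseteq> Lp p \<and> (\<lambda>t. 0) \<in> X \<and>
     (\<forall>x\<in>X. \<forall>y\<in>X. \<forall>a b. (\<lambda>t. a * x t + b * y t) \<in> X) \<and>
     (\<forall>g s. (\<forall>n. s n \<in> X) \<longrightarrow> g \<in> Lp p \<longrightarrow>
        (\<lambda>n. Lp_norm p (\<lambda>t. s n t - g t)) \<longlonglongrightarrow> 0 \<longrightarrow> g \<in> X)"

definition uncond_converges_to :: "real \<Rightarrow> (nat \<Rightarrow> real) \<Rightarrow> (nat \<Rightarrow> real \<Rightarrow> real) \<Rightarrow> (real \<Rightarrow> real) \<Rightarrow> bool" where
  "uncond_converges_to p a f x \<longleftrightarrow>
     (\<forall>\<sigma>. bij \<sigma> \<longrightarrow>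
        (\<lambda>n. Lp_norm p (\<lambda>t. x t - (\<Sum>k<n. a (\<sigma> k) * f (\<sigma> k) t))) \<longlonglongrightarrow> 0)"

definition unconditional_basis :: "real \<Rightarrow> (nat \<Rightarrow> real \<Rightarrow> real) \<Rightarrow> (real \<Rightarrow> real) set \<Rightarrow> bool" where
  "unconditional_basis p f X \<longleftrightarrow>
     (\<forall>i. f i \<in> X) \<and> (\<forall>x\<in>X. \<exists>!a. uncond_converges_to p a f x)"

definition embeds_into_lp :: "real \<Rightarrow> (real \<Rightarrow> real) set \<Rightarrow> bool" where
  "embeds_into_lp p X \<longleftrightarrow>
     (\<exists>T :: (real \<Rightarrow> real) \<Rightarrow> (nat \<Rightarrow> real).
        (\<forall>x\<in>X. T x \<in> lp_seq p) \<and>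
        (\<forall>x\<in>X. \<forall>y\<in>X. \<forall>a b. T (\<lambda>t. a * x t + b * y t) = (\<lambda>n. a * T x n + b * T y n)) \<and>
        (\<exists>c C. 0 < c \<and> (\<forall>x\<in>X. c * Lp_norm p x \<le> lp_norm p (T x) \<and>
                                  lp_norm p (T x) \<le> C * Lp_norm p x)))"

end

theory Submission
  imports Defs
begin

text \<open>
  Unconditionality and Khinchine's inequality make the norm of \<open>\<Sum>i. a i * f i\<close> comparable to
  the \<open>L\<^sub>p\<close>-norm of the square function \<open>sqrt (\<Sum>i. (a i * f i)\<^sup>2)\<close>, which does not see
  signs; for \<open>p \<ge> 2\<close> it dominates the \<open>\<ell>\<^sub>p\<close>-sum of the norms of disjoint blocks, in particular
  the \<open>\<ell>\<^sub>p\<close>-norm of \<open>a\<close>.  For the converse, the translation parameters are uniformly separated because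
  translation is continuous in \<open>L\<^sub>p\<close>, so \<open>\<Sum>i. \<integral>x\<in>I. \<bar>f i x\<bar> powr p\<close> is finite for every
  bounded \<open>I\<close>.  One can therefore cut the index set into finite intervals such that, up to a summable
  \<open>L\<^sub>p\<close>-mass, consecutive blocks of functions live on annuli with bounded overlap.  The pointwise inequality
  \<open>(\<Sum>i. (a i * b i)\<^sup>2) powr (p/2) \<le> (\<Sum>i. \<bar>a i\<bar> powr p) * (\<Sum>i. \<bar>b i\<bar> powr p)\<close>, valid
  for \<open>p \<le> 4\<close>, absorbs the error.  Hence the space is isomorphic to an \<open>\<ell>\<^sub>p\<close>-sum of finite-dimensional
  subspaces of \<open>L\<^sub>p\<close>, and approximation by simple functions embeds each of these into a finite-dimensional
  \<open>\<ell>\<^sub>p\<close> with uniform constants.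
\<close>

section \<open>Unconditional expansions\<close>

text \<open>The hypothesis only says that each single expansion converges in every order; the
  constant \<open>K\<close> on which all later estimates rest has to be extracted from it.
  \<open>Lp_norm\<close> is merely a seminorm on functions, so this is done on coefficient
  sequences, which form a complete normed space where a category argument bounds all finite
  truncations at once. The same constant forces the translates apart: two nearly equal translates
  have a small difference, yet deleting one term of that difference leaves a full copy of
  \<open>f\<close>.

  Cutting points of the index set and radii of the annuli are one sequence \<open>m\<close>: indices
  below \<open>m j\<close> have little mass outside radius \<open>m (Suc j)\<close>, and indices
  from \<open>m (Suc j)\<close> on have little mass inside radius \<open>m j\<close>. Since
  \<open>2 < p\<close> and \<open>p \<le> 4\<close>, Khinchine's inequality follows from second and
  fourth moments alone.

  The simple approximants are chosen once per index, with geometrically decreasing errors.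
  Unconditionality bounds every coefficient by the norm of the whole sum, so the total error is at
  most half that norm, with constants independent of the size of a block.\<close>

lemma bij_enumerating_chain:
  fixes A :: "nat \<Rightarrow> nat set"
  assumes "\<And>k. finite (A k)" "incseq A" "(\<Union>k. A k) = UNIV"
  obtains \<sigma> where "bij \<sigma>" "\<And>k. \<sigma> ` {..<card (A k)} = A k"
proof -
  define r where "r n = (LEAST k. n \<in> A k)" for n
  have rA: "n \<in> A (r n)" for n
    unfolding r_def by (rule LeastI_ex) (use assms(3) in blast)
  have rle: "n \<in> A k \<longleftrightarrow> r n \<le> k" for n k
  proof
    show "n \<in> A k \<Longrightarrow> r n \<le> k" unfolding r_def by (rule Least_le)
    show "r n \<le> k \<Longrightarrow> n \<in> A k" using rA[of n] incseqD[OF assms(2), of "r n" k] by blast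
  qed
  \<comment> \<open>Predecessors of \<open>n\<close> when indices are ordered by the stage at which
    they enter the chain, ties broken by size. Each \<open>A k\<close> is an initial segment of this
    order, so the inverse of the position map is the required permutation.\<close>
  define B where "B n = {m. r m < r n \<or> (r m = r n \<and> m < n)}" for n
  have Bsub: "B n \<subset> A k" if "n \<in> A k" for n k
  proof -
    have "B n \<subseteq> A k" using that by (auto simp: rle B_def)
    moreover have "n \<notin> B n" by (simp add: B_def)
    ultimately show ?thesis using that by blast
  qed
  have finB: "finite (B n)" for n
    using finite_subset[OF psubset_imp_subset[OF Bsub[OF rA[of n]]] assms(1)] .
  define pos where "pos n = card (B n)" for n
  have mono: "pos m < pos n" if "m \<in> B n" for m n
    unfolding pos_def by (rule psubset_card_mono[OF finB]) (use that in \<open>auto simp: B_def\<close>)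
  have inj: "inj pos"
  proof (rule injI)
    fix m n assume "pos m = pos n"
    then have "m \<notin> B n" "n \<notin> B m" using mono[of m n] mono[of n m] by auto
    then show "m = n" by (auto simp: B_def)
  qed
  have img: "pos ` A k = {..<card (A k)}" for k
  proof (rule card_subset_eq)
    show "pos ` A k \<subseteq> {..<card (A k)}"
      using psubset_card_mono[OF assms(1) Bsub] by (auto simp: pos_def)
    show "card (pos ` A k) = card {..<card (A k)}"
      using card_image[OF inj_on_subset[OF inj subset_UNIV], of "A k"] by simp
  qed simp
  have surj: "n \<in> range pos" for n
  proof -
    have "\<exists>k. {..n} \<subseteq> A k"
    proof -
      have "i \<in> A (Max (r ` {..n}))" if "i \<le> n" for i
        using that by (auto simp: rle intro!: Max_ge)
      then show ?thesis by auto
    qed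
    then obtain k where "{..n} \<subseteq> A k" by blast
    then have "card {..n} \<le> card (A k)" using card_mono[OF assms(1)] by blast
    then have "n \<in> pos ` A k" by (simp add: img)
    then show ?thesis by blast
  qed
  have bij: "bij pos" using inj surj by (auto simp: bij_def)
  show ?thesis
  proof
    show "bij (inv pos)" using bij by (rule bij_imp_bij_inv)
    show "inv pos ` {..<card (A k)} = A k" for k
      using image_inv_f_f[OF inj, of "A k"] by (simp add: img)
  qed
qed

section \<open>Uniform bounds for truncated coefficient sequences\<close>

definition trunc :: "nat set \<Rightarrow> (nat \<Rightarrow> real) \<Rightarrow> nat \<Rightarrow> real" where
  "trunc F a = (\<lambda>i. if i \<in> F then a i else 0)"

text \<open>\<open>conv\<close> and \<open>uniq\<close> are existence and uniqueness of
  unconditional expansions, written with truncations: a partial sum in the order \<sigma> depends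
  only on the set of indices listed so far. No continuity of truncation is assumed; that is what has
  to be proved.\<close>

locale unconditional_coefficients =
  fixes V :: "(nat \<Rightarrow> real) set" and N :: "(nat \<Rightarrow> real) \<Rightarrow> real"
  assumes V_add: "a \<in> V \<Longrightarrow> b \<in> V \<Longrightarrow> (\<lambda>i. a i + b i) \<in> V"
    and V_scale: "a \<in> V \<Longrightarrow> (\<lambda>i. c * a i) \<in> V"
    and V_trunc: "finite F \<Longrightarrow> trunc F b \<in> V"
    and N_add: "a \<in> V \<Longrightarrow> b \<in> V \<Longrightarrow> N (\<lambda>i. a i + b i) \<le> N a + N b"
    and N_scale: "a \<in> V \<Longrightarrow> N (\<lambda>i. c * a i) = \<bar>c\<bar> * N a"
    and N_eq_0: "a \<in> V \<Longrightarrow> N a = 0 \<Longrightarrow> a = (\<lambda>i. 0)"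
    and complete: "(\<And>n. s n \<in> V) \<Longrightarrow>
      (\<And>e. e > 0 \<Longrightarrow> \<exists>M. \<forall>m\<ge>M. \<forall>n\<ge>M. N (\<lambda>i. s m i - s n i) < e) \<Longrightarrow>
      \<exists>a\<in>V. (\<lambda>n. N (\<lambda>i. s n i - a i)) \<longlonglongrightarrow> 0"
    and conv: "a \<in> V \<Longrightarrow> bij \<sigma> \<Longrightarrow> (\<lambda>n. N (\<lambda>i. a i - trunc (\<sigma> ` {..<n}) a i)) \<longlonglongrightarrow> 0"
    and uniq: "a \<in> V \<Longrightarrow>
      (\<And>\<sigma>. bij \<sigma> \<Longrightarrow> (\<lambda>n. N (\<lambda>i. a i - trunc (\<sigma> ` {..<n}) b i)) \<longlonglongrightarrow> 0) \<Longrightarrow> b = a"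
begin

lemma V_0: "(\<lambda>i. 0) \<in> V"
  using V_trunc[of "{}" undefined] by (simp add: trunc_def)

lemma N_0: "N (\<lambda>i. 0) = 0"
  using N_scale[OF V_0, of 0] by simp

lemma V_diff: "a \<in> V \<Longrightarrow> b \<in> V \<Longrightarrow> (\<lambda>i. a i - b i) \<in> V"
  using V_add[OF _ V_scale[of b "-1"], of a] by simp

lemma N_uminus: "a \<in> V \<Longrightarrow> N (\<lambda>i. - a i) = N a"
  using N_scale[of a "-1"] by simp

lemma N_diff: "a \<in> V \<Longrightarrow> b \<in> V \<Longrightarrow> N (\<lambda>i. a i - b i) \<le> N a + N b"
  using N_add[OF _ V_scale[of b "-1"], of a] N_uminus[of b] by simp

lemma N_nonneg: "a \<in> V \<Longrightarrow> 0 \<le> N a"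
  using N_diff[of a a] N_0 by simp

lemma N_commute: "a \<in> V \<Longrightarrow> b \<in> V \<Longrightarrow> N (\<lambda>i. a i - b i) = N (\<lambda>i. b i - a i)"
  using N_uminus[OF V_diff[of a b]] by simp

lemma N_triangle:
  assumes "a \<in> V" "b \<in> V" "c \<in> V"
  shows "N (\<lambda>i. a i - c i) \<le> N (\<lambda>i. a i - b i) + N (\<lambda>i. b i - c i)"
  using N_add[OF V_diff[OF assms(1,2)] V_diff[OF assms(2,3)]] by simp

lemma V_sum: "(\<And>j. j \<in> J \<Longrightarrow> s j \<in> V) \<Longrightarrow> (\<lambda>i. \<Sum>j\<in>J. s j i) \<in> V"
  by (induction J rule: infinite_finite_induct) (simp_all add: V_0 V_add)

lemma N_sum: "(\<And>j. j \<in> J \<Longrightarrow> s j \<in> V) \<Longrightarrow> N (\<lambda>i. \<Sum>j\<in>J. s j i) \<le> (\<Sum>j\<in>J. N (s j))"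
proof (induction J rule: infinite_finite_induct)
  case (insert j J)
  then show ?case
    using N_add[of "s j" "\<lambda>i. \<Sum>j\<in>J. s j i"] V_sum[of J s] by simp
qed (simp_all add: N_0)

text \<open>Otherwise there are infinitely many consecutive disjoint finite sets with large truncations, and
  a permutation that lists each of them contiguously destroys convergence.\<close>

lemma trunc_tail_small:
  assumes a: "a \<in> V" and e: "e > 0"
  shows "\<exists>m. \<forall>F. finite F \<longrightarrow> F \<inter> {..<m} = {} \<longrightarrow> N (trunc F a) \<le> e"
proof (rule ccontr)
  assume "\<not> ?thesis"
  then have "\<exists>F. finite F \<and> F \<inter> {..<m} = {} \<and> N (trunc F a) > e" for m
    by (meson not_le)
  then obtain F where F: "\<And>m. finite (F m)" "\<And>m. F m \<inter> {..<m} = {}" "\<And>m. N (trunc (F m) a) > e"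
    by metis
  define step where "step m = Suc (Max (insert m (F m)))" for m
  have step: "m < step m" "F m \<subseteq> {..<step m}" for m
  proof -
    have "x \<le> Max (insert m (F m))" if "x \<in> insert m (F m)" for x
      using that F(1) by (intro Max_ge) auto
    then show "m < step m" "F m \<subseteq> {..<step m}"
      by (auto simp: step_def le_imp_less_Suc)
  qed
  define M where "M k = (step ^^ k) 0" for k
  have M: "M (Suc k) = step (M k)" for k by (simp add: M_def)
  have Mge: "k \<le> M k" for k
  proof (induction k)
    case (Suc k)
    then show ?case using step(1)[of "M k"] M[of k] by simp
  qed simp
  \<comment> \<open>Stage \<open>2 * j\<close> is the initial segment below \<open>M j\<close>, and
    stage \<open>2 * j + 1\<close> adds the bad set \<open>F (M j)\<close>. Two consecutive partial
    sums therefore differ by exactly one large truncation, contradicting the Cauchy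
    property.\<close>
  define A where "A k = {..<M (k div 2)} \<union> (if odd k then F (M (k div 2)) else {})" for k
  have "incseq A"
  proof (rule incseq_SucI)
    fix k show "A k \<le> A (Suc k)"
    proof (cases "odd k")
      case True
      then have "Suc k div 2 = Suc (k div 2)" by presburger
      then show ?thesis using True step[of "M (k div 2)"] by (auto simp: A_def M)
    next
      case False
      then have "Suc k div 2 = k div 2" by presburger
      then show ?thesis using False by (auto simp: A_def)
    qed
  qed
  moreover have "(\<Union>k. A k) = UNIV"
  proof -
    have "n \<in> A (2 * Suc n)" for n using Mge[of "Suc n"] by (auto simp: A_def)
    then show ?thesis by blast
  qed
  moreover have fin: "finite (A k)" for k using F(1) by (auto simp: A_def)
  ultimately obtain \<sigma> where \<sigma>: "bij \<sigma>" "\<And>k. \<sigma> ` {..<card (A k)} = A k"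
    using bij_enumerating_chain by blast
  have "eventually (\<lambda>n. N (\<lambda>i. a i - trunc (\<sigma> ` {..<n}) a i) < e/2) sequentially"
    using order_tendstoD(2)[OF conv[OF a \<sigma>(1)], of "e/2"] e by auto
  then obtain n0 where n0: "\<And>n. n \<ge> n0 \<Longrightarrow> N (\<lambda>i. a i - trunc (\<sigma> ` {..<n}) a i) < e/2"
    by (auto simp: eventually_sequentially)
  have card: "n0 \<le> card (A k)" if "k \<ge> 2 * n0" for k
  proof -
    have "{..<n0} \<subseteq> A k" using Mge[of "k div 2"] that by (auto simp: A_def)
    then have "card {..<n0} \<le> card (A k)" by (rule card_mono[OF fin])
    then show ?thesis by simp
  qed
  have small: "N (\<lambda>i. a i - trunc (A k) a i) < e/2" if "k \<ge> 2 * n0" for k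
    using n0[OF card[OF that]] \<sigma>(2) by simp
  define m where "m = M n0"
  have A2: "A (2 * n0) = {..<m}" "A (Suc (2 * n0)) = {..<m} \<union> F m" by (auto simp: A_def m_def)
  have "trunc (F m) a = (\<lambda>i. trunc (A (Suc (2 * n0))) a i - trunc (A (2 * n0)) a i)"
    using F(2)[of m] by (auto simp: trunc_def A2 fun_eq_iff)
  then have "N (trunc (F m) a) \<le> N (\<lambda>i. trunc (A (Suc (2 * n0))) a i - a i)
      + N (\<lambda>i. a i - trunc (A (2 * n0)) a i)"
    using N_triangle[OF V_trunc[OF fin] a V_trunc[OF fin]] by auto
  also have "\<dots> < e/2 + e/2"
    using small[of "2 * n0"] small[of "Suc (2 * n0)"] N_commute[OF a V_trunc[OF fin]]
    by (intro add_strict_mono) auto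
  finally show False using F(3)[of m] by simp
qed

text \<open>Truncations beyond some index are at most 1, and below it there are only finitely many
  sets. The bound is a natural number so that countably many sets \<open>A m\<close> exhaust
  \<open>V\<close> in the category argument.\<close>

lemma trunc_bounded:
  assumes a: "a \<in> V"
  shows "\<exists>m::nat. \<forall>F. finite F \<longrightarrow> N (trunc F a) \<le> real m"
proof -
  obtain m where m: "\<And>F. finite F \<Longrightarrow> F \<inter> {..<m} = {} \<Longrightarrow> N (trunc F a) \<le> 1"
    using trunc_tail_small[OF a, of 1] by auto
  define B where "B = Max ((\<lambda>F. N (trunc F a)) ` Pow {..<m})"
  have B: "N (trunc F a) \<le> B" if "F \<subseteq> {..<m}" for F
    unfolding B_def by (rule Max_ge) (use that in auto)
  have "N (trunc F a) \<le> B + 1" if "finite F" for F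
  proof -
    have "trunc F a = (\<lambda>i. trunc (F \<inter> {..<m}) a i + trunc (F - {..<m}) a i)"
      by (auto simp: trunc_def)
    then have "N (trunc F a) \<le> N (trunc (F \<inter> {..<m}) a) + N (trunc (F - {..<m}) a)"
      using N_add[OF V_trunc[of "F \<inter> {..<m}" a] V_trunc[of "F - {..<m}" a]] that by simp
    also have "\<dots> \<le> B + 1" using that by (intro add_mono B m) auto
    finally show ?thesis .
  qed
  moreover obtain k :: nat where "B + 1 \<le> real k" using real_arch_simple by blast
  ultimately show ?thesis by (meson order_trans)
qed

lemma trunc_diff: "trunc F (\<lambda>i. a i - b i) = (\<lambda>i. trunc F a i - trunc F b i)"
  by (auto simp: trunc_def)

lemma trunc_scale: "trunc F (\<lambda>i. c * a i) = (\<lambda>i. c * trunc F a i)"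
  by (auto simp: trunc_def)

text \<open>The Baire half of the open mapping theorem. The sequences whose truncations are bounded
  by \<open>m\<close> form a set that is not known to be closed, because continuity of truncation is
  still open, so category only makes it dense in some ball. Hence the conclusion approximates
  \<open>u\<close> instead of bounding its own truncations.\<close>

lemma approximable:
  "\<exists>K\<ge>0. \<forall>u\<in>V. \<forall>e>0. \<exists>b\<in>V. (\<forall>F. finite F \<longrightarrow> N (trunc F b) \<le> K * N u) \<and> N (\<lambda>i. u i - b i) < e"
proof -
  \<comment> \<open>The value 0 off \<open>V\<close> gives nonnegativity and symmetry for all
    arguments, as \<open>Metric_space\<close> demands; they hold for \<open>N\<close> only on
    \<open>V\<close>.\<close>
  define d where "d a b = (if a \<in> V \<and> b \<in> V then N (\<lambda>i. a i - b i) else 0)" for a b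
  have d: "a \<in> V \<Longrightarrow> b \<in> V \<Longrightarrow> d a b = N (\<lambda>i. a i - b i)" for a b by (simp add: d_def)
  interpret M: Metric_space V d
  proof
    show "0 \<le> d x y" for x y using N_nonneg[OF V_diff] by (simp add: d_def)
    show "d x y = d y x" for x y by (simp add: d_def N_commute[of x y])
    show "(d x y = 0) = (x = y)" if "x \<in> V" "y \<in> V" for x y
      using N_eq_0[OF V_diff[OF that]] N_0 d[OF that] by (auto simp: fun_eq_iff)
    show "d x z \<le> d x y + d y z" if "x \<in> V" "y \<in> V" "z \<in> V" for x y z
      using N_triangle[OF that] that by (simp add: d)
  qed
  have mc: "M.mcomplete"
    unfolding M.mcomplete_def
  proof (intro allI impI)
    fix s assume "M.MCauchy s"
    then have s: "\<And>n. s n \<in> V" and c: "\<And>e. e > 0 \<Longrightarrow> \<exists>M. \<forall>m n. M \<le> m \<longrightarrow> M \<le> n \<longrightarrow> d (s m) (s n) < e"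
      by (auto simp: M.MCauchy_def)
    have "\<exists>a\<in>V. (\<lambda>n. N (\<lambda>i. s n i - a i)) \<longlonglongrightarrow> 0"
    proof (rule complete[OF s])
      fix e :: real assume "e > 0"
      then show "\<exists>M. \<forall>m\<ge>M. \<forall>n\<ge>M. N (\<lambda>i. s m i - s n i) < e"
        using c[of e] s by (auto simp: d)
    qed
    then obtain a where a: "a \<in> V" "(\<lambda>n. N (\<lambda>i. s n i - a i)) \<longlonglongrightarrow> 0" by blast
    then have "limitin M.mtopology s a sequentially"
      using s by (simp add: M.limitin_metric_dist_null d)
    then show "\<exists>x. limitin M.mtopology s x sequentially" by blast
  qed
  define A where "A m = {a \<in> V. \<forall>F. finite F \<longrightarrow> N (trunc F a) \<le> real m}" for m :: nat
  have AV: "A m \<subseteq> V" for m by (auto simp: A_def)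
  have "(\<Union>m. M.mtopology closure_of A m) = V"
  proof
    show "(\<Union>m. M.mtopology closure_of A m) \<subseteq> V"
      using closure_of_subset_topspace[of M.mtopology] by auto
    show "V \<subseteq> (\<Union>m. M.mtopology closure_of A m)"
    proof
      fix a assume a: "a \<in> V"
      then obtain m where "a \<in> A m" using trunc_bounded[OF a] by (auto simp: A_def)
      then show "a \<in> (\<Union>m. M.mtopology closure_of A m)"
        using closure_of_subset[of "A m" M.mtopology] AV[of m] by auto
    qed
  qed
  moreover have "M.mtopology interior_of V = V"
    using interior_of_topspace[of M.mtopology] by simp
  ultimately have nonempty: "M.mtopology interior_of (\<Union>m. M.mtopology closure_of A m) \<noteq> {}"
    using V_0 by auto
  have "\<exists>m. M.mtopology interior_of (M.mtopology closure_of A m) \<noteq> {}"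
  proof (rule ccontr)
    assume "\<not> ?thesis"
    then have "M.mtopology interior_of (\<Union>m. M.mtopology closure_of A m) = {}"
      by (intro M.metric_Baire_category_alt mc) auto
    then show False using nonempty by simp
  qed
  then obtain m c where "c \<in> M.mtopology interior_of (M.mtopology closure_of A m)" by auto
  then obtain r where r: "r > 0" "M.mball c r \<subseteq> M.mtopology closure_of A m" and c: "c \<in> V"
    unfolding M.metric_interior_of by auto
  have near: "\<exists>y\<in>A m. N (\<lambda>i. a i - y i) < e" if "a \<in> V" "N (\<lambda>i. c i - a i) < r" "e > 0" for a e
  proof -
    have "a \<in> M.mtopology closure_of A m"
      using that c by (intro subsetD[OF r(2)]) (simp add: d)
    then obtain y where "y \<in> A m" "y \<in> M.mball a e"
      using \<open>e > 0\<close> unfolding M.metric_closure_of by auto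
    then show ?thesis by (intro bexI[of _ y]) (auto simp: d)
  qed
  \<comment> \<open>Moves the ball from \<open>c\<close> to the origin: approximating both
    \<open>c + u\<close> and \<open>c\<close> and subtracting approximates \<open>u\<close>, at the
    price of doubling the bound \<open>m\<close>.\<close>
  have ball: "\<exists>b\<in>V. (\<forall>F. finite F \<longrightarrow> N (trunc F b) \<le> 2 * real m) \<and> N (\<lambda>i. u i - b i) < e"
    if u: "u \<in> V" "N u < r" and e: "e > 0" for u e
  proof -
    have cu: "(\<lambda>i. c i + u i) \<in> V" using c u by (intro V_add)
    obtain y where y: "y \<in> A m" "N (\<lambda>i. (c i + u i) - y i) < e/2"
      using near[OF cu, of "e/2"] u e N_uminus[OF u(1)] by auto
    obtain z where z: "z \<in> A m" "N (\<lambda>i. c i - z i) < e/2"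
      using near[OF c, of "e/2"] e r N_0 by auto
    have V: "y \<in> V" "z \<in> V" using y z AV by auto
    show ?thesis
    proof (intro bexI[of _ "\<lambda>i. y i - z i"] conjI allI impI)
      show "(\<lambda>i. y i - z i) \<in> V" using V by (rule V_diff)
      fix F :: "nat set" assume F: "finite F"
      have "N (trunc F (\<lambda>i. y i - z i)) \<le> N (trunc F y) + N (trunc F z)"
        unfolding trunc_diff by (intro N_diff V_trunc F)
      also have "\<dots> \<le> real m + real m" using y z F by (intro add_mono) (auto simp: A_def)
      finally show "N (trunc F (\<lambda>i. y i - z i)) \<le> 2 * real m" by simp
    next
      have "N (\<lambda>i. ((c i + u i) - y i) - (c i - z i)) \<le> N (\<lambda>i. (c i + u i) - y i) + N (\<lambda>i. c i - z i)"
        by (intro N_diff V_diff cu V c)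
      moreover have "(\<lambda>i. ((c i + u i) - y i) - (c i - z i)) = (\<lambda>i. u i - (y i - z i))"
        by (simp add: fun_eq_iff)
      ultimately show "N (\<lambda>i. u i - (y i - z i)) < e" using y z by simp
    qed
  qed
  show ?thesis
  \<comment> \<open>Scaling \<open>u\<close> to norm \<open>r / 2\<close> puts it into the ball,
    where the bound is \<open>2 * m\<close>; undoing the scaling multiplies by
    \<open>2 * N u / r\<close>.\<close>
  proof (intro exI[of _ "4 * real m / r"] conjI ballI allI impI)
    show "0 \<le> 4 * real m / r" using r by simp
    fix u and e :: real assume u: "u \<in> V" and e: "e > 0"
    show "\<exists>b\<in>V. (\<forall>F. finite F \<longrightarrow> N (trunc F b) \<le> 4 * real m / r * N u) \<and> N (\<lambda>i. u i - b i) < e"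
    proof (cases "N u = 0")
      case True
      then show ?thesis using e N_0 N_eq_0[OF u True]
        by (intro bexI[of _ "\<lambda>i. 0"]) (auto simp: trunc_def V_0)
    next
      case False
      define t where "t = r / (2 * N u)"
      have t: "t > 0" using False N_nonneg[OF u] r by (simp add: t_def)
      have Nt: "N (\<lambda>i. t * u i) < r" using t False r N_nonneg[OF u] by (simp add: N_scale[OF u]) (simp add: t_def)
      obtain b where b: "b \<in> V" "\<And>F. finite F \<Longrightarrow> N (trunc F b) \<le> 2 * real m" "N (\<lambda>i. t * u i - b i) < t * e"
        using ball[OF V_scale[OF u] Nt, of "t * e"] t e by auto
      show ?thesis
      proof (intro bexI[of _ "\<lambda>i. (1/t) * b i"] conjI allI impI)
        show "(\<lambda>i. (1/t) * b i) \<in> V" by (rule V_scale[OF b(1)])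
        fix F :: "nat set" assume F: "finite F"
        have "N (trunc F (\<lambda>i. (1/t) * b i)) = (1/t) * N (trunc F b)"
          unfolding trunc_scale using t by (subst N_scale) (auto intro: V_trunc F)
        also have "\<dots> \<le> (1/t) * (2 * real m)" using t b(2)[OF F] by (intro mult_left_mono) auto
        also have "\<dots> = 4 * real m / r * N u" by (simp add: t_def)
        finally show "N (trunc F (\<lambda>i. (1/t) * b i)) \<le> 4 * real m / r * N u" .
      next
        have "(\<lambda>i. u i - (1/t) * b i) = (\<lambda>i. (1/t) * (t * u i - b i))"
          using t by (simp add: fun_eq_iff field_simps)
        then have "N (\<lambda>i. u i - (1/t) * b i) = (1/t) * N (\<lambda>i. t * u i - b i)"
          using N_scale[OF V_diff[OF V_scale[OF u] b(1)], of "1/t"] t by simp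
        also have "\<dots> < (1/t) * (t * e)" using b(3) t by (intro mult_strict_left_mono) auto
        finally show "N (\<lambda>i. u i - (1/t) * b i) < e" using t by simp
      qed
    qed
  qed
qed

lemma trunc_sum: "trunc F (\<lambda>i. \<Sum>j\<in>J. s j i) = (\<lambda>i. \<Sum>j\<in>J. trunc F (s j) i)"
  by (auto simp: trunc_def)

text \<open>The bound depends on \<open>F\<close>, but it suffices to turn coordinatewise
  convergence into \<open>N\<close>-convergence on a fixed finite set.\<close>

lemma N_trunc_le:
  assumes "finite F"
  shows "N (trunc F a) \<le> (\<Sum>j\<in>F. \<bar>a j\<bar> * N (trunc {j} (\<lambda>_. 1)))"
proof -
  have "trunc F a = (\<lambda>i. \<Sum>j\<in>F. a j * trunc {j} (\<lambda>_. 1) i)"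
  proof
    fix i
    have "(\<Sum>j\<in>F. a j * trunc {j} (\<lambda>_. 1) i) = (\<Sum>j\<in>F. if j = i then a j else 0)"
      by (rule sum.cong) (auto simp: trunc_def)
    then show "trunc F a i = (\<Sum>j\<in>F. a j * trunc {j} (\<lambda>_. 1) i)"
      using assms by (simp add: trunc_def)
  qed
  then have "N (trunc F a) \<le> (\<Sum>j\<in>F. N (\<lambda>i. a j * trunc {j} (\<lambda>_. 1) i))"
    using N_sum[of F "\<lambda>j i. a j * trunc {j} (\<lambda>_. 1) i"] V_scale V_trunc by simp
  also have "\<dots> = (\<Sum>j\<in>F. \<bar>a j\<bar> * N (trunc {j} (\<lambda>_. 1)))"
    by (intro sum.cong refl N_scale V_trunc) auto
  finally show ?thesis .
qed

lemma N_unit_pos: "0 < N (trunc {j} (\<lambda>_. 1))"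
proof -
  have V: "trunc {j} (\<lambda>_. 1) \<in> V" by (intro V_trunc) simp
  have "trunc {j} (\<lambda>_. 1) j \<noteq> 0" by (simp add: trunc_def)
  then have "N (trunc {j} (\<lambda>_. 1)) \<noteq> 0" using N_eq_0[OF V] by force
  then show ?thesis using N_nonneg[OF V] by simp
qed

text \<open>The open mapping argument: successive approximation writes \<open>u\<close> as an \<open>N\<close>-convergent
  series whose terms have geometrically small truncations, and uniqueness of the expansion
  identifies the coefficientwise sum of the series with \<open>u\<close>.\<close>

theorem trunc_uniformly_bounded:
  "\<exists>K>0. \<forall>u\<in>V. \<forall>F. finite F \<longrightarrow> N (trunc F u) \<le> K * N u"
proof -
  obtain K where K: "K \<ge> 0" and app: "\<And>u e. u \<in> V \<Longrightarrow> e > 0 \<Longrightarrow>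
      \<exists>b\<in>V. (\<forall>F. finite F \<longrightarrow> N (trunc F b) \<le> K * N u) \<and> N (\<lambda>i. u i - b i) < e"
    using approximable by blast
  \<comment> \<open>The argument yields \<open>2 * K\<close>; the extra 1 keeps the constant
    positive when \<open>K = 0\<close>.\<close>
  have "N (trunc F u) \<le> (2 * K + 1) * N u" if u: "u \<in> V" and F: "finite F" for u F
  proof (cases "N u = 0")
    case True
    then show ?thesis using N_eq_0[OF u True] N_0 by (simp add: trunc_def)
  next
    case False
    define \<nu> where "\<nu> = N u"
    have \<nu>: "\<nu> > 0" using False N_nonneg[OF u] by (simp add: \<nu>_def)
    define B where "B v e = (SOME b. b \<in> V \<and> (\<forall>F. finite F \<longrightarrow> N (trunc F b) \<le> K * N v)
        \<and> N (\<lambda>i. v i - b i) < e)" for v e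
    have B: "B v e \<in> V \<and> (\<forall>F. finite F \<longrightarrow> N (trunc F (B v e)) \<le> K * N v) \<and> N (\<lambda>i. v i - B v e i) < e"
      if "v \<in> V" "e > 0" for v e
    proof -
      have "\<exists>b. b \<in> V \<and> (\<forall>F. finite F \<longrightarrow> N (trunc F b) \<le> K * N v) \<and> N (\<lambda>i. v i - b i) < e"
        using app[OF that] by blast
      from someI_ex[OF this] show ?thesis unfolding B_def .
    qed
    have BV: "\<And>v e. v \<in> V \<Longrightarrow> e > 0 \<Longrightarrow> B v e \<in> V"
      and BK: "\<And>v e F. v \<in> V \<Longrightarrow> e > 0 \<Longrightarrow> finite F \<Longrightarrow> N (trunc F (B v e)) \<le> K * N v"
      and Be: "\<And>v e. v \<in> V \<Longrightarrow> e > 0 \<Longrightarrow> N (\<lambda>i. v i - B v e i) < e"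
      using B by blast+
    \<comment> \<open>Remainders: each is the previous one minus an approximant good enough to halve
      the bound on its norm.\<close>
    define w where "w = rec_nat u (\<lambda>n v i. v i - B v (\<nu> / 2 ^ Suc n) i)"
    have w0: "w 0 = u" and wS: "w (Suc n) = (\<lambda>i. w n i - B (w n) (\<nu> / 2 ^ Suc n) i)" for n
      by (simp_all add: w_def)
    have wV: "w n \<in> V" for n
      by (induction n) (use u \<nu> in \<open>auto simp: w0 wS intro!: V_diff BV\<close>)
    have wN: "N (w n) \<le> \<nu> / 2 ^ n" for n
    proof (cases n)
      case 0 then show ?thesis by (simp add: w0 \<nu>_def)
    next
      case (Suc k)
      then show ?thesis using Be[OF wV[of k], of "\<nu> / 2 ^ Suc k"] \<nu> by (simp add: wS)
    qed
    define b where "b n = B (w n) (\<nu> / 2 ^ Suc n)" for n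
    have bV: "b n \<in> V" for n using BV[OF wV] \<nu> by (simp add: b_def)
    have bN: "N (trunc F (b n)) \<le> K * \<nu> / 2 ^ n" if "finite F" for F n
    proof -
      have "N (trunc F (b n)) \<le> K * N (w n)" using BK[OF wV _ that] \<nu> by (simp add: b_def)
      also have "\<dots> \<le> K * (\<nu> / 2 ^ n)" using K wN by (intro mult_left_mono)
      finally show ?thesis by simp
    qed
    define s where "s J = (\<lambda>i. \<Sum>n<J. b n i)" for J
    have sV: "s J \<in> V" for J unfolding s_def using bV by (intro V_sum)
    have ws: "w J = (\<lambda>i. u i - s J i)" for J
    proof (induction J)
      case (Suc J)
      have "w (Suc J) = (\<lambda>i. w J i - b J i)" by (simp only: wS b_def)
      also have "\<dots> = (\<lambda>i. u i - s (Suc J) i)" unfolding Suc by (simp add: s_def algebra_simps)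
      finally show ?case .
    qed (simp add: w0 s_def)
    \<comment> \<open>Truncation to a single index bounds each coefficient by a geometric sequence,
      so the coefficientwise sum exists before anything is known about its norm.\<close>
    have coord: "summable (\<lambda>n. b n i)" for i
    proof (rule summable_comparison_test')
      have gs: "summable (\<lambda>n. (1/2::real) ^ n)" by (intro summable_geometric) auto
      show "summable (\<lambda>n. K * \<nu> / N (trunc {i} (\<lambda>_. 1)) * (1/2) ^ n)" by (intro summable_mult gs)
      fix n
      have "trunc {i} (b n) = (\<lambda>j. b n i * trunc {i} (\<lambda>_. 1) j)" by (auto simp: trunc_def)
      then have "\<bar>b n i\<bar> * N (trunc {i} (\<lambda>_. 1)) \<le> K * \<nu> / 2 ^ n"
        using bN[of "{i}" n] N_scale[OF V_trunc[of "{i}" "\<lambda>_. 1"], of "b n i"] by simp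
      then show "norm (b n i) \<le> K * \<nu> / N (trunc {i} (\<lambda>_. 1)) * (1/2) ^ n"
        using N_unit_pos[of i] by (simp add: field_simps power_divide)
    qed
    define \<beta> where "\<beta> i = (\<Sum>n. b n i)" for i
    have lim: "(\<lambda>L. s L i) \<longlonglongrightarrow> \<beta> i" for i
      using summable_LIMSEQ[OF coord] by (simp add: \<beta>_def s_def)
    have tail: "N (trunc F (\<lambda>i. s L i - s J i)) \<le> 2 * K * \<nu> / 2 ^ J" if F: "finite F" and "J \<le> L" for F L J
    proof -
      have "(\<lambda>i. s L i - s J i) = (\<lambda>i. \<Sum>n\<in>{J..<L}. b n i)"
        using sum_diff_nat_ivl[of 0 J L "\<lambda>n. b n i" for i] \<open>J \<le> L\<close> by (simp add: s_def lessThan_atLeast0)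
      then have "N (trunc F (\<lambda>i. s L i - s J i)) \<le> (\<Sum>n\<in>{J..<L}. N (trunc F (b n)))"
        using N_sum[of "{J..<L}" "\<lambda>n. trunc F (b n)"] V_trunc[OF F] by (simp add: trunc_sum)
      also have "\<dots> \<le> (\<Sum>n\<in>{J..<L}. K * \<nu> / 2 ^ n)" using bN[OF F] by (intro sum_mono)
      also have "\<dots> = 2 * K * \<nu> / 2 ^ J - 2 * K * \<nu> / 2 ^ L"
        using \<open>J \<le> L\<close>
      proof (induction L rule: dec_induct)
        case (step n)
        have "2 * K * \<nu> / 2 ^ n = K * \<nu> / 2 ^ n + K * \<nu> / 2 ^ n" "2 * K * \<nu> / 2 ^ Suc n = K * \<nu> / 2 ^ n"
          by simp_all
        then show ?case using step by (simp del: power_Suc)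
      qed simp
      also have "\<dots> \<le> 2 * K * \<nu> / 2 ^ J" using K \<nu> by simp
      finally show ?thesis .
    qed
    \<comment> \<open>The bound \<open>tail\<close> is uniform in \<open>L\<close>, and on the
      finite set \<open>F\<close> the passage from \<open>s L\<close> to \<beta> costs only finitely
      many coordinate errors.\<close>
    have tail_lim: "N (trunc F (\<lambda>i. \<beta> i - s J i)) \<le> 2 * K * \<nu> / 2 ^ J" if F: "finite F" for F J
    proof (rule tendsto_lowerbound)
      have "(\<lambda>L. 2 * K * \<nu> / 2 ^ J + (\<Sum>j\<in>F. \<bar>\<beta> j - s L j\<bar> * N (trunc {j} (\<lambda>_. 1))))
          \<longlonglongrightarrow> 2 * K * \<nu> / 2 ^ J + (\<Sum>j\<in>F. \<bar>\<beta> j - \<beta> j\<bar> * N (trunc {j} (\<lambda>_. 1)))"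
        by (intro tendsto_intros lim)
      then show "(\<lambda>L. 2 * K * \<nu> / 2 ^ J + (\<Sum>j\<in>F. \<bar>\<beta> j - s L j\<bar> * N (trunc {j} (\<lambda>_. 1)))) \<longlonglongrightarrow> 2 * K * \<nu> / 2 ^ J"
        by simp
      show "\<forall>\<^sub>F L in sequentially. N (trunc F (\<lambda>i. \<beta> i - s J i))
          \<le> 2 * K * \<nu> / 2 ^ J + (\<Sum>j\<in>F. \<bar>\<beta> j - s L j\<bar> * N (trunc {j} (\<lambda>_. 1)))"
      proof (rule eventually_sequentiallyI[of J])
        fix L assume "J \<le> L"
        have "trunc F (\<lambda>i. \<beta> i - s J i) = (\<lambda>i. trunc F (\<lambda>i. s L i - s J i) i + trunc F (\<lambda>i. \<beta> i - s L i) i)"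
          by (auto simp: trunc_def)
        then have "N (trunc F (\<lambda>i. \<beta> i - s J i)) \<le> N (trunc F (\<lambda>i. s L i - s J i)) + N (trunc F (\<lambda>i. \<beta> i - s L i))"
          using N_add[OF V_trunc[OF F] V_trunc[OF F]] by simp
        then show "N (trunc F (\<lambda>i. \<beta> i - s J i))
          \<le> 2 * K * \<nu> / 2 ^ J + (\<Sum>j\<in>F. \<bar>\<beta> j - s L j\<bar> * N (trunc {j} (\<lambda>_. 1)))"
          using tail[OF F \<open>J \<le> L\<close>] N_trunc_le[OF F, of "\<lambda>i. \<beta> i - s L i"] by linarith
      qed
    qed simp
    have "\<beta> = u"
    proof (rule uniq[OF u])
      fix \<sigma> :: "nat \<Rightarrow> nat" assume \<sigma>: "bij \<sigma>"
      show "(\<lambda>n. N (\<lambda>i. u i - trunc (\<sigma> ` {..<n}) \<beta> i)) \<longlonglongrightarrow> 0"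
      proof (rule LIMSEQ_I)
        fix e :: real assume e: "e > 0"
        have "(\<lambda>J. (\<nu> + 2 * K * \<nu>) * (1/2) ^ J) \<longlonglongrightarrow> (\<nu> + 2 * K * \<nu>) * 0"
          by (intro tendsto_intros LIMSEQ_power_zero) auto
        then have small_ev: "\<forall>\<^sub>F J in sequentially. (\<nu> + 2 * K * \<nu>) * (1/2) ^ J < e/2"
          using order_tendstoD(2)[of _ 0 sequentially "e/2"] e by simp
        have J_eq: "(\<nu> + 2 * K * \<nu>) * (1/2) ^ J = \<nu> / 2 ^ J + 2 * K * \<nu> / 2 ^ J" for J
          by (simp add: power_divide add_divide_distrib)
        \<comment> \<open>\<open>J\<close> is fixed before \<open>n\<close>. The remainder
          \<open>w J\<close> and the truncations of \<beta> minus \<open>s J\<close> are small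
          uniformly in \<open>n\<close>; only the middle term, the expansion of the single sequence
          \<open>s J\<close>, needs \<open>n\<close> large.\<close>
        obtain J where J: "(\<nu> + 2 * K * \<nu>) * (1/2) ^ J < e/2"
          using small_ev by (auto simp: eventually_sequentially)
        have "\<forall>\<^sub>F n in sequentially. N (\<lambda>i. s J i - trunc (\<sigma> ` {..<n}) (s J) i) < e/2"
          using order_tendstoD(2)[OF conv[OF sV \<sigma>], of "e/2" J] e by simp
        then obtain n0 where n0: "\<And>n. n \<ge> n0 \<Longrightarrow> N (\<lambda>i. s J i - trunc (\<sigma> ` {..<n}) (s J) i) < e/2"
          by (auto simp: eventually_sequentially)
        show "\<exists>n0. \<forall>n\<ge>n0. norm (N (\<lambda>i. u i - trunc (\<sigma> ` {..<n}) \<beta> i) - 0) < e"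
        proof (intro exI[of _ n0] allI impI)
          fix n assume "n \<ge> n0"
          define G where "G = \<sigma> ` {..<n}"
          have G: "finite G" by (simp add: G_def)
          have "N (\<lambda>i. u i - trunc G \<beta> i) \<le> N (\<lambda>i. u i - s J i) + N (\<lambda>i. s J i - trunc G \<beta> i)"
            by (intro N_triangle u sV V_trunc G)
          moreover have "N (\<lambda>i. s J i - trunc G \<beta> i)
              \<le> N (\<lambda>i. s J i - trunc G (s J) i) + N (\<lambda>i. trunc G (s J) i - trunc G \<beta> i)"
            by (intro N_triangle sV V_trunc G)
          moreover have "N (\<lambda>i. trunc G (s J) i - trunc G \<beta> i) = N (trunc G (\<lambda>i. \<beta> i - s J i))"
            using N_commute[OF V_trunc[OF G] V_trunc[OF G]] by (simp add: trunc_diff)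
          moreover have "N (\<lambda>i. u i - s J i) = N (w J)" by (simp add: ws)
          ultimately have "N (\<lambda>i. u i - trunc G \<beta> i) < e"
            using wN[of J] tail_lim[OF G, of J] n0[OF \<open>n \<ge> n0\<close>, folded G_def] J J_eq[of J] by linarith
          then show "norm (N (\<lambda>i. u i - trunc (\<sigma> ` {..<n}) \<beta> i) - 0) < e"
            using N_nonneg[OF V_diff[OF u V_trunc[OF G]]] by (simp add: G_def)
        qed
      qed
    qed
    \<comment> \<open>At \<open>J = 0\<close> the partial sum \<open>s 0\<close> vanishes, so the
      tail is the whole sequence.\<close>
    then have "N (trunc F u) \<le> 2 * K * N u"
      using tail_lim[OF F, of 0] by (simp add: s_def \<nu>_def)
    then show ?thesis using \<nu> by (simp add: \<nu>_def algebra_simps)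
  qed
  then show ?thesis using K by (intro exI[of _ "2 * K + 1"]) auto
qed

end

section \<open>The spaces \<open>L\<^sub>p\<close>\<close>

definition Lp_int :: "real \<Rightarrow> (real \<Rightarrow> real) \<Rightarrow> real" where
  "Lp_int p f = (\<integral>x. \<bar>f x\<bar> powr p \<partial>lborel)"

lemma Lp_int_nonneg: "0 \<le> Lp_int p f"
  by (simp add: Lp_int_def)

lemma Lp_norm_nonneg: "0 \<le> Lp_norm p f"
  by (simp add: Lp_norm_def)

lemma Lp_norm_powr: "p > 0 \<Longrightarrow> Lp_norm p f powr p = Lp_int p f"
  by (simp add: Lp_norm_def Lp_int_def powr_powr)

lemma Lp_norm_eq: "Lp_norm p f = Lp_int p f powr (1 / p)"
  by (simp add: Lp_norm_def Lp_int_def)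

lemma LpD [measurable_dest]: "f \<in> Lp p \<Longrightarrow> f \<in> borel_measurable lborel"
  by (simp add: Lp_def)

lemma Lp_integrable: "f \<in> Lp p \<Longrightarrow> integrable lborel (\<lambda>x. \<bar>f x\<bar> powr p)"
  by (simp add: Lp_def)

lemma abs_add_powr_le:
  fixes a b :: real
  assumes "p > 0"
  shows "\<bar>a + b\<bar> powr p \<le> 2 powr p * (\<bar>a\<bar> powr p + \<bar>b\<bar> powr p)"
proof -
  have "\<bar>a + b\<bar> powr p \<le> (2 * max \<bar>a\<bar> \<bar>b\<bar>) powr p"
    using assms by (intro powr_mono2) auto
  also have "\<dots> = 2 powr p * max \<bar>a\<bar> \<bar>b\<bar> powr p" by (simp add: powr_mult)
  also have "max \<bar>a\<bar> \<bar>b\<bar> powr p \<le> \<bar>a\<bar> powr p + \<bar>b\<bar> powr p" by (simp add: max_def)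
  finally show ?thesis by simp
qed

lemma Lp_bounded_by:
  assumes "f \<in> borel_measurable lborel" "integrable lborel g" "\<And>x. \<bar>f x\<bar> powr p \<le> g x"
  shows "f \<in> Lp p"
proof -
  have "integrable lborel (\<lambda>x. \<bar>f x\<bar> powr p)"
  proof (rule Bochner_Integration.integrable_bound[OF assms(2)])
    show "(\<lambda>x. \<bar>f x\<bar> powr p) \<in> borel_measurable lborel" using assms(1) by measurable
    show "AE x in lborel. norm (\<bar>f x\<bar> powr p) \<le> norm (g x)"
      using assms(3) by (auto intro!: AE_I2 intro: order_trans[OF _ abs_ge_self])
  qed
  then show ?thesis using assms by (simp add: Lp_def)
qed

lemma Lp_0: "(\<lambda>x. 0) \<in> Lp p"
  by (rule Lp_bounded_by[of _ "\<lambda>_. 0"]) auto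

lemma Lp_add:
  assumes "p > 0" "f \<in> Lp p" "g \<in> Lp p"
  shows "(\<lambda>x. f x + g x) \<in> Lp p"
proof (rule Lp_bounded_by)
  show "(\<lambda>x. f x + g x) \<in> borel_measurable lborel" using assms by measurable
  show "integrable lborel (\<lambda>x. 2 powr p * (\<bar>f x\<bar> powr p + \<bar>g x\<bar> powr p))"
    using assms by (intro integrable_mult_right Bochner_Integration.integrable_add Lp_integrable)
qed (use abs_add_powr_le assms in auto)

lemma Lp_scale:
  assumes "f \<in> Lp p"
  shows "(\<lambda>x. c * f x) \<in> Lp p"
proof (rule Lp_bounded_by)
  show "(\<lambda>x. c * f x) \<in> borel_measurable lborel" using assms by measurable
  show "integrable lborel (\<lambda>x. \<bar>c\<bar> powr p * \<bar>f x\<bar> powr p)"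
    using assms by (intro integrable_mult_right Lp_integrable)
qed (simp add: abs_mult powr_mult)

lemma Lp_diff:
  assumes "p > 0" "f \<in> Lp p" "g \<in> Lp p"
  shows "(\<lambda>x. f x - g x) \<in> Lp p"
  using Lp_add[OF assms(1,2) Lp_scale[OF assms(3), of "-1"]] by simp

lemma Lp_sum:
  assumes "p > 0" "\<And>i. i \<in> I \<Longrightarrow> f i \<in> Lp p"
  shows "(\<lambda>x. \<Sum>i\<in>I. f i x) \<in> Lp p"
  using assms(2) by (induction I rule: infinite_finite_induct) (auto simp: Lp_0 Lp_add assms(1))

lemma Lp_int_scale: "Lp_int p (\<lambda>x. c * f x) = \<bar>c\<bar> powr p * Lp_int p f"
  by (simp add: Lp_int_def abs_mult powr_mult)

lemma Lp_norm_scale: "p > 0 \<Longrightarrow> Lp_norm p (\<lambda>x. c * f x) = \<bar>c\<bar> * Lp_norm p f"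
  by (simp add: Lp_norm_eq Lp_int_scale powr_mult Lp_int_nonneg powr_powr)

section \<open>Convexity and the triangle inequality\<close>

lemma powr_convex_nonneg:
  fixes a b t :: real
  assumes "p \<ge> 1" "0 \<le> a" "0 \<le> b" "0 \<le> t" "t \<le> 1"
  shows "(t * a + (1 - t) * b) powr p \<le> t * a powr p + (1 - t) * b powr p"
proof -
  have scal: "(s * c) powr p \<le> s * c powr p" if "0 \<le> s" "s \<le> 1" "0 \<le> c" for s c :: real
  proof -
    have "s powr p \<le> s powr 1" using that assms by (intro powr_mono') auto
    then show ?thesis using that by (auto simp: powr_mult intro!: mult_right_mono)
  qed
  consider "a = 0" | "b = 0" | "a > 0" "b > 0" using assms by linarith
  then show ?thesis
  proof cases
    case 3
    then show ?thesis
      using convex_onD[OF powr_convex[OF assms(1)], of "1 - t" a b] assms by simp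
  qed (use scal[of "1 - t" b] scal[of t a] assms in auto)
qed

text \<open>Convexity of the \<open>p\<close>-th power with weights proportional to \<alpha> and
  \<beta>. Strict upper bounds replace the norms themselves because they are positive even for a
  null function, so both functions can be normalised by division.\<close>

lemma Minkowski_aux:
  assumes p: "p \<ge> 1" and f: "f \<in> Lp p" and g: "g \<in> Lp p"
    and \<alpha>: "Lp_norm p f < \<alpha>" and \<beta>: "Lp_norm p g < \<beta>"
  shows "Lp_norm p (\<lambda>x. f x + g x) \<le> \<alpha> + \<beta>"
proof -
  have pos: "\<alpha> > 0" "\<beta> > 0" using \<alpha> \<beta> Lp_norm_nonneg[of p f] Lp_norm_nonneg[of p g] by linarith+
  define t where "t = \<alpha> / (\<alpha> + \<beta>)"
  have t: "0 \<le> t" "t \<le> 1" "1 - t = \<beta> / (\<alpha> + \<beta>)" using pos by (auto simp: t_def field_simps)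
  have If: "Lp_int p f \<le> \<alpha> powr p" "Lp_int p g \<le> \<beta> powr p"
    using powr_mono2[of p "Lp_norm p f" \<alpha>] powr_mono2[of p "Lp_norm p g" \<beta>] p \<alpha> \<beta>
    by (simp_all add: Lp_norm_nonneg Lp_norm_powr)
  let ?h = "\<lambda>x. (\<alpha> + \<beta>) powr p * (t / \<alpha> powr p * \<bar>f x\<bar> powr p + (1 - t) / \<beta> powr p * \<bar>g x\<bar> powr p)"
  have int: "integrable lborel ?h"
    using f g by (intro integrable_mult_right Bochner_Integration.integrable_add Lp_integrable)
  have "Lp_int p (\<lambda>x. f x + g x) \<le> (\<integral>x. ?h x \<partial>lborel)"
    unfolding Lp_int_def
  proof (rule integral_mono)
    show "integrable lborel (\<lambda>x. \<bar>f x + g x\<bar> powr p)"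
      using p by (intro Lp_integrable Lp_add f g) simp
    fix x
    have "\<bar>f x + g x\<bar> powr p \<le> (\<bar>f x\<bar> + \<bar>g x\<bar>) powr p" using p by (intro powr_mono2) auto
    also have "\<bar>f x\<bar> + \<bar>g x\<bar> = (\<alpha> + \<beta>) * (t * (\<bar>f x\<bar> / \<alpha>) + (1 - t) * (\<bar>g x\<bar> / \<beta>))"
      unfolding t(3) using pos by (simp add: t_def distrib_left)
    also have "\<dots> powr p = (\<alpha> + \<beta>) powr p * (t * (\<bar>f x\<bar> / \<alpha>) + (1 - t) * (\<bar>g x\<bar> / \<beta>)) powr p"
      using pos t by (intro powr_mult)
    also have "\<dots> \<le> (\<alpha> + \<beta>) powr p * (t * (\<bar>f x\<bar> / \<alpha>) powr p + (1 - t) * (\<bar>g x\<bar> / \<beta>) powr p)"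
      using pos t p by (intro mult_left_mono powr_convex_nonneg) auto
    also have "\<dots> = ?h x" using pos by (simp add: powr_divide)
    finally show "\<bar>f x + g x\<bar> powr p \<le> ?h x" .
  qed (rule int)
  also have "\<dots> = (\<alpha> + \<beta>) powr p * (t / \<alpha> powr p * Lp_int p f + (1 - t) / \<beta> powr p * Lp_int p g)"
    using f g by (simp add: Lp_int_def Bochner_Integration.integral_add Lp_integrable)
  also have "\<dots> \<le> (\<alpha> + \<beta>) powr p * (t / \<alpha> powr p * \<alpha> powr p + (1 - t) / \<beta> powr p * \<beta> powr p)"
    using t(1,2) by (intro mult_left_mono add_mono If) auto
  also have "\<dots> = (\<alpha> + \<beta>) powr p" using pos by simp
  finally have "Lp_norm p (\<lambda>x. f x + g x) \<le> ((\<alpha> + \<beta>) powr p) powr (1 / p)"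
    unfolding Lp_norm_eq using p by (intro powr_mono2) (auto simp: Lp_int_nonneg)
  then show ?thesis using p pos by (simp add: powr_powr)
qed

theorem Minkowski:
  assumes "p \<ge> 1" "f \<in> Lp p" "g \<in> Lp p"
  shows "Lp_norm p (\<lambda>x. f x + g x) \<le> Lp_norm p f + Lp_norm p g"
proof (rule field_le_epsilon)
  fix e :: real assume "e > 0"
  then show "Lp_norm p (\<lambda>x. f x + g x) \<le> Lp_norm p f + Lp_norm p g + e"
    using Minkowski_aux[OF assms, of "Lp_norm p f + e/2" "Lp_norm p g + e/2"] by simp
qed

lemma Lp_norm_uminus: "p > 0 \<Longrightarrow> Lp_norm p (\<lambda>x. - f x) = Lp_norm p f"
  using Lp_norm_scale[of p "-1" f] by simp

lemma Lp_norm_minus_commute: "Lp_norm p (\<lambda>x. f x - g x) = Lp_norm p (\<lambda>x. g x - f x)"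
  by (simp add: Lp_norm_def abs_minus_commute)

lemma Lp_norm_diff_le:
  assumes "p \<ge> 1" "f \<in> Lp p" "g \<in> Lp p"
  shows "Lp_norm p (\<lambda>x. f x - g x) \<le> Lp_norm p f + Lp_norm p g"
  using Minkowski[OF assms(1,2) Lp_scale[OF assms(3), of "-1"]] Lp_norm_uminus[of p g] assms(1) by simp

lemma Lp_norm_triangle:
  assumes "p \<ge> 1" "f \<in> Lp p" "g \<in> Lp p" "h \<in> Lp p"
  shows "Lp_norm p (\<lambda>x. f x - h x) \<le> Lp_norm p (\<lambda>x. f x - g x) + Lp_norm p (\<lambda>x. g x - h x)"
  using Minkowski[OF assms(1) Lp_diff[of p f g] Lp_diff[of p g h]] assms by simp

lemma Lp_norm_0: "Lp_norm p (\<lambda>x. 0) = 0"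
  by (simp add: Lp_norm_def)

lemma Lp_norm_sum:
  assumes "p \<ge> 1" "\<And>i. i \<in> I \<Longrightarrow> f i \<in> Lp p"
  shows "Lp_norm p (\<lambda>x. \<Sum>i\<in>I. f i x) \<le> (\<Sum>i\<in>I. Lp_norm p (f i))"
  using assms(2)
proof (induction I rule: infinite_finite_induct)
  case (insert i I)
  then show ?case
    using Minkowski[OF assms(1), of "f i" "\<lambda>x. \<Sum>i\<in>I. f i x"] Lp_sum[of p I f] assms(1) by simp
qed (auto simp: Lp_norm_0)

lemma Lp_norm_less_iff:
  assumes "p > 0" "e > 0"
  shows "Lp_norm p f < e \<longleftrightarrow> Lp_int p f < e powr p"
proof
  assume "Lp_norm p f < e"
  then show "Lp_int p f < e powr p"
    using powr_less_mono2[of p "Lp_norm p f" e] assms by (simp add: Lp_norm_nonneg Lp_norm_powr)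
next
  assume "Lp_int p f < e powr p"
  then show "Lp_norm p f < e"
    using powr_less_mono2[of "1/p" "Lp_int p f" "e powr p"] assms
    by (simp add: Lp_int_nonneg Lp_norm_eq powr_powr)
qed

lemma Lp_norm_le_iff:
  assumes "p > 0" "e \<ge> 0"
  shows "Lp_norm p f \<le> e \<longleftrightarrow> Lp_int p f \<le> e powr p"
proof
  assume "Lp_norm p f \<le> e"
  then show "Lp_int p f \<le> e powr p"
    using powr_mono2[of p "Lp_norm p f" e] assms by (simp add: Lp_norm_nonneg Lp_norm_powr)
next
  assume "Lp_int p f \<le> e powr p"
  then show "Lp_norm p f \<le> e"
    using powr_mono2[of "1/p" "Lp_int p f" "e powr p"] assms
    by (simp add: Lp_int_nonneg Lp_norm_eq powr_powr)
qed

section \<open>Completeness and approximation by simple functions\<close>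

lemma Lp_nn_integral:
  assumes "f \<in> Lp p"
  shows "(\<integral>\<^sup>+x. ennreal (\<bar>f x\<bar> powr p) \<partial>lborel) = ennreal (Lp_int p f)"
  unfolding Lp_int_def by (rule nn_integral_eq_integral[OF Lp_integrable[OF assms]]) simp

lemma Lp_of_nn_integral:
  assumes "f \<in> borel_measurable lborel" "(\<integral>\<^sup>+x. ennreal (\<bar>f x\<bar> powr p) \<partial>lborel) \<le> ennreal c" "c \<ge> 0"
  shows "f \<in> Lp p" "Lp_int p f \<le> c"
proof -
  have m: "(\<lambda>x. \<bar>f x\<bar> powr p) \<in> borel_measurable lborel" using assms(1) by measurable
  show f: "f \<in> Lp p"
    using assms(1) integrableI_bounded[OF m] le_less_trans[OF assms(2) ennreal_less_top] by (simp add: Lp_def)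
  show "Lp_int p f \<le> c" using assms(2,3) unfolding Lp_nn_integral[OF f] by simp
qed

text \<open>A rapidly Cauchy subsequence converges almost everywhere, and Fatou's lemma turns the
  pointwise limit into a limit in norm.\<close>

theorem Lp_complete:
  assumes p: "p \<ge> 1" and g: "\<And>n. g n \<in> Lp p"
    and cauchy: "\<And>e. e > 0 \<Longrightarrow> \<exists>M. \<forall>m\<ge>M. \<forall>n\<ge>M. Lp_norm p (\<lambda>x. g m x - g n x) < e"
  shows "\<exists>h\<in>Lp p. (\<lambda>n. Lp_norm p (\<lambda>x. g n x - h x)) \<longlonglongrightarrow> 0"
proof -
  have p0: "p > 0" using p by simp
  \<comment> \<open>The rate \<open>1/4\<close> leaves room for the weight \<open>2 ^ k\<close>: the
    weighted integrals still sum like \<open>(1/2) ^ k\<close>.\<close>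
  have "\<exists>M. \<forall>m\<ge>M. \<forall>n\<ge>M. Lp_int p (\<lambda>x. g m x - g n x) < (1/4) ^ k" for k :: nat
    using cauchy[of "((1/4) ^ k) powr (1/p)"] p0 by (simp add: Lp_norm_less_iff powr_powr)
  then obtain M where M: "\<And>k m n. m \<ge> M k \<Longrightarrow> n \<ge> M k \<Longrightarrow> Lp_int p (\<lambda>x. g m x - g n x) < (1/4) ^ k"
    by metis
  \<comment> \<open>Cumulative sums make the thresholds monotone while staying above each
    \<open>M k\<close>.\<close>
  define r where "r k = (\<Sum>i\<le>k. M i)" for k
  have r: "M k \<le> r k" "r k \<le> r (Suc k)" for k
    unfolding r_def by (auto intro: member_le_sum)
  have r_mono: "r j \<le> r k" if "j \<le> k" for j k using that r(2) by (rule lift_Suc_mono_le[rotated])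
  define u where "u k x = \<bar>g (r (Suc k)) x - g (r k) x\<bar> powr p" for k x
  have [measurable]: "g n \<in> borel_measurable lborel" for n using g by (rule LpD)
  have um [measurable]: "u k \<in> borel_measurable lborel" for k unfolding u_def by measurable
  have "(\<integral>\<^sup>+x. (\<Sum>k. ennreal (2 ^ k * u k x)) \<partial>lborel) = (\<Sum>k. \<integral>\<^sup>+x. ennreal (2 ^ k * u k x) \<partial>lborel)"
    by (rule nn_integral_suminf) measurable
  also have "\<dots> \<le> (\<Sum>k. ennreal ((1/2) ^ k))"
  proof (rule suminf_le)
    fix k
    have "(\<integral>\<^sup>+x. ennreal (2 ^ k * u k x) \<partial>lborel) = 2 ^ k * (\<integral>\<^sup>+x. ennreal (u k x) \<partial>lborel)"
      by (subst nn_integral_cmult[symmetric]) (auto simp: ennreal_mult u_def simp flip: ennreal_power)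
    also have "(\<integral>\<^sup>+x. ennreal (u k x) \<partial>lborel) = ennreal (Lp_int p (\<lambda>x. g (r (Suc k)) x - g (r k) x))"
      unfolding u_def using p0 g by (intro Lp_nn_integral Lp_diff)
    also have "\<dots> \<le> ennreal ((1/4) ^ k)"
      using M[of k "r (Suc k)" "r k"] r[of k] by (intro ennreal_leI less_imp_le) auto
    also have "2 ^ k * ennreal ((1/4) ^ k) = ennreal (2 ^ k * (1/4) ^ k)"
      by (simp add: ennreal_mult flip: ennreal_power)
    also have "(2::real) ^ k * (1/4) ^ k = (1/2) ^ k"
      by (simp add: power_mult_distrib[symmetric])
    finally show "(\<integral>\<^sup>+x. ennreal (2 ^ k * u k x) \<partial>lborel) \<le> ennreal ((1/2) ^ k)"
      by (simp add: mult_left_mono)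
  qed auto
  also have "\<dots> = ennreal (\<Sum>k. (1/2) ^ k)"
    by (intro suminf_ennreal2 summable_geometric) auto
  also have "\<dots> < top" by simp
  finally have fin: "(\<integral>\<^sup>+x. (\<Sum>k. ennreal (2 ^ k * u k x)) \<partial>lborel) < top" .
  have AE_fin: "AE x in lborel. (\<Sum>k. ennreal (2 ^ k * u k x)) \<noteq> \<infinity>"
    using fin by (intro nn_integral_PInf_AE) auto
  have conv: "convergent (\<lambda>k. g (r k) x)" if "(\<Sum>k. ennreal (2 ^ k * u k x)) \<noteq> \<infinity>" for x
  proof -
    have "summable (\<lambda>k. 2 ^ k * u k x)"
      using that by (intro summable_suminf_not_top) (auto simp: u_def)
    then have "(\<lambda>k. 2 ^ k * u k x) \<longlonglongrightarrow> 0" by (rule summable_LIMSEQ_zero)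
    then have ev: "\<forall>\<^sub>F k in sequentially. 2 ^ k * u k x < 1" by (rule order_tendstoD) simp
    \<comment> \<open>Once the weighted terms are below 1, consecutive differences are at most
      \<rho> to the power \<open>k\<close>, so the telescoping series converges absolutely.\<close>
    define \<rho> where "\<rho> = (1/2::real) powr (1/p)"
    have \<rho>: "0 \<le> \<rho>" "\<rho> < 1" using p0 powr_less_mono2[of "1/p" "1/2" 1] by (auto simp: \<rho>_def)
    have "summable (\<lambda>k. g (r (Suc k)) x - g (r k) x)"
    proof (rule summable_comparison_test_ev)
      show "summable (\<lambda>k. \<rho> ^ k)" using \<rho> by (intro summable_geometric) simp
      show "\<forall>\<^sub>F k in sequentially. norm (g (r (Suc k)) x - g (r k) x) \<le> \<rho> ^ k"
        using ev
      proof eventually_elim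
        case (elim k)
        then have "u k x \<le> (1/2) ^ k" by (simp add: field_simps power_divide)
        then have "u k x powr (1/p) \<le> ((1/2) ^ k) powr (1/p)"
          using p0 by (intro powr_mono2) (auto simp: u_def)
        also have "\<dots> = \<rho> ^ k" by (simp add: \<rho>_def powr_power powr_realpow[symmetric] powr_powr)
        finally show ?case using p0 by (simp add: u_def powr_powr)
      qed
    qed
    then have "(\<lambda>n. \<Sum>k<n. g (r (Suc k)) x - g (r k) x) \<longlonglongrightarrow> (\<Sum>k. g (r (Suc k)) x - g (r k) x)"
      by (rule summable_LIMSEQ)
    then have "(\<lambda>n. g (r n) x - g (r 0) x + g (r 0) x) \<longlonglongrightarrow> (\<Sum>k. g (r (Suc k)) x - g (r k) x) + g (r 0) x"
      by (intro tendsto_add tendsto_const) (simp only: sum_lessThan_telescope[of "\<lambda>k. g (r k) x"])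
    then show ?thesis by (auto simp: convergent_def)
  qed
  define h where "h x = lim (\<lambda>k. g (r k) x)" for x
  have [measurable]: "h \<in> borel_measurable lborel" unfolding h_def by measurable
  have lim: "AE x in lborel. (\<lambda>k. g (r k) x) \<longlonglongrightarrow> h x"
    using AE_fin by eventually_elim (use conv in \<open>auto simp: h_def convergent_LIMSEQ_iff\<close>)
  \<comment> \<open>Fatou is applied to \<open>g n\<close> against the subsequence for an arbitrary
    large \<open>n\<close>, which gives convergence of the full sequence directly.\<close>
  have tail: "(\<lambda>x. g n x - h x) \<in> Lp p \<and> Lp_int p (\<lambda>x. g n x - h x) \<le> (1/4) ^ j" if n: "n \<ge> r j" for n j
  proof -
    have "(\<integral>\<^sup>+x. ennreal (\<bar>g n x - h x\<bar> powr p) \<partial>lborel)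
        = (\<integral>\<^sup>+x. liminf (\<lambda>k. ennreal (\<bar>g n x - g (r k) x\<bar> powr p)) \<partial>lborel)"
    proof (rule nn_integral_cong_AE)
      show "AE x in lborel. ennreal (\<bar>g n x - h x\<bar> powr p) = liminf (\<lambda>k. ennreal (\<bar>g n x - g (r k) x\<bar> powr p))"
        using lim
      proof eventually_elim
        case (elim x)
        then have "(\<lambda>k. ennreal (\<bar>g n x - g (r k) x\<bar> powr p)) \<longlonglongrightarrow> ennreal (\<bar>g n x - h x\<bar> powr p)"
          using p0 by (intro tendsto_ennrealI tendsto_powr' tendsto_rabs tendsto_diff tendsto_const) auto
        then show ?case by (intro lim_imp_Liminf[symmetric]) auto
      qed
    qed
    also have "\<dots> \<le> liminf (\<lambda>k. \<integral>\<^sup>+x. ennreal (\<bar>g n x - g (r k) x\<bar> powr p) \<partial>lborel)"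
      by (rule nn_integral_liminf) measurable
    also have "\<dots> \<le> ennreal ((1/4) ^ j)"
    proof (rule Liminf_le)
      show "\<forall>\<^sub>F k in sequentially. (\<integral>\<^sup>+x. ennreal (\<bar>g n x - g (r k) x\<bar> powr p) \<partial>lborel) \<le> ennreal ((1/4) ^ j)"
      proof (rule eventually_sequentiallyI[of j])
        fix k assume "j \<le> k"
        then have "Lp_int p (\<lambda>x. g n x - g (r k) x) < (1/4) ^ j"
          using r_mono[of j k] r(1)[of j] n by (intro M) auto
        then show "(\<integral>\<^sup>+x. ennreal (\<bar>g n x - g (r k) x\<bar> powr p) \<partial>lborel) \<le> ennreal ((1/4) ^ j)"
          using Lp_nn_integral[OF Lp_diff[OF p0 g g]] by (simp add: ennreal_leI)
      qed
    qed simp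
    finally show ?thesis using Lp_of_nn_integral[of "\<lambda>x. g n x - h x" p "(1/4) ^ j"] by simp
  qed
  have h: "h \<in> Lp p"
    using Lp_diff[OF p0 g[of "r 0"] conjunct1[OF tail[OF order_refl, of 0]]] by simp
  moreover have "(\<lambda>n. Lp_norm p (\<lambda>x. g n x - h x)) \<longlonglongrightarrow> 0"
  proof (rule LIMSEQ_I)
    fix e :: real assume e: "e > 0"
    then obtain j :: nat where j: "(1/4) ^ j < e powr p"
      using real_arch_pow_inv[of "e powr p" "1/4"] by auto
    have "Lp_norm p (\<lambda>x. g n x - h x) < e" if "n \<ge> r j" for n
      using tail[OF that] j by (simp add: Lp_norm_less_iff[OF p0 e])
    then show "\<exists>n0. \<forall>n\<ge>n0. norm (Lp_norm p (\<lambda>x. g n x - h x) - 0) < e"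
      using Lp_norm_nonneg by (intro exI[of _ "r j"]) auto
  qed
  ultimately show ?thesis by blast
qed

text \<open>The bounded support makes the level sets at nonzero values bounded, as the continuity of
  translation for indicators requires.\<close>

lemma Lp_simple_approx:
  assumes p: "p > 0" and f: "f \<in> Lp p" and e: "e > 0"
  obtains h R where "simple_function lborel h" "h \<in> Lp p" "\<And>x. \<bar>x\<bar> > R \<Longrightarrow> h x = 0"
    "Lp_norm p (\<lambda>x. f x - h x) < e"
proof -
  have [measurable]: "f \<in> borel_measurable lborel" using f by (rule LpD)
  obtain s where s: "\<And>n. simple_function lborel (s n)" "\<And>x. (\<lambda>n. s n x) \<longlonglongrightarrow> f x"
    "\<And>n x. \<bar>s n x\<bar> \<le> 2 * \<bar>f x\<bar>"
    using borel_measurable_implies_sequence_metric[of f lborel 0] by (auto simp: dist_real_def)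
  \<comment> \<open>Cutting to growing intervals keeps the bound \<open>2 * \<bar>f x\<bar>\<close>
    and the pointwise limit, so dominated convergence applies with majorant
    \<open>(3 * \<bar>f x\<bar>) powr p\<close>.\<close>
  define h where "h n x = s n x * indicator {- real n..real n} x" for n :: nat and x
  have hs: "simple_function lborel (h n)" for n
    unfolding h_def by (intro simple_function_mult s simple_function_indicator) simp
  have [measurable]: "h n \<in> borel_measurable lborel" for n using hs by (rule borel_measurable_simple_function)
  have hle: "\<bar>h n x\<bar> \<le> 2 * \<bar>f x\<bar>" for n x using s(3)[of n x] by (auto simp: h_def indicator_def)
  have hlim: "(\<lambda>n. h n x) \<longlonglongrightarrow> f x" for x
  proof (rule Lim_transform_eventually[OF s(2)])
    obtain N :: nat where "\<bar>x\<bar> \<le> real N" using real_arch_simple by blast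
    then show "\<forall>\<^sub>F n in sequentially. s n x = h n x"
      by (intro eventually_sequentiallyI[of N]) (auto simp: h_def indicator_def)
  qed
  have hLp: "h n \<in> Lp p" for n
  proof (rule Lp_bounded_by)
    show "integrable lborel (\<lambda>x. 2 powr p * \<bar>f x\<bar> powr p)" using Lp_integrable[OF f] by (rule integrable_mult_right)
    show "\<bar>h n x\<bar> powr p \<le> 2 powr p * \<bar>f x\<bar> powr p" for x
      using powr_mono2[OF less_imp_le[OF p] abs_ge_zero hle[of n x]] by (simp add: powr_mult)
  qed simp
  have "(\<lambda>n. Lp_int p (\<lambda>x. f x - h n x)) \<longlonglongrightarrow> (\<integral>x. 0 \<partial>(lborel::real measure))"
    unfolding Lp_int_def
  proof (rule integral_dominated_convergence)
    show "integrable lborel (\<lambda>x. 3 powr p * \<bar>f x\<bar> powr p)" using Lp_integrable[OF f] by (rule integrable_mult_right)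
    show "AE x in lborel. (\<lambda>n. \<bar>f x - h n x\<bar> powr p) \<longlonglongrightarrow> 0"
    proof (rule AE_I2)
      fix x
      have "(\<lambda>n. \<bar>f x - h n x\<bar> powr p) \<longlonglongrightarrow> \<bar>f x - f x\<bar> powr p"
        using p by (intro tendsto_powr' tendsto_rabs tendsto_diff tendsto_const hlim) auto
      then show "(\<lambda>n. \<bar>f x - h n x\<bar> powr p) \<longlonglongrightarrow> 0" by simp
    qed
    show "AE x in lborel. norm (\<bar>f x - h n x\<bar> powr p) \<le> 3 powr p * \<bar>f x\<bar> powr p" for n
    proof (rule AE_I2)
      fix x
      have "\<bar>f x - h n x\<bar> \<le> 3 * \<bar>f x\<bar>" using hle[of n x] by linarith
      then show "norm (\<bar>f x - h n x\<bar> powr p) \<le> 3 powr p * \<bar>f x\<bar> powr p"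
        using powr_mono2[OF less_imp_le[OF p] abs_ge_zero, of "f x - h n x" "3 * \<bar>f x\<bar>"] by (simp add: powr_mult)
    qed
  qed measurable
  then have "\<forall>\<^sub>F n in sequentially. Lp_int p (\<lambda>x. f x - h n x) < e powr p"
    using e by (intro order_tendstoD) auto
  then obtain n where "Lp_int p (\<lambda>x. f x - h n x) < e powr p" by (auto simp: eventually_sequentially)
  then have "Lp_norm p (\<lambda>x. f x - h n x) < e" using p e by (simp add: Lp_norm_less_iff)
  moreover have "\<And>x. \<bar>x\<bar> > real n \<Longrightarrow> h n x = 0" by (auto simp: h_def indicator_def)
  ultimately show ?thesis using that[OF hs hLp, of "real n" n] by blast
qed

section \<open>Continuity of translation\<close>

lemma Lp_translate:
  assumes "f \<in> Lp p"
  shows "translate f s \<in> Lp p" "Lp_int p (translate f s) = Lp_int p f"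
    "Lp_norm p (translate f s) = Lp_norm p f"
proof -
  have [measurable]: "f \<in> borel_measurable lborel" using assms by (rule LpD)
  have "integrable lborel (\<lambda>x. \<bar>f (- s + 1 * x)\<bar> powr p)"
    by (rule lborel_integrable_real_affine) (use Lp_integrable[OF assms] in auto)
  then show "translate f s \<in> Lp p" by (simp add: Lp_def translate_def)
  show I: "Lp_int p (translate f s) = Lp_int p f"
    using lborel_integral_real_affine[of 1 "\<lambda>x. \<bar>f x\<bar> powr p" "-s"] by (simp add: Lp_int_def translate_def)
  show "Lp_norm p (translate f s) = Lp_norm p f" by (simp add: Lp_norm_eq I)
qed

text \<open>Regularity of Lebesgue measure: choose a compact \<open>K\<close> inside and an open
  \<open>U\<close> around \<open>A\<close> with \<open>U - K\<close> small. A short shift keeps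
  \<open>K\<close> inside \<open>U\<close>, so wherever the two indicators differ, \<open>x\<close>
  or \<open>x - s\<close> lies in \<open>U - K\<close>.\<close>

lemma indicator_translation_continuous:
  fixes A :: "real set"
  assumes A: "A \<in> sets borel" "bounded A" and p: "p > 0" and e: "e > 0"
  shows "\<exists>d>0. \<forall>s. \<bar>s\<bar> < d \<longrightarrow> Lp_norm p (\<lambda>x. indicator A (x - s) - indicator A x) < e"
proof -
  \<comment> \<open>\<open>W\<close> has measure below twice \<epsilon>, and both \<open>W\<close>
    and its translate are counted; hence the factor 4.\<close>
  define \<epsilon> where "\<epsilon> = e powr p / 4"
  have \<epsilon>: "\<epsilon> > 0" using e by (simp add: \<epsilon>_def)
  have Al: "A \<in> sets lebesgue" using A by auto
  obtain U where U: "open U" "A \<subseteq> U" "U - A \<in> lmeasurable" "emeasure lebesgue (U - A) < ennreal \<epsilon>"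
    using sets_lebesgue_outer_open[OF Al \<epsilon>] by blast
  obtain K where K: "closed K" "K \<subseteq> A" "A - K \<in> lmeasurable" "emeasure lebesgue (A - K) < ennreal \<epsilon>"
    using sets_lebesgue_inner_closed[OF Al \<epsilon>] by blast
  have "compact K" using K A bounded_subset compact_eq_bounded_closed by blast
  then obtain d where d: "d > 0" "(\<Union>x\<in>K. ball x d) \<subseteq> U"
    using compact_subset_open_imp_ball_epsilon_subset[of K U] U K by blast
  define W where "W = U - K"
  have W[measurable]: "W \<in> sets lborel" using U K by (auto simp: W_def)
  have "emeasure lborel W \<le> emeasure lebesgue (U - A) + emeasure lebesgue (A - K)"
  proof -
    have "emeasure lborel W = emeasure lebesgue W" using W by (simp add: emeasure_completion)
    also have "\<dots> \<le> emeasure lebesgue ((U - A) \<union> (A - K))"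
      using U K by (intro emeasure_mono) (auto simp: W_def fmeasurable_def)
    also have "\<dots> \<le> emeasure lebesgue (U - A) + emeasure lebesgue (A - K)"
      using U K by (intro emeasure_subadditive) (auto simp: fmeasurable_def)
    finally show ?thesis .
  qed
  also have "\<dots> < ennreal \<epsilon> + ennreal \<epsilon>" using U K by (intro add_strict_mono)
  also have "\<dots> = ennreal (2 * \<epsilon>)" using \<epsilon> by (simp flip: ennreal_plus)
  finally have Wlt: "emeasure lborel W < ennreal (2 * \<epsilon>)" .
  then have Wfin: "emeasure lborel W < \<infinity>" by (auto intro: less_trans)
  have Wm: "measure lborel W < 2 * \<epsilon>"
    using Wlt Wfin \<epsilon> by (simp add: emeasure_eq_ennreal_measure ennreal_less_iff)
  have Wint: "integrable lborel (indicator W :: real \<Rightarrow> real)"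
    using Wfin W by (intro integrable_real_indicator) auto
  have Wsint: "integrable lborel (\<lambda>x. indicator W (x - s) :: real)" for s
    using lborel_integrable_real_affine[OF Wint, of 1 "-s"] by simp
  have Ws: "(\<integral>x. indicator W (x - s) \<partial>lborel) = measure lborel W" for s
    using lborel_integral_real_affine[of 1 "indicator W :: real \<Rightarrow> real" "-s"] W by simp
  show ?thesis
  proof (intro exI[of _ d] conjI allI impI d)
    fix s :: real assume s: "\<bar>s\<bar> < d"
    have pt: "\<bar>indicator A (x - s) - indicator A x\<bar> powr p \<le> indicator W x + indicator W (x - s)" for x
    proof -
      have 1: "x \<in> W \<or> x - s \<in> W" if "x - s \<in> A" "x \<notin> A"
      proof (cases "x - s \<in> K")
        case True
        then have "x \<in> U" using s by (intro subsetD[OF d(2)] UN_I[OF True]) (simp add: dist_real_def)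
        then show ?thesis using that K by (auto simp: W_def)
      qed (use that U in \<open>auto simp: W_def\<close>)
      have 2: "x \<in> W \<or> x - s \<in> W" if "x - s \<notin> A" "x \<in> A"
      proof (cases "x \<in> K")
        case True
        then have "x - s \<in> U" using s by (intro subsetD[OF d(2)] UN_I[OF True]) (simp add: dist_real_def)
        then show ?thesis using that K by (auto simp: W_def)
      qed (use that U in \<open>auto simp: W_def\<close>)
      show ?thesis using 1 2 by (auto simp: indicator_def)
    qed
    have am [measurable]: "A \<in> sets borel" by fact
    have "Lp_int p (\<lambda>x. indicator A (x - s) - indicator A x) \<le> (\<integral>x. indicator W x + indicator W (x - s) \<partial>lborel)"
      unfolding Lp_int_def
    proof (rule integral_mono)
      show int: "integrable lborel (\<lambda>x. indicator W x + indicator W (x - s) :: real)"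
        by (intro Bochner_Integration.integrable_add Wint Wsint)
      show "integrable lborel (\<lambda>x. \<bar>indicator A (x - s) - indicator A x\<bar> powr p)"
        by (intro Lp_integrable Lp_bounded_by[OF _ int] pt) measurable
    qed (rule pt)
    also have "\<dots> = 2 * measure lborel W"
      using Wint Wsint W by (simp add: Bochner_Integration.integral_add Ws)
    also have "\<dots> < e powr p" using Wm by (simp add: \<epsilon>_def)
    finally show "Lp_norm p (\<lambda>x. indicator A (x - s) - indicator A x) < e"
      using p e by (simp add: Lp_norm_less_iff)
  qed
qed

theorem translation_continuous_Lp:
  assumes p: "p \<ge> 1" and f: "f \<in> Lp p" and e: "e > 0"
  shows "\<exists>d>0. \<forall>s. \<bar>s\<bar> < d \<longrightarrow> Lp_norm p (\<lambda>x. translate f s x - f x) < e"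
proof -
  have p0: "p > 0" using p by simp
  obtain h R where h: "simple_function lborel h" "h \<in> Lp p" "\<And>x. \<bar>x\<bar> > R \<Longrightarrow> h x = 0"
    and fh: "Lp_norm p (\<lambda>x. f x - h x) < e/3"
    using Lp_simple_approx[OF p0 f, of "e/3"] e by auto
  \<comment> \<open>The value 0 is left out: its level set is unbounded and contributes nothing to
    the sum.\<close>
  define Y where "Y = h ` UNIV - {0}"
  have Y: "finite Y" using simple_functionD(1)[OF h(1)] by (simp add: Y_def)
  define A where "A y = h -` {y}" for y
  have A: "A y \<in> sets borel" for y using simple_functionD(2)[OF h(1), of "{y}"] by (simp add: A_def)
  have Ab: "bounded (A y)" if "y \<in> Y" for y
  proof (rule bounded_subset[OF bounded_cball[of 0 R]], rule subsetI)
    fix x assume "x \<in> A y"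
    then show "x \<in> cball 0 R" using h(3)[of x] that by (fastforce simp: A_def Y_def)
  qed
  have hx: "h x = (\<Sum>y\<in>Y. y * indicator (A y) x)" for x
  proof -
    have "(\<Sum>y\<in>Y. y * indicator (A y) x) = (\<Sum>y\<in>Y. if y = h x then y else 0)"
      by (intro sum.cong) (auto simp: A_def indicator_def)
    also have "\<dots> = h x" using Y by (auto simp: Y_def)
    finally show ?thesis by simp
  qed
  \<comment> \<open>The added 1 keeps \<open>B\<close> positive when \<open>h\<close> vanishes and
    makes the final comparison strict.\<close>
  define B where "B = (\<Sum>y\<in>Y. \<bar>y\<bar>) + 1"
  have B: "B > 0" unfolding B_def by (simp add: add_nonneg_pos sum_nonneg)
  have "\<exists>d>0. \<forall>s. \<bar>s\<bar> < d \<longrightarrow> Lp_norm p (\<lambda>x. indicator (A y) (x - s) - indicator (A y) x) < e / (3 * B)"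
    if "y \<in> Y" for y
    using indicator_translation_continuous[OF A Ab[OF that] p0, of "e / (3 * B)"] e B by simp
  then obtain d where d: "\<And>y. y \<in> Y \<Longrightarrow> d y > 0"
    and ds: "\<And>y s. y \<in> Y \<Longrightarrow> \<bar>s\<bar> < d y \<Longrightarrow>
      Lp_norm p (\<lambda>x. indicator (A y) (x - s) - indicator (A y) x) < e / (3 * B)"
    by metis
  define \<delta> where "\<delta> = Min (insert 1 (d ` Y))"
  have \<delta>: "\<delta> > 0" "\<And>y. y \<in> Y \<Longrightarrow> \<delta> \<le> d y" using Y d by (auto simp: \<delta>_def)
  show ?thesis
  proof (intro exI[of _ \<delta>] conjI allI impI \<delta>)
    fix s assume s: "\<bar>s\<bar> < \<delta>"
    have ind: "indicator (A y) \<in> Lp p" if "y \<in> Y" for y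
      using that by (intro Lp_bounded_by[of _ "indicator (A y)"] integrable_real_indicator)
        (use A emeasure_bounded_finite[OF Ab[OF that]] in \<open>auto simp: indicator_def\<close>)
    have inds: "(\<lambda>x. indicator (A y) (x - s)) \<in> Lp p" if "y \<in> Y" for y
      using Lp_translate(1)[OF ind[OF that], of s] by (simp add: translate_def)
    have "(\<lambda>x. translate h s x - h x) = (\<lambda>x. \<Sum>y\<in>Y. y * (indicator (A y) (x - s) - indicator (A y) x))"
      by (simp add: translate_def hx sum_subtractf[symmetric] right_diff_distrib)
    then have "Lp_norm p (\<lambda>x. translate h s x - h x)
        \<le> (\<Sum>y\<in>Y. Lp_norm p (\<lambda>x. y * (indicator (A y) (x - s) - indicator (A y) x)))"
      using Lp_norm_sum[OF p, of Y "\<lambda>y x. y * (indicator (A y) (x - s) - indicator (A y) x)"]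
        Lp_scale[OF Lp_diff[OF p0 inds ind]] by simp
    also have "\<dots> = (\<Sum>y\<in>Y. \<bar>y\<bar> * Lp_norm p (\<lambda>x. indicator (A y) (x - s) - indicator (A y) x))"
      using p0 by (simp add: Lp_norm_scale)
    also have "\<dots> \<le> (\<Sum>y\<in>Y. \<bar>y\<bar> * (e / (3 * B)))"
    proof (intro sum_mono mult_left_mono)
      fix y assume y: "y \<in> Y"
      show "Lp_norm p (\<lambda>x. indicator (A y) (x - s) - indicator (A y) x) \<le> e / (3 * B)"
        using ds[OF y] \<delta>(2)[OF y] s by (intro less_imp_le) simp
    qed simp
    also have "\<dots> = (B - 1) * (e / (3 * B))" by (simp only: B_def sum_distrib_right[symmetric] add_diff_cancel_right')
    also have "\<dots> < B * (e / (3 * B))" using e B by (intro mult_strict_right_mono) auto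
    also have "\<dots> = e / 3" using B by simp
    finally have hs: "Lp_norm p (\<lambda>x. translate h s x - h x) < e / 3" .
    have fhs: "Lp_norm p (\<lambda>x. translate f s x - translate h s x) < e/3"
      using Lp_translate(3)[OF Lp_diff[OF p0 f h(2)], of s] fh by (simp add: translate_def)
    have tr: "translate f s \<in> Lp p" "translate h s \<in> Lp p" using f h Lp_translate(1) by auto
    have "Lp_norm p (\<lambda>x. h x - f x) < e/3" using fh Lp_norm_minus_commute[of p f h] by simp
    moreover have "Lp_norm p (\<lambda>x. translate f s x - f x)
        \<le> Lp_norm p (\<lambda>x. translate f s x - translate h s x) + Lp_norm p (\<lambda>x. translate h s x - f x)"
      by (intro Lp_norm_triangle p tr f)
    moreover have "Lp_norm p (\<lambda>x. translate h s x - f x)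
        \<le> Lp_norm p (\<lambda>x. translate h s x - h x) + Lp_norm p (\<lambda>x. h x - f x)"
      by (intro Lp_norm_triangle p tr f h)
    ultimately show "Lp_norm p (\<lambda>x. translate f s x - f x) < e" using fhs hs by linarith
  qed
qed

section \<open>Khinchine's inequality\<close>

lemma powr_mean_le:
  fixes v :: "'a \<Rightarrow> real"
  assumes "finite A" "A \<noteq> {}" "r \<ge> 1" "\<And>i. i \<in> A \<Longrightarrow> 0 \<le> v i"
  shows "((\<Sum>i\<in>A. v i) / card A) powr r \<le> (\<Sum>i\<in>A. v i powr r) / card A"
proof -
  have "convex_on {0..} (\<lambda>x::real. x powr r)"
  proof (rule convex_onI)
    show "((1 - t) *\<^sub>R x + t *\<^sub>R y) powr r \<le> (1 - t) * x powr r + t * y powr r"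
      if "0 < t" "t < 1" "x \<in> {0..}" "y \<in> {0..}" for t x y :: real
      using powr_convex_nonneg[of r x y "1 - t"] that assms(3) by simp
  qed simp
  from convex_on_sum[OF assms(1,2) this, of "\<lambda>_. 1 / card A" v] assms
  show ?thesis by (simp add: sum_divide_distrib)
qed

text \<open>Split off one factor: \<open>v i powr r\<close> is \<open>v i\<close> times
  \<open>v i powr (r - 1)\<close>, and the second factor grows when \<open>v i\<close> is replaced
  by the whole sum.\<close>

lemma sum_powr_le_powr_sum:
  fixes v :: "'a \<Rightarrow> real"
  assumes "finite A" "r \<ge> 1" "\<And>i. i \<in> A \<Longrightarrow> 0 \<le> v i"
  shows "(\<Sum>i\<in>A. v i powr r) \<le> (\<Sum>i\<in>A. v i) powr r"
proof (cases "(\<Sum>i\<in>A. v i) = 0")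
  case True
  then have "\<forall>i\<in>A. v i = 0" using assms by (simp add: sum_nonneg_eq_0_iff)
  then show ?thesis by simp
next
  case False
  define s where "s = (\<Sum>i\<in>A. v i)"
  have s: "s > 0" using False assms(3) sum_nonneg[of A v] by (simp add: s_def)
  have "(\<Sum>i\<in>A. v i powr r) \<le> (\<Sum>i\<in>A. v i * s powr (r - 1))"
  proof (rule sum_mono)
    fix i assume i: "i \<in> A"
    have "v i powr r = v i * v i powr (r - 1)"
      using assms(3)[OF i] powr_mult_base[of "v i" "r - 1"] by simp
    also have "\<dots> \<le> v i * s powr (r - 1)"
      using assms i by (intro mult_left_mono powr_mono2) (auto simp: s_def intro: member_le_sum)
    finally show "v i powr r \<le> v i * s powr (r - 1)" .
  qed
  also have "\<dots> = s * s powr (r - 1)" by (simp add: s_def sum_distrib_right)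
  also have "\<dots> = s powr r" using s powr_mult_base[of s "r - 1"] by simp
  finally show ?thesis by (simp add: s_def)
qed

lemma powr_sum_le_sum_powr:
  fixes v :: "'a \<Rightarrow> real"
  assumes "finite A" "0 < r" "r \<le> 1" "\<And>i. i \<in> A \<Longrightarrow> 0 \<le> v i"
  shows "(\<Sum>i\<in>A. v i) powr r \<le> (\<Sum>i\<in>A. v i powr r)"
proof -
  have "(\<Sum>i\<in>A. (v i powr r) powr (1/r)) \<le> (\<Sum>i\<in>A. v i powr r) powr (1/r)"
    using assms by (intro sum_powr_le_powr_sum) auto
  then have "(\<Sum>i\<in>A. v i) \<le> (\<Sum>i\<in>A. v i powr r) powr (1/r)"
    using assms by (simp add: powr_powr)
  then have "(\<Sum>i\<in>A. v i) powr r \<le> ((\<Sum>i\<in>A. v i powr r) powr (1/r)) powr r"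
    using assms by (intro powr_mono2 sum_nonneg) auto
  then show ?thesis using assms by (simp add: powr_powr sum_nonneg)
qed

text \<open>This is where \<open>p \<le> 4\<close> enters: Cauchy--Schwarz bounds the left-hand side by \<open>\<ell>\<^sub>4\<close>-norms,
  which are dominated by \<open>\<ell>\<^sub>p\<close>-norms only in that range.\<close>

lemma powr_sum_square_le:
  fixes a b :: "'a \<Rightarrow> real"
  assumes "finite A" "0 < p" "p \<le> 4"
  shows "(\<Sum>i\<in>A. (a i * b i)\<^sup>2) powr (p/2) \<le> (\<Sum>i\<in>A. \<bar>a i\<bar> powr p) * (\<Sum>i\<in>A. \<bar>b i\<bar> powr p)"
proof -
  have four: "(\<Sum>i\<in>A. ((c i)\<^sup>2)\<^sup>2) powr (p/4) \<le> (\<Sum>i\<in>A. \<bar>c i\<bar> powr p)" for c :: "'a \<Rightarrow> real"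
  proof -
    have eq: "((x\<^sup>2)\<^sup>2) powr (p/4) = \<bar>x\<bar> powr p" for x :: real
    proof -
      have "(x\<^sup>2)\<^sup>2 = \<bar>x\<bar> ^ 4" by (simp add: power2_eq_square power4_eq_xxxx)
      also have "\<dots> = \<bar>x\<bar> powr 4" by simp
      finally have "(x\<^sup>2)\<^sup>2 = \<bar>x\<bar> powr 4" .
      then show ?thesis by (simp only: powr_powr) simp
    qed
    have pre: "0 < p/4" "p/4 \<le> 1" "\<And>i. 0 \<le> ((c i)\<^sup>2)\<^sup>2" using assms by simp_all
    show ?thesis
      using powr_sum_le_sum_powr[OF assms(1) pre] by (simp only: eq)
  qed
  have "(\<Sum>i\<in>A. (a i * b i)\<^sup>2)\<^sup>2 = (\<Sum>i\<in>A. (a i)\<^sup>2 * (b i)\<^sup>2)\<^sup>2" by (simp add: power_mult_distrib)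
  also have "\<dots> \<le> (\<Sum>i\<in>A. ((a i)\<^sup>2)\<^sup>2) * (\<Sum>i\<in>A. ((b i)\<^sup>2)\<^sup>2)" by (rule Cauchy_Schwarz_ineq_sum)
  finally have "((\<Sum>i\<in>A. (a i * b i)\<^sup>2)\<^sup>2) powr (p/4)
      \<le> ((\<Sum>i\<in>A. ((a i)\<^sup>2)\<^sup>2) * (\<Sum>i\<in>A. ((b i)\<^sup>2)\<^sup>2)) powr (p/4)"
    using assms by (intro powr_mono2) auto
  also have "\<dots> = (\<Sum>i\<in>A. ((a i)\<^sup>2)\<^sup>2) powr (p/4) * (\<Sum>i\<in>A. ((b i)\<^sup>2)\<^sup>2) powr (p/4)"
    by (rule powr_mult)
  also have "\<dots> \<le> (\<Sum>i\<in>A. \<bar>a i\<bar> powr p) * (\<Sum>i\<in>A. \<bar>b i\<bar> powr p)"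
    by (intro mult_mono four) (auto intro: sum_nonneg)
  also have "((\<Sum>i\<in>A. (a i * b i)\<^sup>2)\<^sup>2) powr (p/4) = (\<Sum>i\<in>A. (a i * b i)\<^sup>2) powr (p/2)"
  proof -
    have "(\<Sum>i\<in>A. (a i * b i)\<^sup>2) \<ge> 0" by (intro sum_nonneg) auto
    then have "(\<Sum>i\<in>A. (a i * b i)\<^sup>2)\<^sup>2 = (\<Sum>i\<in>A. (a i * b i)\<^sup>2) powr 2" by simp
    then show ?thesis by (simp add: powr_powr)
  qed
  finally show ?thesis .
qed

section \<open>Averages over signs\<close>

text \<open>A choice of signs is encoded by the set carrying the plus signs. Averages over signs
  become sums over \<open>Pow E\<close>, and a sign change becomes a difference of the truncations
  to \<open>S\<close> and \<open>E - S\<close>.\<close>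

definition sgn_of :: "'a set \<Rightarrow> 'a \<Rightarrow> real" where
  "sgn_of S i = (if i \<in> S then 1 else - 1)"

text \<open>Conditioning on the sign at \<open>j\<close>. Adding the two cases cancels all odd
  powers of \<open>c j\<close>, which drives the inductions for the moments.\<close>

lemma sum_Pow_insert_signs:
  fixes g :: "real \<Rightarrow> real"
  assumes "finite E" "j \<notin> E"
  shows "(\<Sum>S\<in>Pow (insert j E). g (\<Sum>i\<in>insert j E. sgn_of S i * c i))
       = (\<Sum>S\<in>Pow E. g ((\<Sum>i\<in>E. sgn_of S i * c i) - c j) + g ((\<Sum>i\<in>E. sgn_of S i * c i) + c j))"
proof -
  have disj: "Pow E \<inter> insert j ` Pow E = {}" using assms by auto
  have inj: "inj_on (insert j) (Pow E)" using assms by (intro inj_onI) auto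
  have 1: "(\<Sum>i\<in>insert j E. sgn_of S i * c i) = (\<Sum>i\<in>E. sgn_of S i * c i) - c j" if "S \<in> Pow E" for S
    using that assms by (subst sum.insert) (auto simp: sgn_of_def)
  have 2: "(\<Sum>i\<in>insert j E. sgn_of (insert j S) i * c i) = (\<Sum>i\<in>E. sgn_of S i * c i) + c j" for S
  proof -
    have "(\<Sum>i\<in>E. sgn_of (insert j S) i * c i) = (\<Sum>i\<in>E. sgn_of S i * c i)"
      using assms by (intro sum.cong) (auto simp: sgn_of_def)
    then show ?thesis using assms by (subst sum.insert) (auto simp: sgn_of_def)
  qed
  have "(\<Sum>S\<in>Pow (insert j E). g (\<Sum>i\<in>insert j E. sgn_of S i * c i))
     = (\<Sum>S\<in>Pow E. g (\<Sum>i\<in>insert j E. sgn_of S i * c i))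
       + (\<Sum>S\<in>Pow E. g (\<Sum>i\<in>insert j E. sgn_of (insert j S) i * c i))"
    unfolding Pow_insert using assms(1) by (subst sum.union_disjoint[OF _ _ disj]) (auto simp: sum.reindex[OF inj])
  then show ?thesis by (simp add: 1 2 sum.distrib)
qed

lemma sum_signs_square:
  assumes "finite E"
  shows "(\<Sum>S\<in>Pow E. (\<Sum>i\<in>E. sgn_of S i * c i)\<^sup>2) = 2 ^ card E * (\<Sum>i\<in>E. (c i)\<^sup>2)"
  using assms
proof (induction E rule: finite_induct)
  case (insert j E)
  have e: "(v - c j)\<^sup>2 + (v + c j)\<^sup>2 = 2 * v\<^sup>2 + 2 * (c j)\<^sup>2" for v by (simp add: power2_eq_square algebra_simps)
  show ?case
    unfolding sum_Pow_insert_signs[OF insert(1,2), of "\<lambda>t. t\<^sup>2"] e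
    using insert by (simp add: sum.distrib sum_distrib_left[symmetric] card_Pow algebra_simps)
qed simp

lemma sum_signs_fourth:
  assumes "finite E"
  shows "(\<Sum>S\<in>Pow E. (\<Sum>i\<in>E. sgn_of S i * c i) ^ 4) \<le> 3 * 2 ^ card E * (\<Sum>i\<in>E. (c i)\<^sup>2)\<^sup>2"
  using assms
proof (induction E rule: finite_induct)
  case (insert j E)
  let ?v = "\<lambda>S. \<Sum>i\<in>E. sgn_of S i * c i" and ?Q = "\<Sum>i\<in>E. (c i)\<^sup>2"
  have e: "(v - c j) ^ 4 + (v + c j) ^ 4 = 2 * v ^ 4 + 12 * (c j)\<^sup>2 * v\<^sup>2 + 2 * (c j) ^ 4" for v
    by (simp add: power4_eq_xxxx power2_eq_square algebra_simps)
  have "(\<Sum>S\<in>Pow (insert j E). (\<Sum>i\<in>insert j E. sgn_of S i * c i) ^ 4)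
      = 2 * (\<Sum>S\<in>Pow E. ?v S ^ 4) + 12 * (c j)\<^sup>2 * (\<Sum>S\<in>Pow E. (?v S)\<^sup>2) + 2 ^ card E * (2 * (c j) ^ 4)"
    unfolding sum_Pow_insert_signs[OF insert(1,2), of "\<lambda>t. t ^ 4"] e
    using insert by (simp add: sum.distrib sum_distrib_left card_Pow)
  \<comment> \<open>The coefficient 2 of \<open>(c j) ^ 4\<close> is raised to 6 precisely to
    complete the square of \<open>?Q + (c j)\<^sup>2\<close>.\<close>
  also have "\<dots> \<le> 2 * (3 * 2 ^ card E * ?Q\<^sup>2) + 12 * (c j)\<^sup>2 * (2 ^ card E * ?Q) + 2 ^ card E * (6 * (c j) ^ 4)"
    using insert by (intro add_mono mult_left_mono) (auto simp: sum_signs_square)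
  also have "\<dots> = 3 * 2 ^ card (insert j E) * (\<Sum>i\<in>insert j E. (c i)\<^sup>2)\<^sup>2"
    using insert by (simp add: power2_sum power4_eq_xxxx power2_eq_square algebra_simps)
  finally show ?case .
qed simp

lemma abs_powr_eq_square: "\<bar>x\<bar> powr p = (x\<^sup>2) powr (p/2)" for x :: real
proof -
  have "x\<^sup>2 = \<bar>x\<bar> powr 2" by simp
  then show ?thesis by (simp only: powr_powr) simp
qed

text \<open>The second moment is exact, and Jensen with exponent \<open>p/2\<close> passes from it
  to the \<open>p\<close>-th moment.\<close>

lemma Khinchine_lower:
  assumes "finite E" "p \<ge> 2"
  shows "2 ^ card E * (\<Sum>i\<in>E. (c i)\<^sup>2) powr (p/2) \<le> (\<Sum>S\<in>Pow E. \<bar>\<Sum>i\<in>E. sgn_of S i * c i\<bar> powr p)"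
proof -
  have "(\<Sum>i\<in>E. (c i)\<^sup>2) powr (p/2)
      = ((\<Sum>S\<in>Pow E. (\<Sum>i\<in>E. sgn_of S i * c i)\<^sup>2) / card (Pow E)) powr (p/2)"
    using assms by (simp add: sum_signs_square card_Pow)
  also have "\<dots> \<le> (\<Sum>S\<in>Pow E. ((\<Sum>i\<in>E. sgn_of S i * c i)\<^sup>2) powr (p/2)) / card (Pow E)"
    using assms by (intro powr_mean_le) auto
  finally show ?thesis using assms by (simp add: card_Pow abs_powr_eq_square field_simps)
qed

text \<open>Jensen with exponent \<open>4/p\<close> reduces the \<open>p\<close>-th moment to the
  fourth, whose constant 3 turns into \<open>3 powr (p/4)\<close>.\<close>

lemma Khinchine_upper:
  assumes "finite E" "0 < p" "p \<le> 4"
  shows "(\<Sum>S\<in>Pow E. \<bar>\<Sum>i\<in>E. sgn_of S i * c i\<bar> powr p)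
    \<le> 2 ^ card E * (3 powr (p/4) * (\<Sum>i\<in>E. (c i)\<^sup>2) powr (p/2))"
proof -
  let ?v = "\<lambda>S. \<Sum>i\<in>E. sgn_of S i * c i" and ?Q = "\<Sum>i\<in>E. (c i)\<^sup>2"
  have Q: "?Q \<ge> 0" by (intro sum_nonneg) auto
  have pw: "(\<bar>x\<bar> powr p) powr (4/p) = x ^ 4" for x :: real
  proof -
    have "\<bar>x\<bar> powr 4 = x ^ 4" by simp
    then show ?thesis using assms by (simp add: powr_powr)
  qed
  let ?m = "(\<Sum>S\<in>Pow E. \<bar>?v S\<bar> powr p) / card (Pow E)"
  have "?m powr (4/p) \<le> (\<Sum>S\<in>Pow E. (\<bar>?v S\<bar> powr p) powr (4/p)) / card (Pow E)"
    using assms by (intro powr_mean_le) auto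
  also have "\<dots> = (\<Sum>S\<in>Pow E. ?v S ^ 4) / card (Pow E)" by (simp add: pw)
  also have "\<dots> \<le> 3 * ?Q\<^sup>2"
    using sum_signs_fourth[OF assms(1), of c] assms(1) by (simp add: card_Pow field_simps)
  finally have "(?m powr (4/p)) powr (p/4) \<le> (3 * ?Q\<^sup>2) powr (p/4)"
    using assms by (intro powr_mono2) auto
  moreover have "(?m powr (4/p)) powr (p/4) = ?m"
    using assms by (simp add: powr_powr sum_nonneg)
  moreover have "(3 * ?Q\<^sup>2) powr (p/4) = 3 powr (p/4) * ?Q powr (p/2)"
  proof -
    have "?Q\<^sup>2 = ?Q powr 2" using Q by simp
    then show ?thesis by (simp add: powr_mult powr_powr)
  qed
  ultimately have "?m \<le> 3 powr (p/4) * ?Q powr (p/2)" by (simp only:)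
  then have "2 ^ card E * ?m \<le> 2 ^ card E * (3 powr (p/4) * ?Q powr (p/2))" by (intro mult_left_mono) auto
  then show ?thesis using assms(1) by (simp add: card_Pow)
qed

section \<open>Block estimates\<close>

locale unconditional_Lp =
  fixes p K :: real and f :: "nat \<Rightarrow> real \<Rightarrow> real"
  assumes p: "2 < p" "p \<le> 4" and K: "K > 0" and f_Lp: "\<And>i. f i \<in> Lp p"
    and unconditional: "\<And>F G a. finite F \<Longrightarrow> G \<subseteq> F \<Longrightarrow>
      Lp_norm p (\<lambda>x. \<Sum>i\<in>G. a i * f i x) \<le> K * Lp_norm p (\<lambda>x. \<Sum>i\<in>F. a i * f i x)"
begin

definition comb :: "nat set \<Rightarrow> (nat \<Rightarrow> real) \<Rightarrow> real \<Rightarrow> real" where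
  "comb E a = (\<lambda>x. \<Sum>i\<in>E. a i * f i x)"

text \<open>The \<open>p\<close>-th power of the square function, so that its integral compares with
  \<open>Lp_int\<close> without taking roots.\<close>

definition square_fn :: "nat set \<Rightarrow> (nat \<Rightarrow> real) \<Rightarrow> real \<Rightarrow> real" where
  "square_fn E a x = (\<Sum>i\<in>E. (a i * f i x)\<^sup>2) powr (p/2)"

lemma p_pos: "p > 0" "p \<ge> 1" using p by auto

lemma f_measurable [measurable]: "f i \<in> borel_measurable lborel"
  using f_Lp by (rule LpD)

lemma comb_Lp: "comb E a \<in> Lp p"
  unfolding comb_def by (intro Lp_sum p_pos Lp_scale f_Lp)

text \<open>A change of signs is the difference of two complementary truncations, each costing a
  factor \<open>K\<close> in norm.\<close>

lemma comb_signs: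
  assumes "finite E" "S \<subseteq> E"
  shows "Lp_int p (comb E (\<lambda>i. sgn_of S i * a i)) \<le> (2 * K) powr p * Lp_int p (comb E a)"
proof -
  have "comb E (\<lambda>i. sgn_of S i * a i) = (\<lambda>x. comb S a x - comb (E - S) a x)"
  proof
    fix x
    have "comb E (\<lambda>i. sgn_of S i * a i) x
        = (\<Sum>i\<in>S. sgn_of S i * a i * f i x) + (\<Sum>i\<in>E - S. sgn_of S i * a i * f i x)"
      unfolding comb_def using assms by (simp add: sum.subset_diff add.commute)
    then show "comb E (\<lambda>i. sgn_of S i * a i) x = comb S a x - comb (E - S) a x"
      by (simp add: comb_def sgn_of_def sum_negf)
  qed
  then have "Lp_norm p (comb E (\<lambda>i. sgn_of S i * a i)) \<le> Lp_norm p (comb S a) + Lp_norm p (comb (E - S) a)"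
    using Lp_norm_diff_le[OF p_pos(2) comb_Lp comb_Lp] by simp
  also have "\<dots> \<le> K * Lp_norm p (comb E a) + K * Lp_norm p (comb E a)"
    unfolding comb_def using assms by (intro add_mono unconditional) auto
  finally have "Lp_norm p (comb E (\<lambda>i. sgn_of S i * a i)) \<le> 2 * K * Lp_norm p (comb E a)" by simp
  then have "Lp_int p (comb E (\<lambda>i. sgn_of S i * a i)) \<le> (2 * K * Lp_norm p (comb E a)) powr p"
    using p_pos K by (subst Lp_norm_le_iff[symmetric]) (auto simp: Lp_norm_nonneg)
  then show ?thesis using p_pos by (simp add: powr_mult Lp_norm_powr)
qed

lemma comb_signs':
  assumes "finite E" "S \<subseteq> E"
  shows "Lp_int p (comb E a) \<le> (2 * K) powr p * Lp_int p (comb E (\<lambda>i. sgn_of S i * a i))"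
proof -
  have "(\<lambda>i. sgn_of S i * (sgn_of S i * a i)) = a" by (auto simp: sgn_of_def)
  then show ?thesis using comb_signs[OF assms, of "\<lambda>i. sgn_of S i * a i"] by simp
qed

lemma square_fn_measurable [measurable]: "square_fn E a \<in> borel_measurable lborel"
  unfolding square_fn_def by measurable

lemma square_fn_nonneg: "0 \<le> square_fn E a x"
  by (simp add: square_fn_def)

lemma square_fn_le_average:
  assumes "finite E"
  shows "2 ^ card E * square_fn E a x \<le> (\<Sum>S\<in>Pow E. \<bar>comb E (\<lambda>i. sgn_of S i * a i) x\<bar> powr p)"
  using Khinchine_lower[OF assms, of p "\<lambda>i. a i * f i x"] p
  by (simp add: square_fn_def comb_def mult.assoc)

lemma average_le_square_fn:
  assumes "finite E"
  shows "(\<Sum>S\<in>Pow E. \<bar>comb E (\<lambda>i. sgn_of S i * a i) x\<bar> powr p) \<le> 2 ^ card E * (3 powr (p/4) * square_fn E a x)"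
  using Khinchine_upper[OF assms, of p "\<lambda>i. a i * f i x"] p
  by (simp add: square_fn_def comb_def mult.assoc)

lemma average_integrable:
  "integrable lborel (\<lambda>x. \<Sum>S\<in>Pow E. \<bar>comb E (\<lambda>i. sgn_of S i * a i) x\<bar> powr p)"
  by (intro Bochner_Integration.integrable_sum Lp_integrable comb_Lp)

lemma integral_average:
  "(\<integral>x. (\<Sum>S\<in>Pow E. \<bar>comb E (\<lambda>i. sgn_of S i * a i) x\<bar> powr p) \<partial>lborel)
    = (\<Sum>S\<in>Pow E. Lp_int p (comb E (\<lambda>i. sgn_of S i * a i)))"
  unfolding Lp_int_def by (intro Bochner_Integration.integral_sum Lp_integrable comb_Lp)

lemma square_fn_integrable:
  assumes "finite E"
  shows "integrable lborel (square_fn E a)"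
proof (rule Bochner_Integration.integrable_bound[OF average_integrable[of E a]])
  show "AE x in lborel. norm (square_fn E a x)
      \<le> norm (\<Sum>S\<in>Pow E. \<bar>comb E (\<lambda>i. sgn_of S i * a i) x\<bar> powr p)"
  proof (rule AE_I2)
    fix x
    have "square_fn E a x \<le> 2 ^ card E * square_fn E a x"
      using square_fn_nonneg[of E a x] by (simp add: mult_le_cancel_right1)
    also note square_fn_le_average[OF assms]
    finally show "norm (square_fn E a x) \<le> norm (\<Sum>S\<in>Pow E. \<bar>comb E (\<lambda>i. sgn_of S i * a i) x\<bar> powr p)"
      by (simp add: square_fn_nonneg sum_nonneg)
  qed
qed measurable

text \<open>Khinchine holds pointwise; after integration the square function is controlled by the
  average over sign changes of \<open>comb E a\<close>, and each of these costs at most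
  \<open>(2 * K) powr p\<close>.\<close>

lemma square_fn_le_comb:
  assumes E: "finite E"
  shows "(\<integral>x. square_fn E a x \<partial>lborel) \<le> (2 * K) powr p * Lp_int p (comb E a)"
proof -
  have "2 ^ card E * (\<integral>x. square_fn E a x \<partial>lborel) = (\<integral>x. 2 ^ card E * square_fn E a x \<partial>lborel)" by simp
  also have "\<dots> \<le> (\<integral>x. (\<Sum>S\<in>Pow E. \<bar>comb E (\<lambda>i. sgn_of S i * a i) x\<bar> powr p) \<partial>lborel)"
    by (intro integral_mono integrable_mult_right square_fn_integrable E average_integrable square_fn_le_average)
  also have "\<dots> = (\<Sum>S\<in>Pow E. Lp_int p (comb E (\<lambda>i. sgn_of S i * a i)))" by (rule integral_average)
  also have "\<dots> \<le> (\<Sum>S\<in>Pow E. (2 * K) powr p * Lp_int p (comb E a))"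
    by (intro sum_mono comb_signs E) auto
  also have "\<dots> = 2 ^ card E * ((2 * K) powr p * Lp_int p (comb E a))" using E by (simp add: card_Pow)
  finally show ?thesis by simp
qed

lemma comb_le_square_fn:
  assumes E: "finite E"
  shows "Lp_int p (comb E a) \<le> (2 * K) powr p * 3 powr (p/4) * (\<integral>x. square_fn E a x \<partial>lborel)"
proof -
  have "2 ^ card E * Lp_int p (comb E a) = (\<Sum>S\<in>Pow E. Lp_int p (comb E a))" using E by (simp add: card_Pow)
  also have "\<dots> \<le> (\<Sum>S\<in>Pow E. (2 * K) powr p * Lp_int p (comb E (\<lambda>i. sgn_of S i * a i)))"
    by (intro sum_mono comb_signs' E) auto
  also have "\<dots> = (2 * K) powr p * (\<integral>x. (\<Sum>S\<in>Pow E. \<bar>comb E (\<lambda>i. sgn_of S i * a i) x\<bar> powr p) \<partial>lborel)"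
    by (simp add: integral_average sum_distrib_left)
  also have "\<dots> \<le> (2 * K) powr p * (\<integral>x. 2 ^ card E * (3 powr (p/4) * square_fn E a x) \<partial>lborel)"
    by (intro mult_left_mono integral_mono integrable_mult_right square_fn_integrable E
        average_integrable average_le_square_fn) auto
  also have "\<dots> = 2 ^ card E * ((2 * K) powr p * 3 powr (p/4) * (\<integral>x. square_fn E a x \<partial>lborel))" by simp
  finally show ?thesis by simp
qed

lemma coeff_le:
  assumes "finite F" "i \<in> F"
  shows "\<bar>a i\<bar> * Lp_norm p (f i) \<le> K * Lp_norm p (comb F a)"
  using unconditional[of F "{i}" a] assms p_pos by (simp add: comb_def Lp_norm_scale)

text \<open>Superadditivity of the power \<open>p/2\<close>, which exceeds 1, applied at each point
  to the sums of squares over the blocks.\<close>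

lemma sum_square_fn_le:
  assumes "finite L" "\<And>l. l \<in> L \<Longrightarrow> finite (E l)" "disjoint_family_on E L"
  shows "(\<Sum>l\<in>L. square_fn (E l) a x) \<le> square_fn (\<Union>l\<in>L. E l) a x"
proof -
  have "(\<Sum>l\<in>L. square_fn (E l) a x) \<le> (\<Sum>l\<in>L. \<Sum>i\<in>E l. (a i * f i x)\<^sup>2) powr (p/2)"
    unfolding square_fn_def using assms p by (intro sum_powr_le_powr_sum) (auto intro: sum_nonneg)
  also have "(\<Sum>l\<in>L. \<Sum>i\<in>E l. (a i * f i x)\<^sup>2) = (\<Sum>i\<in>(\<Union>l\<in>L. E l). (a i * f i x)\<^sup>2)"
    using assms by (intro sum.UNION_disjoint[symmetric]) (auto simp: disjoint_family_on_def)
  finally show ?thesis by (simp add: square_fn_def)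
qed

text \<open>The lower half of the comparison with an \<open>\<ell>\<^sub>p\<close>-sum, valid for
  any disjoint finite blocks: pass from each block to its square function, add pointwise, and return
  from the square function of the union.\<close>

lemma sum_blocks_le:
  assumes "finite L" "\<And>l. l \<in> L \<Longrightarrow> finite (E l)" "disjoint_family_on E L"
  shows "(\<Sum>l\<in>L. Lp_int p (comb (E l) a))
    \<le> ((2 * K) powr p * 3 powr (p/4) * (2 * K) powr p) * Lp_int p (comb (\<Union>l\<in>L. E l) a)"
proof -
  have fin: "finite (\<Union>l\<in>L. E l)" using assms by auto
  have "(\<Sum>l\<in>L. Lp_int p (comb (E l) a)) \<le> (\<Sum>l\<in>L. (2 * K) powr p * 3 powr (p/4) * (\<integral>x. square_fn (E l) a x \<partial>lborel))"
    using assms by (intro sum_mono comb_le_square_fn)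
  also have "\<dots> = (2 * K) powr p * 3 powr (p/4) * (\<integral>x. (\<Sum>l\<in>L. square_fn (E l) a x) \<partial>lborel)"
    using assms by (subst Bochner_Integration.integral_sum) (auto simp: sum_distrib_left square_fn_integrable)
  also have "\<dots> \<le> (2 * K) powr p * 3 powr (p/4) * (\<integral>x. square_fn (\<Union>l\<in>L. E l) a x \<partial>lborel)"
    using assms fin by (intro mult_left_mono integral_mono Bochner_Integration.integrable_sum square_fn_integrable
        sum_square_fn_le) auto
  also have "\<dots> \<le> (2 * K) powr p * 3 powr (p/4) * ((2 * K) powr p * Lp_int p (comb (\<Union>l\<in>L. E l) a))"
    using fin by (intro mult_left_mono square_fn_le_comb) auto
  finally show ?thesis by (simp add: mult.assoc)
qed

end

section \<open>Localisation of blocks on annuli\<close>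

definition mass :: "real \<Rightarrow> (real \<Rightarrow> real) \<Rightarrow> real set \<Rightarrow> real" where
  "mass p g S = (\<integral>x. \<bar>g x\<bar> powr p * indicator S x \<partial>lborel)"

lemma mass_integrable:
  assumes "g \<in> Lp p" "S \<in> sets borel"
  shows "integrable lborel (\<lambda>x. \<bar>g x\<bar> powr p * indicator S x)"
  using integrable_mult_indicator[OF _ Lp_integrable[OF assms(1)], of S] assms(2) by (simp add: mult.commute)

lemma mass_nonneg: "0 \<le> mass p g S"
  by (simp add: mass_def)

lemma mass_Un_le:
  assumes "g \<in> Lp p" "S \<in> sets borel" "S' \<in> sets borel"
  shows "mass p g (S \<union> S') \<le> mass p g S + mass p g S'"
proof -
  have "mass p g (S \<union> S') \<le> (\<integral>x. \<bar>g x\<bar> powr p * indicator S x + \<bar>g x\<bar> powr p * indicator S' x \<partial>lborel)"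
    unfolding mass_def using assms
    by (intro integral_mono Bochner_Integration.integrable_add mass_integrable) (auto simp: indicator_def)
  also have "\<dots> = mass p g S + mass p g S'"
    unfolding mass_def by (intro Bochner_Integration.integral_add mass_integrable assms)
  finally show ?thesis .
qed

lemma mass_tail_tendsto_0:
  assumes "g \<in> Lp p"
  shows "(\<lambda>n. mass p g {x. real n \<le> \<bar>x\<bar>}) \<longlonglongrightarrow> 0"
proof -
  have [measurable]: "g \<in> borel_measurable lborel" using assms by (rule LpD)
  have "(\<lambda>n. mass p g {x. real n \<le> \<bar>x\<bar>}) \<longlonglongrightarrow> (\<integral>x. 0 \<partial>(lborel::real measure))"
    unfolding mass_def
  proof (rule integral_dominated_convergence[OF _ _ Lp_integrable[OF assms]])
    show "AE x in lborel. (\<lambda>n. \<bar>g x\<bar> powr p * indicator {x. real n \<le> \<bar>x\<bar>} x) \<longlonglongrightarrow> 0"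
    proof (rule AE_I2)
      fix x :: real
      obtain N :: nat where "\<bar>x\<bar> < real N" using reals_Archimedean2 by blast
      then show "(\<lambda>n. \<bar>g x\<bar> powr p * indicator {x. real n \<le> \<bar>x\<bar>} x) \<longlonglongrightarrow> 0"
        by (intro tendsto_eventually eventually_sequentiallyI[of N]) (auto simp: indicator_def)
    qed
    show "AE x in lborel. norm (\<bar>g x\<bar> powr p * indicator {x. real n \<le> \<bar>x\<bar>} x) \<le> \<bar>g x\<bar> powr p" for n
      by (rule AE_I2) (auto simp: indicator_def)
  qed measurable
  then show ?thesis by simp
qed

lemma UN_blocks:
  fixes m :: "nat \<Rightarrow> nat"
  assumes "m 0 = 0" "strict_mono m"
  shows "(\<Union>l<M. {m l..<m (Suc l)}) = {..<m M}"
proof (induction M)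
  case (Suc M)
  have "m M \<le> m (Suc M)" using strict_mono_less_eq[OF assms(2)] by simp
  then show ?case using Suc by (auto simp: lessThan_Suc)
qed (simp add: assms(1))

lemma disjoint_blocks:
  fixes m :: "nat \<Rightarrow> nat"
  assumes "strict_mono m"
  shows "disjoint_family_on (\<lambda>l. {m l..<m (Suc l)}) L"
  unfolding disjoint_family_on_def
proof (intro ballI impI)
  fix k l :: nat assume "k \<noteq> l"
  then have "Suc k \<le> l \<or> Suc l \<le> k" by auto
  then have "m (Suc k) \<le> m l \<or> m (Suc l) \<le> m k" using strict_mono_less_eq[OF assms] by blast
  then show "{m k..<m (Suc k)} \<inter> {m l..<m (Suc l)} = {}" by auto
qed

text \<open>The trace that translation leaves in the rest of the argument: a common norm, and finite
  total mass on bounded sets.\<close>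

locale locally_small_Lp = unconditional_Lp +
  fixes \<nu> :: real
  assumes \<nu>: "\<nu> > 0" and norm_f: "\<And>i. Lp_norm p (f i) = \<nu>"
    and local_summable: "\<And>R. summable (\<lambda>i. mass p (f i) {x. \<bar>x\<bar> < R})"
begin

text \<open>Each new point must satisfy two independent largeness conditions given the previous one:
  as a radius it leaves little of finitely many functions outside, and as an index it leaves a small
  tail of a convergent series. Both persist for larger values, so one number can serve in both
  roles.\<close>

lemma blocks:
  obtains m :: "nat \<Rightarrow> nat" where "m 0 = 0" "strict_mono m"
    "\<And>j. (\<Sum>i<m j. mass p (f i) {x. real (m (Suc j)) \<le> \<bar>x\<bar>}) \<le> (1/2) ^ j"
    "\<And>j n. (\<Sum>i\<in>{m (Suc j)..<n}. mass p (f i) {x. \<bar>x\<bar> < real (m j)}) \<le> (1/2) ^ j"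
proof -
  define P where "P j k k' \<longleftrightarrow> k < k' \<and> (\<Sum>i<k. mass p (f i) {x. real k' \<le> \<bar>x\<bar>}) \<le> (1/2) ^ j \<and>
    (\<forall>n. (\<Sum>i\<in>{k'..<n}. mass p (f i) {x. \<bar>x\<bar> < real k}) \<le> (1/2) ^ j)" for j k k' :: nat
  have "\<exists>k'. P j k k'" for j k
  proof -
    have e: "(0::real) < (1/2) ^ j" by simp
    have "(\<lambda>n. \<Sum>i<k. mass p (f i) {x. real n \<le> \<bar>x\<bar>}) \<longlonglongrightarrow> (\<Sum>i<k. 0)"
      by (intro tendsto_sum mass_tail_tendsto_0 f_Lp)
    then have "\<forall>\<^sub>F n in sequentially. (\<Sum>i<k. mass p (f i) {x. real n \<le> \<bar>x\<bar>}) < (1/2) ^ j"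
      using order_tendstoD(2)[OF _ e] by simp
    then obtain N1 where N1: "\<And>n. n \<ge> N1 \<Longrightarrow> (\<Sum>i<k. mass p (f i) {x. real n \<le> \<bar>x\<bar>}) < (1/2) ^ j"
      by (auto simp: eventually_sequentially)
    obtain N2 where N2: "\<And>m n. m \<ge> N2 \<Longrightarrow> norm (\<Sum>i\<in>{m..<n}. mass p (f i) {x. \<bar>x\<bar> < real k}) < (1/2) ^ j"
      using local_summable[of "real k"] e unfolding summable_Cauchy by meson
    have "P j k (Suc k + N1 + N2)"
      unfolding P_def
    proof (intro conjI allI)
      show "(\<Sum>i<k. mass p (f i) {x. real (Suc k + N1 + N2) \<le> \<bar>x\<bar>}) \<le> (1/2) ^ j"
        by (rule less_imp_le, rule N1) simp
      show "(\<Sum>i\<in>{Suc k + N1 + N2..<n}. mass p (f i) {x. \<bar>x\<bar> < real k}) \<le> (1/2) ^ j" for n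
        using N2[of "Suc k + N1 + N2" n] by simp
    qed simp
    then show ?thesis by blast
  qed
  then obtain nx where nx: "\<And>j k. P j k (nx j k)" by metis
  define m where "m = rec_nat 0 nx"
  have m0: "m 0 = 0" and m: "\<And>j. P j (m j) (m (Suc j))" using nx by (simp_all add: m_def)
  show ?thesis
    using m by (intro that[of m] m0) (auto simp: P_def strict_mono_Suc_iff)
qed

text \<open>The function \<open>f i\<close> with \<open>i\<close> in the block \<open>l\<close> lives, up to a summable error, on the
  annulus \<open>m (l - 1) \<le> \<bar>x\<bar> < m (l + 2)\<close>, and each point lies in at most three of these annuli.\<close>

lemma blocks_dominate:
  obtains m :: "nat \<Rightarrow> nat" and C where "m 0 = 0" "strict_mono m" "C > 0"
    "\<And>M a. Lp_int p (comb {..<m M} a) \<le> C * (\<Sum>l<M. Lp_int p (comb {m l..<m (Suc l)} a))"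
proof -
  obtain m :: "nat \<Rightarrow> nat" where m0: "m 0 = 0" and mono: "strict_mono m"
    and outer: "\<And>j. (\<Sum>i<m j. mass p (f i) {x. real (m (Suc j)) \<le> \<bar>x\<bar>}) \<le> (1/2) ^ j"
    and inner: "\<And>j n. (\<Sum>i\<in>{m (Suc j)..<n}. mass p (f i) {x. \<bar>x\<bar> < real (m j)}) \<le> (1/2) ^ j"
    using blocks by blast
  define E where "E l = {m l..<m (Suc l)}" for l
  \<comment> \<open>The complement of the annulus belonging to block \<open>l\<close>. For
    \<open>l = 0\<close> the truncated subtraction gives \<open>m 0 = 0\<close>, so the inner part
    is empty.\<close>
  define D where "D l = {x::real. real (m (Suc (Suc l))) \<le> \<bar>x\<bar>} \<union> {x. \<bar>x\<bar> < real (m (l - 1))}" for l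
  have finE [simp]: "finite (E l)" for l by (simp add: E_def)
  have D_borel [measurable]: "D l \<in> sets borel" for l unfolding D_def by measurable
  \<comment> \<open>The outer estimate is used at \<open>Suc l\<close> and the inner one at
    \<open>l - 1\<close>, giving \<open>1/2\<close> and 2 times \<open>(1/2) ^ l\<close>; 3 rounds
    this up.\<close>
  have far_mass: "(\<Sum>i\<in>E l. mass p (f i) (D l)) \<le> 3 * (1/2) ^ l" for l
  proof -
    have "(\<Sum>i\<in>E l. mass p (f i) (D l)) \<le> (\<Sum>i\<in>E l. mass p (f i) {x. real (m (Suc (Suc l))) \<le> \<bar>x\<bar>})
        + (\<Sum>i\<in>E l. mass p (f i) {x. \<bar>x\<bar> < real (m (l - 1))})"
      unfolding D_def sum.distrib[symmetric] by (intro sum_mono mass_Un_le f_Lp) measurable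
    also have "(\<Sum>i\<in>E l. mass p (f i) {x. real (m (Suc (Suc l))) \<le> \<bar>x\<bar>})
        \<le> (\<Sum>i<m (Suc l). mass p (f i) {x. real (m (Suc (Suc l))) \<le> \<bar>x\<bar>})"
      by (intro sum_mono2) (auto simp: E_def mass_nonneg)
    also have "\<dots> \<le> (1/2) ^ Suc l" by (rule outer)
    also have "(\<Sum>i\<in>E l. mass p (f i) {x. \<bar>x\<bar> < real (m (l - 1))}) \<le> 2 * (1/2) ^ l"
    proof (cases l)
      case 0
      then show ?thesis by (simp add: m0 mass_def)
    next
      case (Suc j)
      then show ?thesis using inner[of j "m (Suc l)"] by (simp add: E_def)
    qed
    also have "(1/2) ^ Suc l + 2 * (1/2) ^ l \<le> 3 * (1/2::real) ^ l" by simp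
    finally show ?thesis by simp
  qed
  have card3: "card {l \<in> {..<M}. x \<notin> D l} \<le> 3" for x M
  proof -
    have "\<exists>n. \<bar>x\<bar> < real (m n)"
      using reals_Archimedean2[of "\<bar>x\<bar>"] strict_mono_imp_increasing[OF mono] by (meson less_le_trans of_nat_le_iff)
    \<comment> \<open>The first radius beyond \<open>x\<close>, positive because
      \<open>m 0 = 0\<close>. With \<open>n = Suc k\<close>, monotonicity of \<open>m\<close> leaves
      only \<open>k - 1\<close>, \<open>k\<close> and \<open>k + 1\<close> for an annulus containing
      \<open>x\<close>.\<close>
    define n where "n = (LEAST n. \<bar>x\<bar> < real (m n))"
    have n: "\<bar>x\<bar> < real (m n)"
      unfolding n_def by (rule LeastI_ex) fact
    have "n \<noteq> 0"
    proof
      assume "n = 0"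
      then show False using n m0 by simp
    qed
    then obtain k where k: "n = Suc k" using not0_implies_Suc by blast
    have "\<not> \<bar>x\<bar> < real (m k)" using not_less_Least[of k "\<lambda>n. \<bar>x\<bar> < real (m n)"] k by (simp add: n_def)
    then have kx: "real (m k) \<le> \<bar>x\<bar>" by simp
    have "{l \<in> {..<M}. x \<notin> D l} \<subseteq> {k - 1..k + 1}"
    proof
      fix l assume "l \<in> {l \<in> {..<M}. x \<notin> D l}"
      then have l: "\<bar>x\<bar> < real (m (Suc (Suc l)))" "real (m (l - 1)) \<le> \<bar>x\<bar>" by (auto simp: D_def)
      have "m k < m (Suc (Suc l))" "m (l - 1) < m (Suc k)" using l kx n unfolding k by linarith+
      then have "k < Suc (Suc l)" "l - 1 < Suc k" using strict_mono_less[OF mono] by blast+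
      then show "l \<in> {k - 1..k + 1}" by auto
    qed
    then have "card {l \<in> {..<M}. x \<notin> D l} \<le> card {k - 1..k + 1}" by (intro card_mono) auto
    also have "\<dots> \<le> 3" by simp
    finally show ?thesis .
  qed
  define q where "q = p / 2"
  have q: "q > 0" "q \<ge> 1" using p by (auto simp: q_def)
  have Eun: "(\<Union>l<M. E l) = {..<m M}" for M
    unfolding E_def by (rule UN_blocks[OF m0 mono])
  have Edisj: "disjoint_family E"
    unfolding E_def by (rule disjoint_blocks[OF mono])
  define y where "y a l x = (\<Sum>i\<in>E l. (a i * f i x)\<^sup>2)" for a l x
  have y0: "0 \<le> y a l x" for a l x unfolding y_def by (intro sum_nonneg) auto
  have sq: "square_fn (E l) a x = y a l x powr q" for a l x by (simp add: square_fn_def y_def q_def)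
  have sqM: "square_fn {..<m M} a x = (\<Sum>l<M. y a l x) powr q" for a M x
  proof -
    have "(\<Sum>i\<in>(\<Union>l<M. E l). (a i * f i x)\<^sup>2) = (\<Sum>l<M. y a l x)"
      unfolding y_def using Edisj by (intro sum.UNION_disjoint) (auto simp: disjoint_family_on_def)
    then show ?thesis by (simp add: Eun square_fn_def q_def)
  qed
  \<comment> \<open>Of the blocks, at most three count at \<open>x\<close>, and each is bounded by
    the \<open>1/q\<close>-th power of the full sum; hence \<open>3 powr q\<close>.\<close>
  have near: "(\<Sum>l\<in>{l \<in> {..<M}. x \<notin> D l}. y a l x) powr q \<le> 3 powr q * (\<Sum>l<M. square_fn (E l) a x)" for a M x
  proof -
    let ?s = "\<Sum>l<M. square_fn (E l) a x"
    have s0: "?s \<ge> 0" by (intro sum_nonneg square_fn_nonneg)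
    have "y a l x \<le> ?s powr (1/q)" if "l < M" for l
    proof -
      have "square_fn (E l) a x \<le> ?s" using that by (intro member_le_sum square_fn_nonneg) auto
      then have "(y a l x powr q) powr (1/q) \<le> ?s powr (1/q)"
        unfolding sq using q by (intro powr_mono2) auto
      then show ?thesis using q y0 by (simp add: powr_powr)
    qed
    then have "(\<Sum>l\<in>{l \<in> {..<M}. x \<notin> D l}. y a l x) \<le> real (card {l \<in> {..<M}. x \<notin> D l}) * ?s powr (1/q)"
      by (intro sum_bounded_above) auto
    also have "\<dots> \<le> 3 * ?s powr (1/q)" using card3[of M x] by (intro mult_right_mono) auto
    finally have "(\<Sum>l\<in>{l \<in> {..<M}. x \<notin> D l}. y a l x) powr q \<le> (3 * ?s powr (1/q)) powr q"
      using q y0 by (intro powr_mono2 sum_nonneg) auto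
    also have "\<dots> = 3 powr q * ?s" using q s0 by (simp add: powr_mult powr_powr)
    finally show ?thesis .
  qed
  \<comment> \<open>The inequality for \<open>p \<le> 4\<close> is applied to pairs of a block and
    an index in it, with \<open>f i\<close> cut down to \<open>D l\<close>. It separates
    coefficients from functions, so that integration acts only on the second factor and produces the
    far mass.\<close>
  have far: "(\<Sum>l\<in>{l \<in> {..<M}. x \<in> D l}. y a l x) powr q
      \<le> (\<Sum>l<M. \<Sum>i\<in>E l. \<bar>a i\<bar> powr p) * (\<Sum>l<M. \<Sum>i\<in>E l. \<bar>f i x\<bar> powr p * indicator (D l) x)" for a M x
  proof -
    have "(\<Sum>l\<in>{l \<in> {..<M}. x \<in> D l}. y a l x) = (\<Sum>l<M. if x \<in> D l then y a l x else 0)"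
      by (rule sum.inter_filter) simp
    also have "\<dots> = (\<Sum>l<M. \<Sum>i\<in>E l. (a i * (f i x * indicator (D l) x))\<^sup>2)"
      by (intro sum.cong) (auto simp: y_def indicator_def)
    also have "\<dots> = (\<Sum>(l, i)\<in>Sigma {..<M} E. (a i * (f i x * indicator (D l) x))\<^sup>2)"
      by (rule sum.Sigma) auto
    also have "\<dots> = (\<Sum>z\<in>Sigma {..<M} E. (a (snd z) * (f (snd z) x * indicator (D (fst z)) x))\<^sup>2)"
      by (simp add: case_prod_beta)
    also have "\<dots> powr q \<le> (\<Sum>z\<in>Sigma {..<M} E. \<bar>a (snd z)\<bar> powr p)
        * (\<Sum>z\<in>Sigma {..<M} E. \<bar>f (snd z) x * indicator (D (fst z)) x\<bar> powr p)"
      unfolding q_def using p by (intro powr_sum_square_le finite_SigmaI) auto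
    also have "(\<Sum>z\<in>Sigma {..<M} E. \<bar>a (snd z)\<bar> powr p) = (\<Sum>l<M. \<Sum>i\<in>E l. \<bar>a i\<bar> powr p)"
      by (subst sum.Sigma) (auto simp: case_prod_beta)
    also have "(\<Sum>z\<in>Sigma {..<M} E. \<bar>f (snd z) x * indicator (D (fst z)) x\<bar> powr p)
        = (\<Sum>l<M. \<Sum>i\<in>E l. \<bar>f i x\<bar> powr p * indicator (D l) x)"
    proof -
      have "\<bar>f i x * indicator (D l) x\<bar> powr p = \<bar>f i x\<bar> powr p * indicator (D l) x" for i l
        by (simp add: indicator_def)
      then show ?thesis by (subst sum.Sigma) (auto simp: case_prod_beta)
    qed
    finally show ?thesis .
  qed
  have split: "square_fn {..<m M} a x \<le> 2 powr q * (3 powr q * (\<Sum>l<M. square_fn (E l) a x)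
      + (\<Sum>l<M. \<Sum>i\<in>E l. \<bar>a i\<bar> powr p) * (\<Sum>l<M. \<Sum>i\<in>E l. \<bar>f i x\<bar> powr p * indicator (D l) x))" for a M x
  proof -
    let ?N = "\<Sum>l\<in>{l \<in> {..<M}. x \<notin> D l}. y a l x" and ?F = "\<Sum>l\<in>{l \<in> {..<M}. x \<in> D l}. y a l x"
    have nn: "?N \<ge> 0" "?F \<ge> 0" using y0 by (auto intro: sum_nonneg)
    have "(\<Sum>l<M. y a l x) = ?N + ?F"
      by (subst sum.union_disjoint[symmetric]) (auto intro!: sum.cong)
    then have "square_fn {..<m M} a x = \<bar>?N + ?F\<bar> powr q" using nn by (simp add: sqM)
    also have "\<dots> \<le> 2 powr q * (\<bar>?N\<bar> powr q + \<bar>?F\<bar> powr q)" by (rule abs_add_powr_le[OF q(1)])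
    also have "\<dots> = 2 powr q * (?N powr q + ?F powr q)" using nn by simp
    also have "\<dots> \<le> 2 powr q * (3 powr q * (\<Sum>l<M. square_fn (E l) a x)
      + (\<Sum>l<M. \<Sum>i\<in>E l. \<bar>a i\<bar> powr p) * (\<Sum>l<M. \<Sum>i\<in>E l. \<bar>f i x\<bar> powr p * indicator (D l) x))"
      by (intro mult_left_mono add_mono near far) auto
    finally show ?thesis .
  qed
  \<comment> \<open>The coefficient factor of the far part is absorbed here: the common norm \<nu>
    of the functions bounds it by the blocks themselves.\<close>
  have coeffs: "(\<Sum>i\<in>E l. \<bar>a i\<bar> powr p) * \<nu> powr p \<le> (\<integral>x. square_fn (E l) a x \<partial>lborel)" for a l
  proof -
    have "(\<Sum>i\<in>E l. \<bar>a i\<bar> powr p) * \<nu> powr p = (\<Sum>i\<in>E l. Lp_int p (\<lambda>x. a i * f i x))"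
      using p_pos by (simp add: Lp_int_scale sum_distrib_right norm_f flip: Lp_norm_powr)
    also have "\<dots> = (\<integral>x. (\<Sum>i\<in>E l. \<bar>a i * f i x\<bar> powr p) \<partial>lborel)"
      unfolding Lp_int_def by (intro Bochner_Integration.integral_sum[symmetric] Lp_integrable Lp_scale f_Lp)
    also have "\<dots> \<le> (\<integral>x. square_fn (E l) a x \<partial>lborel)"
    proof (intro integral_mono Bochner_Integration.integrable_sum Lp_integrable Lp_scale f_Lp square_fn_integrable finE)
      show "(\<Sum>i\<in>E l. \<bar>a i * f i x\<bar> powr p) \<le> square_fn (E l) a x" for x
        unfolding square_fn_def abs_powr_eq_square using p by (intro sum_powr_le_powr_sum) auto
    qed
    finally show ?thesis .
  qed
  \<comment> \<open>The outer factors are the costs of passing to the square function and back. In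
    between, \<open>2 powr q\<close> splits near from far, \<open>3 powr q\<close> is the overlap,
    and 6 bounds the sum of the far masses \<open>3 * (1/2) ^ l\<close>.\<close>
  define C where "C = (2 * K) powr p * 3 powr (p/4) * (2 powr q * (3 powr q + 6 / \<nu> powr p) * (2 * K) powr p)"
  show ?thesis
  proof (rule that[of m C, OF m0 mono])
    show "C > 0" using K \<nu> unfolding C_def by (intro mult_pos_pos add_pos_pos) auto
    fix M a
    let ?A = "\<Sum>l<M. \<Sum>i\<in>E l. \<bar>a i\<bar> powr p" and ?S = "\<Sum>l<M. (\<integral>x. square_fn (E l) a x \<partial>lborel)"
    have A: "?A \<le> ?S / \<nu> powr p"
    proof -
      have "?A * \<nu> powr p \<le> ?S" unfolding sum_distrib_right[of _ "{..<M}"] by (intro sum_mono coeffs)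
      then show ?thesis using \<nu> by (simp add: pos_le_divide_eq)
    qed
    have S0: "?S \<ge> 0" by (intro sum_nonneg integral_nonneg_AE AE_I2 square_fn_nonneg)
    have geo: "(\<Sum>l<M. 3 * (1/2) ^ l) \<le> (6::real)"
    proof -
      have "(\<Sum>l<M. 3 * (1/2) ^ l) = 3 * (\<Sum>l<M. (1/2::real) ^ l)" by (simp add: sum_distrib_left)
      also have "\<dots> \<le> 6" by (subst geometric_sum) auto
      finally show ?thesis .
    qed
    have int1: "integrable lborel (\<lambda>x. \<Sum>l<M. square_fn (E l) a x)"
      by (intro Bochner_Integration.integrable_sum square_fn_integrable finE)
    have int2: "integrable lborel (\<lambda>x. \<Sum>l<M. \<Sum>i\<in>E l. \<bar>f i x\<bar> powr p * indicator (D l) x)"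
      by (intro Bochner_Integration.integrable_sum mass_integrable f_Lp D_borel)
    have I1: "(\<integral>x. (\<Sum>l<M. square_fn (E l) a x) \<partial>lborel) = ?S"
      by (intro Bochner_Integration.integral_sum square_fn_integrable finE)
    have I2: "(\<integral>x. (\<Sum>l<M. \<Sum>i\<in>E l. \<bar>f i x\<bar> powr p * indicator (D l) x) \<partial>lborel)
        = (\<Sum>l<M. \<Sum>i\<in>E l. mass p (f i) (D l))"
      unfolding mass_def
      by (subst Bochner_Integration.integral_sum, intro Bochner_Integration.integrable_sum mass_integrable f_Lp D_borel,
          intro sum.cong refl Bochner_Integration.integral_sum mass_integrable f_Lp D_borel)
    have lin: "(\<integral>x. b * (c * u x + d * w x) \<partial>lborel) = b * (c * integral\<^sup>L lborel u + d * integral\<^sup>L lborel w)"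
      if "integrable lborel u" "integrable lborel w" for u w :: "real \<Rightarrow> real" and b c d
      using that by (simp add: Bochner_Integration.integral_add)
    have "(\<integral>x. square_fn {..<m M} a x \<partial>lborel) \<le> (\<integral>x. 2 powr q * (3 powr q * (\<Sum>l<M. square_fn (E l) a x)
      + ?A * (\<Sum>l<M. \<Sum>i\<in>E l. \<bar>f i x\<bar> powr p * indicator (D l) x)) \<partial>lborel)"
      by (intro integral_mono integrable_mult_right Bochner_Integration.integrable_add int1 int2 square_fn_integrable split) simp
    also have "\<dots> = 2 powr q * (3 powr q * ?S + ?A * (\<Sum>l<M. \<Sum>i\<in>E l. mass p (f i) (D l)))"
      unfolding lin[OF int1 int2] I1 I2 ..
    also have "\<dots> \<le> 2 powr q * (3 powr q * ?S + ?S / \<nu> powr p * 6)"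
    proof (intro mult_left_mono add_left_mono mult_mono A)
      show "(\<Sum>l<M. \<Sum>i\<in>E l. mass p (f i) (D l)) \<le> 6"
        using sum_mono[of "{..<M}", OF far_mass] geo by (rule order_trans)
    qed (use S0 in \<open>auto intro!: sum_nonneg mass_nonneg\<close>)
    also have "\<dots> = 2 powr q * (3 powr q + 6 / \<nu> powr p) * ?S" by (simp add: algebra_simps)
    also have "\<dots> \<le> 2 powr q * (3 powr q + 6 / \<nu> powr p) * (\<Sum>l<M. (2 * K) powr p * Lp_int p (comb (E l) a))"
      by (intro mult_left_mono sum_mono square_fn_le_comb) auto
    also have "\<dots> = 2 powr q * (3 powr q + 6 / \<nu> powr p) * (2 * K) powr p * (\<Sum>l<M. Lp_int p (comb (E l) a))"
      by (simp add: sum_distrib_left mult.assoc)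
    finally have "(2 * K) powr p * 3 powr (p/4) * (\<integral>x. square_fn {..<m M} a x \<partial>lborel)
       \<le> (2 * K) powr p * 3 powr (p/4) * (2 powr q * (3 powr q + 6 / \<nu> powr p) * (2 * K) powr p * (\<Sum>l<M. Lp_int p (comb (E l) a)))"
      by (intro mult_left_mono) auto
    then have "Lp_int p (comb {..<m M} a) \<le> (2 * K) powr p * 3 powr (p/4) *
        (2 powr q * (3 powr q + 6 / \<nu> powr p) * (2 * K) powr p * (\<Sum>l<M. Lp_int p (comb (E l) a)))"
      using comb_le_square_fn[of "{..<m M}" a] by (meson finite_lessThan order_trans)
    then show "Lp_int p (comb {..<m M} a) \<le> C * (\<Sum>l<M. Lp_int p (comb {m l..<m (Suc l)} a))"
      by (simp add: C_def E_def mult.assoc)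
  qed
qed

end

section \<open>Embedding into \<open>\<ell>\<^sub>p\<close>\<close>

text \<open>Finitely many simple functions jointly take finitely many vectors of values, so the
  \<open>p\<close>-th power integral of any combination is a finite sum weighted by the measures of
  joint level sets. Absorbing the \<open>p\<close>-th roots of the weights gives an isometry into a
  finite-dimensional \<open>\<ell>\<^sub>p\<close>.\<close>

lemma simple_functions_finite_representation:
  fixes h :: "nat \<Rightarrow> real \<Rightarrow> real"
  assumes E: "finite E" and h: "\<And>i. i \<in> E \<Longrightarrow> simple_function lborel (h i)"
    and hLp: "\<And>i. i \<in> E \<Longrightarrow> h i \<in> Lp p" and p: "p > 0"
  shows "\<exists>(d::nat) w. \<forall>a. Lp_int p (\<lambda>x. \<Sum>i\<in>E. a i * h i x) = (\<Sum>j<d. \<bar>\<Sum>i\<in>E. a i * w j i\<bar> powr p)"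
proof -
  \<comment> \<open>Setting the value 0 off \<open>E\<close> makes the set of joint value vectors
    finite.\<close>
  define H where "H x i = (if i \<in> E then h i x else 0)" for x i
  define V where "V = range H"
  have "finite (\<Union>i\<in>E. range (h i))"
    using E simple_functionD(1)[OF h] by auto
  then have "finite {\<phi>. \<forall>i. (i \<in> E \<longrightarrow> \<phi> i \<in> (\<Union>i\<in>E. range (h i))) \<and> (i \<notin> E \<longrightarrow> \<phi> i = 0)}"
    by (rule finite_set_of_finite_funs[OF E])
  then have V: "finite V" by (rule rev_finite_subset) (fastforce simp: V_def H_def)
  obtain e where e: "bij_betw e {..<card V} V"
    using ex_bij_betw_nat_finite[OF V] by (auto simp: lessThan_atLeast0)
  have meas: "H -` {v} \<in> sets lborel" if "v \<in> V" for v
  proof -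
    have "H -` {v} = (\<Inter>i\<in>E. h i -` {v i})"
    proof (intro set_eqI iffI)
      fix x assume x: "x \<in> (\<Inter>i\<in>E. h i -` {v i})"
      have "H x i = v i" for i using x that by (auto simp: H_def V_def)
      then show "x \<in> H -` {v}" by auto
    qed (auto simp: H_def)
    moreover have "h i -` {v i} \<in> sets lborel" if "i \<in> E" for i
      using simple_functionD(2)[OF h[OF that], of "{v i}"] by simp
    ultimately show ?thesis using E by (cases "E = {}") (auto intro!: sets.finite_INT)
  qed
  \<comment> \<open>The zero vector has a level set of infinite measure, where
    \<open>measure\<close> defaults to 0. This agrees with its contribution, since every linear form
    vanishes there.\<close>
  define \<mu> where "\<mu> v = measure lborel (H -` {v})" for v
  define w where "w j i = e j i * \<mu> (e j) powr (1/p)" for j i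
  have "Lp_int p (\<lambda>x. \<Sum>i\<in>E. a i * h i x) = (\<Sum>j<card V. \<bar>\<Sum>i\<in>E. a i * w j i\<bar> powr p)" for a
  proof -
    let ?c = "\<lambda>v. \<bar>\<Sum>i\<in>E. a i * v i\<bar> powr p"
    have LpE: "(\<lambda>x. \<Sum>i\<in>E. a i * h i x) \<in> Lp p"
      by (intro Lp_sum p Lp_scale hLp)
    have pt: "\<bar>\<Sum>i\<in>E. a i * h i x\<bar> powr p = (\<Sum>v\<in>V. ?c v * indicator (H -` {v}) x)" for x
    proof -
      have "(\<Sum>v\<in>V. ?c v * indicator (H -` {v}) x) = (\<Sum>v\<in>V. if v = H x then ?c v else 0)"
        by (intro sum.cong) (auto simp: indicator_def)
      also have "\<dots> = ?c (H x)" using V by (simp add: V_def)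
      also have "(\<Sum>i\<in>E. a i * H x i) = (\<Sum>i\<in>E. a i * h i x)" by (simp add: H_def)
      finally show ?thesis by simp
    qed
    have int: "integrable lborel (\<lambda>x. ?c v * indicator (H -` {v}) x)" if "v \<in> V" for v
    proof (rule Bochner_Integration.integrable_bound[OF Lp_integrable[OF LpE]])
      show "(\<lambda>x. ?c v * indicator (H -` {v}) x) \<in> borel_measurable lborel"
        using meas[OF that] by measurable
      show "AE x in lborel. norm (?c v * indicator (H -` {v}) x) \<le> norm (\<bar>\<Sum>i\<in>E. a i * h i x\<bar> powr p)"
      proof (rule AE_I2)
        fix x
        have "?c v * indicator (H -` {v}) x \<le> (\<Sum>v\<in>V. ?c v * indicator (H -` {v}) x)"
          using that V by (intro member_le_sum) auto
        then show "norm (?c v * indicator (H -` {v}) x) \<le> norm (\<bar>\<Sum>i\<in>E. a i * h i x\<bar> powr p)"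
          by (simp only: pt[symmetric]) simp
      qed
    qed
    have "Lp_int p (\<lambda>x. \<Sum>i\<in>E. a i * h i x) = (\<Sum>v\<in>V. \<integral>x. ?c v * indicator (H -` {v}) x \<partial>lborel)"
      unfolding Lp_int_def pt by (intro Bochner_Integration.integral_sum int)
    also have "\<dots> = (\<Sum>v\<in>V. ?c v * \<mu> v)" by (simp add: \<mu>_def)
    also have "\<dots> = (\<Sum>j<card V. ?c (e j) * \<mu> (e j))"
      by (rule sum.reindex_bij_betw[OF e, symmetric])
    also have "\<dots> = (\<Sum>j<card V. \<bar>\<Sum>i\<in>E. a i * w j i\<bar> powr p)"
    proof (rule sum.cong[OF refl])
      fix j
      have "(\<Sum>i\<in>E. a i * w j i) = (\<Sum>i\<in>E. a i * e j i) * \<mu> (e j) powr (1/p)"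
        by (simp add: w_def sum_distrib_right mult.assoc)
      then show "?c (e j) * \<mu> (e j) = \<bar>\<Sum>i\<in>E. a i * w j i\<bar> powr p"
        using p by (simp add: abs_mult powr_mult powr_powr \<mu>_def)
    qed
    finally show ?thesis .
  qed
  then show ?thesis by blast
qed

text \<open>Flattens an \<open>\<ell>\<^sub>p\<close>-sum of finite rows, padded with zeros, into a
  single sequence. Summing in \<open>ennreal\<close> permits the rearrangement before summability of
  the flattened family is known.\<close>

lemma suminf_prod_decode_finite_rows:
  fixes g :: "nat \<Rightarrow> nat \<Rightarrow> real"
  assumes nonneg: "\<And>l j. 0 \<le> g l j" and s: "summable (\<lambda>l. \<Sum>j<d l. g l j)"
  shows "summable (\<lambda>n. case prod_decode n of (l, j) \<Rightarrow> if j < d l then g l j else 0)"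
    and "(\<Sum>n. case prod_decode n of (l, j) \<Rightarrow> if j < d l then g l j else 0) = (\<Sum>l. \<Sum>j<d l. g l j)"
proof -
  define G where "G = (\<lambda>(l, j). if j < d l then g l j else 0)"
  have G0: "0 \<le> G z" for z using nonneg by (auto simp: G_def split: prod.split)
  have rows: "(\<Sum>j. ennreal (G (l, j))) = ennreal (\<Sum>j<d l. g l j)" for l
  proof -
    have "(\<Sum>j. ennreal (G (l, j))) = (\<Sum>j<d l. ennreal (G (l, j)))"
      by (intro suminf_finite) (auto simp: G_def)
    then show ?thesis using nonneg by (simp add: G_def sum_ennreal)
  qed
  have "(\<Sum>n. ennreal (G (prod_decode n))) = (\<Sum>l. ennreal (\<Sum>j<d l. g l j))"
    by (rule suminf_ennreal_2dimen) (simp add: rows)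
  also have "\<dots> = ennreal (\<Sum>l. \<Sum>j<d l. g l j)"
    using nonneg by (intro suminf_ennreal2 s) (auto intro: sum_nonneg)
  finally have eq: "(\<Sum>n. ennreal (G (prod_decode n))) = ennreal (\<Sum>l. \<Sum>j<d l. g l j)" .
  have sG: "summable (\<lambda>n. G (prod_decode n))"
    by (rule summable_suminf_not_top[OF G0]) (simp add: eq)
  have "ennreal (\<Sum>n. G (prod_decode n)) = ennreal (\<Sum>l. \<Sum>j<d l. g l j)"
    using suminf_ennreal2[OF G0 sG] eq by simp
  then have "(\<Sum>n. G (prod_decode n)) = (\<Sum>l. \<Sum>j<d l. g l j)"
    using suminf_nonneg[OF sG G0] suminf_nonneg[OF s] nonneg by (simp add: sum_nonneg)
  then show "summable (\<lambda>n. case prod_decode n of (l, j) \<Rightarrow> if j < d l then g l j else 0)"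
    "(\<Sum>n. case prod_decode n of (l, j) \<Rightarrow> if j < d l then g l j else 0) = (\<Sum>l. \<Sum>j<d l. g l j)"
    using sG by (simp_all add: G_def)
qed

section \<open>Perturbation and assembly of the embedding\<close>

context locally_small_Lp
begin

text \<open>The principle of small perturbations. Each coefficient is at most
  \<open>K / \<nu>\<close> times the norm of the sum, which cancels the factor
  \<open>\<nu> / K\<close> in the allowed errors; the remaining geometric series divided by 4 is at
  most \<open>1/2\<close>.\<close>

lemma block_perturbation:
  assumes h: "\<And>i. h i \<in> Lp p" and close: "\<And>i. Lp_norm p (\<lambda>x. f i x - h i x) < \<nu> / (4 * K) * (1/2) ^ i"
    and E: "finite E"
  shows "Lp_int p (comb E a) \<le> 2 powr p * Lp_int p (\<lambda>x. \<Sum>i\<in>E. a i * h i x)"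
    and "Lp_int p (\<lambda>x. \<Sum>i\<in>E. a i * h i x) \<le> 2 powr p * Lp_int p (comb E a)"
proof -
  let ?u = "comb E a" and ?v = "\<lambda>x. \<Sum>i\<in>E. a i * h i x"
  have v: "?v \<in> Lp p" by (intro Lp_sum p_pos Lp_scale h)
  have "Lp_norm p (\<lambda>x. ?u x - ?v x) = Lp_norm p (\<lambda>x. \<Sum>i\<in>E. a i * (f i x - h i x))"
    by (simp add: comb_def sum_subtractf right_diff_distrib)
  also have "\<dots> \<le> (\<Sum>i\<in>E. Lp_norm p (\<lambda>x. a i * (f i x - h i x)))"
    by (intro Lp_norm_sum p_pos Lp_scale Lp_diff f_Lp h)
  also have "\<dots> = (\<Sum>i\<in>E. \<bar>a i\<bar> * Lp_norm p (\<lambda>x. f i x - h i x))"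
    using p_pos by (simp add: Lp_norm_scale)
  also have "\<dots> \<le> (\<Sum>i\<in>E. (K * Lp_norm p ?u / \<nu>) * (\<nu> / (4 * K) * (1/2) ^ i))"
  proof (intro sum_mono mult_mono less_imp_le[OF close])
    fix i assume "i \<in> E"
    then show "\<bar>a i\<bar> \<le> K * Lp_norm p ?u / \<nu>"
      using coeff_le[OF E, of i a] \<nu> by (simp add: norm_f pos_le_divide_eq)
  qed (use K \<nu> in \<open>auto simp: Lp_norm_nonneg\<close>)
  also have "\<dots> = Lp_norm p ?u / 4 * (\<Sum>i\<in>E. (1/2) ^ i)"
    unfolding sum_distrib_left using K \<nu> by (intro sum.cong refl) (simp add: field_simps)
  also have "\<dots> \<le> Lp_norm p ?u / 4 * 2"
  proof (intro mult_left_mono)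
    have "(\<Sum>i\<in>E. (1/2) ^ i) \<le> (\<Sum>i. (1/2::real) ^ i)"
      using E by (intro sum_le_suminf summable_geometric) auto
    also have "\<dots> = 2" by (subst suminf_geometric) auto
    finally show "(\<Sum>i\<in>E. (1/2) ^ i) \<le> (2::real)" .
  qed (simp add: Lp_norm_nonneg)
  finally have d: "Lp_norm p (\<lambda>x. ?u x - ?v x) \<le> Lp_norm p ?u / 2" by simp
  have "Lp_norm p ?u \<le> Lp_norm p (\<lambda>x. ?u x - ?v x) + Lp_norm p ?v"
    using Minkowski[OF p_pos(2) Lp_diff[OF p_pos(1) comb_Lp v] v, of E a] by simp
  then have "Lp_norm p ?u \<le> 2 * Lp_norm p ?v" using d by linarith
  then have "Lp_int p ?u \<le> (2 * Lp_norm p ?v) powr p"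
    using Lp_norm_le_iff[OF p_pos(1), of "2 * Lp_norm p ?v" ?u] by (simp add: Lp_norm_nonneg)
  then show "Lp_int p ?u \<le> 2 powr p * Lp_int p ?v" using p_pos by (simp add: powr_mult Lp_norm_powr)
  have "Lp_norm p ?v \<le> Lp_norm p ?u + Lp_norm p (\<lambda>x. ?u x - ?v x)"
    using Lp_norm_diff_le[OF p_pos(2) comb_Lp Lp_diff[OF p_pos(1) comb_Lp v], of E a E a] by simp
  then have "Lp_norm p ?v \<le> 2 * Lp_norm p ?u" using d Lp_norm_nonneg[of p ?u] by linarith
  then have "Lp_int p ?v \<le> (2 * Lp_norm p ?u) powr p"
    using Lp_norm_le_iff[OF p_pos(1), of "2 * Lp_norm p ?u" ?v] by (simp add: Lp_norm_nonneg)
  then show "Lp_int p ?v \<le> 2 powr p * Lp_int p ?u" using p_pos by (simp add: powr_mult Lp_norm_powr)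
qed

text \<open>\<open>T\<close> is defined on all sequences, so its linearity involves no convergence;
  the norm estimates concern only coefficients of a convergent expansion, and convergence in the
  natural order is enough for them.\<close>

theorem coefficients_embed_into_lp:
  obtains T :: "(nat \<Rightarrow> real) \<Rightarrow> nat \<Rightarrow> real" and c C where "0 < c"
    "\<And>a b \<alpha> \<beta>. T (\<lambda>i. \<alpha> * a i + \<beta> * b i) = (\<lambda>n. \<alpha> * T a n + \<beta> * T b n)"
    "\<And>a x. x \<in> Lp p \<Longrightarrow> (\<lambda>n. Lp_norm p (\<lambda>t. x t - comb {..<n} a t)) \<longlonglongrightarrow> 0 \<Longrightarrow>
      T a \<in> lp_seq p \<and> c * Lp_norm p x \<le> lp_norm p (T a) \<and> lp_norm p (T a) \<le> C * Lp_norm p x"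
proof -
  obtain m C1 where m0: "m 0 = 0" and mono: "strict_mono m" and C1: "C1 > 0"
    and dom: "\<And>M a. Lp_int p (comb {..<m M} a) \<le> C1 * (\<Sum>l<M. Lp_int p (comb {m l..<m (Suc l)} a))"
    by (rule blocks_dominate) blast
  define E where "E l = {m l..<m (Suc l)}" for l
  have finE: "finite (E l)" for l by (simp add: E_def)
  have Eun: "(\<Union>l<M. E l) = {..<m M}" for M
    unfolding E_def by (rule UN_blocks[OF m0 mono])
  have Edisj: "disjoint_family_on E L" for L
    unfolding E_def by (rule disjoint_blocks[OF mono])
  define C2 where "C2 = (2 * K) powr p * 3 powr (p/4) * (2 * K) powr p"
  have C2: "C2 > 0" using K by (simp add: C2_def)
  have sub: "(\<Sum>l<M. Lp_int p (comb (E l) a)) \<le> C2 * Lp_int p (comb {..<m M} a)" for M a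
    unfolding C2_def Eun[symmetric] by (intro sum_blocks_le finite_lessThan finE Edisj)
  have "\<exists>h. simple_function lborel h \<and> h \<in> Lp p \<and> Lp_norm p (\<lambda>x. f i x - h x) < \<nu> / (4 * K) * (1/2) ^ i" for i
  proof -
    have "0 < \<nu> / (4 * K) * (1/2) ^ i" using \<nu> K by simp
    from Lp_simple_approx[OF p_pos(1) f_Lp this] show ?thesis by blast
  qed
  then obtain h where hs: "\<And>i. simple_function lborel (h i)" and hL: "\<And>i. h i \<in> Lp p"
    and hn: "\<And>i. Lp_norm p (\<lambda>x. f i x - h i x) < \<nu> / (4 * K) * (1/2) ^ i" by metis
  have "\<forall>l. \<exists>z :: nat \<times> (nat \<Rightarrow> nat \<Rightarrow> real). \<forall>a. Lp_int p (\<lambda>x. \<Sum>i\<in>E l. a i * h i x)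
      = (\<Sum>j<fst z. \<bar>\<Sum>i\<in>E l. a i * snd z j i\<bar> powr p)"
  proof
    fix l
    have "\<exists>(d::nat) w. \<forall>a. Lp_int p (\<lambda>x. \<Sum>i\<in>E l. a i * h i x) = (\<Sum>j<d. \<bar>\<Sum>i\<in>E l. a i * w j i\<bar> powr p)"
      by (rule simple_functions_finite_representation[OF finE hs hL p_pos(1)])
    then obtain d :: nat and w
      where "\<forall>a. Lp_int p (\<lambda>x. \<Sum>i\<in>E l. a i * h i x) = (\<Sum>j<d. \<bar>\<Sum>i\<in>E l. a i * w j i\<bar> powr p)"
      by blast
    then show "\<exists>z :: nat \<times> (nat \<Rightarrow> nat \<Rightarrow> real). \<forall>a. Lp_int p (\<lambda>x. \<Sum>i\<in>E l. a i * h i x)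
      = (\<Sum>j<fst z. \<bar>\<Sum>i\<in>E l. a i * snd z j i\<bar> powr p)"
      by (intro exI[of _ "(d, w)"]) (simp only: fst_conv snd_conv simp_thms)
  qed
  from choice[OF this] obtain z :: "nat \<Rightarrow> nat \<times> (nat \<Rightarrow> nat \<Rightarrow> real)"
    where z: "\<And>l a. Lp_int p (\<lambda>x. \<Sum>i\<in>E l. a i * h i x) = (\<Sum>j<fst (z l). \<bar>\<Sum>i\<in>E l. a i * snd (z l) j i\<bar> powr p)"
    by blast
  define d where "d l = fst (z l)" for l
  define w where "w l = snd (z l)" for l
  have dw: "Lp_int p (\<lambda>x. \<Sum>i\<in>E l. a i * h i x) = (\<Sum>j<d l. \<bar>\<Sum>i\<in>E l. a i * w l j i\<bar> powr p)" for l a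
    unfolding d_def w_def by (rule z)
  \<comment> \<open>Coordinate \<open>n\<close> encodes a block \<open>l\<close> and a row
    \<open>j\<close>; rows beyond the dimension \<open>d l\<close> are padded with 0.\<close>
  define T where "T a n = (case prod_decode n of (l, j) \<Rightarrow> if j < d l then \<Sum>i\<in>E l. a i * w l j i else 0)" for a and n :: nat
  have lin: "T (\<lambda>i. \<alpha> * a i + \<beta> * b i) = (\<lambda>n. \<alpha> * T a n + \<beta> * T b n)" for a b \<alpha> \<beta>
    by (rule ext) (simp add: T_def sum.distrib sum_distrib_left distrib_right mult.assoc split: prod.split)
  define A1 where "A1 = C1 * 2 powr p"
  define A2 where "A2 = 2 powr p * C2"
  have A1: "A1 > 0" using C1 by (simp add: A1_def)
  have bounds: "T a \<in> lp_seq p \<and> inverse (A1 powr (1/p)) * Lp_norm p x \<le> lp_norm p (T a)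
      \<and> lp_norm p (T a) \<le> A2 powr (1/p) * Lp_norm p x"
    if x: "x \<in> Lp p" and conv: "(\<lambda>n. Lp_norm p (\<lambda>t. x t - comb {..<n} a t)) \<longlonglongrightarrow> 0" for a x
  proof -
    define s where "s l = Lp_int p (comb (E l) a)" for l
    define s' where "s' l = Lp_int p (\<lambda>x. \<Sum>i\<in>E l. a i * h i x)" for l
    have s0: "s l \<ge> 0" "s' l \<ge> 0" for l by (simp_all add: s_def s'_def Lp_int_nonneg)
    have ss': "s l \<le> 2 powr p * s' l" "s' l \<le> 2 powr p * s l" for l
      unfolding s_def s'_def using block_perturbation[OF hL hn finE] by blast+
    have norm_lim: "(\<lambda>n. Lp_norm p (comb {..<n} a)) \<longlonglongrightarrow> Lp_norm p x"
    proof (rule LIM_zero_cancel, rule Lim_null_comparison[OF _ conv], intro always_eventually allI)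
      fix n
      have "Lp_norm p x \<le> Lp_norm p (\<lambda>t. x t - comb {..<n} a t) + Lp_norm p (comb {..<n} a)"
        using Minkowski[OF p_pos(2) Lp_diff[OF p_pos(1) x comb_Lp] comb_Lp, of "{..<n}" a "{..<n}" a] by simp
      moreover have "Lp_norm p (comb {..<n} a) \<le> Lp_norm p x + Lp_norm p (\<lambda>t. x t - comb {..<n} a t)"
        using Lp_norm_diff_le[OF p_pos(2) x Lp_diff[OF p_pos(1) x comb_Lp], of "{..<n}" a] by simp
      ultimately show "norm (Lp_norm p (comb {..<n} a) - Lp_norm p x) \<le> Lp_norm p (\<lambda>t. x t - comb {..<n} a t)"
        by (simp add: abs_le_iff)
    qed
    have "(\<lambda>n. Lp_norm p (comb {..<n} a) powr p) \<longlonglongrightarrow> Lp_norm p x powr p"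
    proof (rule tendsto_powr'[OF norm_lim tendsto_const])
      show "Lp_norm p x \<noteq> 0 \<or> 0 < p \<and> (\<forall>\<^sub>F n in sequentially. 0 \<le> Lp_norm p (comb {..<n} a))"
        using p_pos(1) Lp_norm_nonneg by simp
    qed
    then have "(\<lambda>n. Lp_int p (comb {..<n} a)) \<longlonglongrightarrow> Lp_int p x"
      by (simp only: Lp_norm_powr[OF p_pos(1)])
    \<comment> \<open>The block estimates hold at block ends only, so the limit is taken along
      \<open>m\<close>.\<close>
    from LIMSEQ_subseq_LIMSEQ[OF this mono]
    have lim: "(\<lambda>M. Lp_int p (comb {..<m M} a)) \<longlonglongrightarrow> Lp_int p x" by (simp add: o_def)
    \<comment> \<open>Summability of the block contributions has to come first: it follows from
      \<open>sub\<close> once the partial sums of the expansion are bounded.\<close>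
    then have "Bseq (\<lambda>M. Lp_int p (comb {..<m M} a))" by (intro convergent_imp_Bseq) (auto simp: convergent_def)
    then obtain B where "\<forall>M. norm (Lp_int p (comb {..<m M} a)) \<le> B" by (rule BseqE)
    then have B: "Lp_int p (comb {..<m M} a) \<le> B" for M by (simp add: abs_le_iff)
    have sums: "summable s"
    proof (rule summableI_nonneg_bounded[OF s0(1)])
      show "(\<Sum>l<M. s l) \<le> C2 * B" for M
        using order_trans[OF sub mult_left_mono[OF B less_imp_le[OF C2]]] by (simp only: s_def)
    qed
    have sums': "summable s'"
      by (rule summable_comparison_test'[OF summable_mult[OF sums, of "2 powr p"]]) (use ss' s0 in auto)
    have S_up: "suminf s \<le> C2 * Lp_int p x"
      by (rule LIMSEQ_le[OF summable_LIMSEQ[OF sums] tendsto_mult_left[OF lim]]) (use sub in \<open>auto simp: s_def\<close>)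
    have S_low: "Lp_int p x \<le> C1 * suminf s"
      by (rule LIMSEQ_le[OF lim tendsto_mult_left[OF summable_LIMSEQ[OF sums]]]) (use dom in \<open>auto simp: s_def E_def\<close>)
    have S1: "suminf s \<le> 2 powr p * suminf s'"
      using suminf_le[OF ss'(1) sums summable_mult[OF sums']] suminf_mult[OF sums', of "2 powr p"] by simp
    have S2: "suminf s' \<le> 2 powr p * suminf s"
      using suminf_le[OF ss'(2) sums' summable_mult[OF sums]] suminf_mult[OF sums, of "2 powr p"] by simp
    have S'0: "suminf s' \<ge> 0" by (rule suminf_nonneg[OF sums' s0(2)])
    have rows: "s' = (\<lambda>l. \<Sum>j<d l. \<bar>\<Sum>i\<in>E l. a i * w l j i\<bar> powr p)"
      by (rule ext) (simp add: s'_def dw)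
    have Tn: "\<bar>T a n\<bar> powr p = (case prod_decode n of (l, j) \<Rightarrow> if j < d l then \<bar>\<Sum>i\<in>E l. a i * w l j i\<bar> powr p else 0)" for n
      by (simp add: T_def split: prod.split)
    have T: "summable (\<lambda>n. \<bar>T a n\<bar> powr p)" "(\<Sum>n. \<bar>T a n\<bar> powr p) = suminf s'"
      unfolding Tn using suminf_prod_decode_finite_rows[of "\<lambda>l j. \<bar>\<Sum>i\<in>E l. a i * w l j i\<bar> powr p" d] sums'
      unfolding rows by auto
    have norm: "lp_norm p (T a) = suminf s' powr (1/p)" by (simp add: lp_norm_def T)
    have "C1 * suminf s \<le> C1 * (2 powr p * suminf s')"
      using S1 C1 by (intro mult_left_mono) auto
    then have "Lp_int p x \<le> A1 * suminf s'"
      using S_low unfolding A1_def mult.assoc by (rule order_trans[rotated])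
    then have "Lp_int p x powr (1/p) \<le> (A1 * suminf s') powr (1/p)"
      by (intro powr_mono2 Lp_int_nonneg) (use p_pos(1) in simp_all)
    also have "\<dots> = A1 powr (1/p) * lp_norm p (T a)"
      unfolding norm by (rule powr_mult)
    finally have "Lp_norm p x \<le> A1 powr (1/p) * lp_norm p (T a)" by (simp only: Lp_norm_eq)
    then have low: "inverse (A1 powr (1/p)) * Lp_norm p x \<le> lp_norm p (T a)"
      using A1 by (simp add: field_simps)
    have "2 powr p * suminf s \<le> 2 powr p * (C2 * Lp_int p x)"
      by (intro mult_left_mono S_up) simp
    then have "suminf s' \<le> A2 * Lp_int p x"
      using S2 unfolding A2_def mult.assoc by (rule order_trans[rotated])
    then have "suminf s' powr (1/p) \<le> (A2 * Lp_int p x) powr (1/p)"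
      by (intro powr_mono2 S'0) (use p_pos(1) in simp_all)
    also have "\<dots> = A2 powr (1/p) * Lp_int p x powr (1/p)" by (rule powr_mult)
    finally have "lp_norm p (T a) \<le> A2 powr (1/p) * Lp_norm p x"
      by (simp only: norm Lp_norm_eq)
    then show ?thesis using low T(1) by (simp add: lp_seq_def)
  qed
  show ?thesis
    by (rule that[OF _ lin bounds]) (use A1 in auto)
qed

end

section \<open>Translates\<close>

text \<open>Separated points fall into different cells of length \<delta>, and a window of radius
  \<open>R\<close> meets boundedly many cells. The bound is independent of \<open>y\<close> and
  \<open>n\<close>, as is needed for integration in \<open>y\<close>.\<close>

lemma card_translates_le:
  fixes lam :: "nat \<Rightarrow> real"
  assumes \<delta>: "\<delta> > 0" and sep: "\<And>i j. i \<noteq> j \<Longrightarrow> \<delta> \<le> \<bar>lam i - lam j\<bar>"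
  shows "card {i \<in> {..<n}. \<bar>y + lam i\<bar> < R} \<le> card {\<lfloor>- R / \<delta>\<rfloor>..\<lfloor>R / \<delta>\<rfloor>}"
proof (rule card_inj_on_le)
  let ?g = "\<lambda>i. \<lfloor>(y + lam i) / \<delta>\<rfloor>"
  show "inj_on ?g {i \<in> {..<n}. \<bar>y + lam i\<bar> < R}"
  proof (rule inj_onI, rule ccontr)
    fix i j assume eq: "?g i = ?g j" and "i \<noteq> j"
    have "\<bar>(y + lam i) / \<delta> - (y + lam j) / \<delta>\<bar> < 1" using eq by linarith
    moreover have "(y + lam i) / \<delta> - (y + lam j) / \<delta> = (lam i - lam j) / \<delta>"
      by (simp add: diff_divide_distrib[symmetric])
    ultimately have "\<bar>lam i - lam j\<bar> < \<delta>" using \<delta> by (simp add: abs_divide)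
    then show False using sep[OF \<open>i \<noteq> j\<close>] by simp
  qed
  show "?g ` {i \<in> {..<n}. \<bar>y + lam i\<bar> < R} \<subseteq> {\<lfloor>- R / \<delta>\<rfloor>..\<lfloor>R / \<delta>\<rfloor>}"
  proof
    fix z assume "z \<in> ?g ` {i \<in> {..<n}. \<bar>y + lam i\<bar> < R}"
    then obtain i where i: "z = ?g i" "\<bar>y + lam i\<bar> < R" by auto
    then have "- R \<le> y + lam i" "y + lam i \<le> R" by auto
    then have "- R / \<delta> \<le> (y + lam i) / \<delta>" "(y + lam i) / \<delta> \<le> R / \<delta>"
      using \<delta> by (simp_all only: divide_right_mono less_imp_le)
    then show "z \<in> {\<lfloor>- R / \<delta>\<rfloor>..\<lfloor>R / \<delta>\<rfloor>}" using i(1) by (auto intro: floor_mono)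
  qed
qed simp

text \<open>Shifting back replaces moving functions on a fixed window by the fixed \<open>f\<close>
  on moving windows. These have bounded overlap, so the partial sums stay below a multiple of the
  integral of \<open>\<bar>f y\<bar> powr p\<close>.\<close>

lemma mass_translates_summable:
  fixes lam :: "nat \<Rightarrow> real"
  assumes f: "f \<in> Lp p" and \<delta>: "\<delta> > 0" and sep: "\<And>i j. i \<noteq> j \<Longrightarrow> \<delta> \<le> \<bar>lam i - lam j\<bar>"
  shows "summable (\<lambda>i. mass p (translate f (lam i)) {x. \<bar>x\<bar> < R})"
proof (rule summableI_nonneg_bounded)
  let ?B = "card {\<lfloor>- R / \<delta>\<rfloor>..\<lfloor>R / \<delta>\<rfloor>}"
  fix n
  have shift: "mass p (translate f s) {x. \<bar>x\<bar> < R} = (\<integral>y. \<bar>f y\<bar> powr p * indicator {y. \<bar>y + s\<bar> < R} y \<partial>lborel)" for s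
    using lborel_integral_real_affine[of 1 "\<lambda>x. \<bar>translate f s x\<bar> powr p * indicator {x. \<bar>x\<bar> < R} x" s]
    by (simp add: mass_def translate_def indicator_def add.commute)
  have int: "integrable lborel (\<lambda>y. \<bar>f y\<bar> powr p * indicator {y. \<bar>y + s\<bar> < R} y)" for s
    by (rule mass_integrable[OF f]) measurable
  have "(\<Sum>i<n. mass p (translate f (lam i)) {x. \<bar>x\<bar> < R})
      = (\<integral>y. (\<Sum>i<n. \<bar>f y\<bar> powr p * indicator {y. \<bar>y + lam i\<bar> < R} y) \<partial>lborel)"
    unfolding shift by (intro Bochner_Integration.integral_sum[symmetric] int)
  also have "\<dots> \<le> (\<integral>y. real ?B * \<bar>f y\<bar> powr p \<partial>lborel)"
  proof (intro integral_mono Bochner_Integration.integrable_sum int integrable_mult_right Lp_integrable[OF f])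
    fix y
    have "(\<Sum>i<n. \<bar>f y\<bar> powr p * indicator {y. \<bar>y + lam i\<bar> < R} y)
        = \<bar>f y\<bar> powr p * (\<Sum>i<n. if \<bar>y + lam i\<bar> < R then 1 else 0)"
      unfolding sum_distrib_left by (intro sum.cong) (auto simp: indicator_def)
    also have "(\<Sum>i<n. if \<bar>y + lam i\<bar> < R then 1 else 0) = real (card {i \<in> {..<n}. \<bar>y + lam i\<bar> < R})"
      by (subst sum.inter_filter[symmetric]) auto
    also have "\<bar>f y\<bar> powr p * \<dots> \<le> \<bar>f y\<bar> powr p * real ?B"
      using card_translates_le[OF \<delta> sep] by (intro mult_left_mono) auto
    finally show "(\<Sum>i<n. \<bar>f y\<bar> powr p * indicator {y. \<bar>y + lam i\<bar> < R} y) \<le> real ?B * \<bar>f y\<bar> powr p"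
      by (simp add: mult.commute)
  qed
  finally show "(\<Sum>i<n. mass p (translate f (lam i)) {x. \<bar>x\<bar> < R}) \<le> (\<integral>y. real ?B * \<bar>f y\<bar> powr p \<partial>lborel)" .
qed (rule mass_nonneg)

section \<open>The coefficient space of an unconditional basis\<close>

lemma sum_bij_image:
  fixes F :: "nat \<Rightarrow> real \<Rightarrow> real"
  assumes "bij \<sigma>"
  shows "(\<Sum>k<n. a (\<sigma> k) * F (\<sigma> k) t) = (\<Sum>i\<in>\<sigma> ` {..<n}. a i * F i t)"
  by (subst sum.reindex) (auto intro: inj_on_subset[OF bij_is_inj[OF assms]])

lemma uncond_converges_to_iff:
  "uncond_converges_to p a F x \<longleftrightarrow>
    (\<forall>\<sigma>. bij \<sigma> \<longrightarrow> (\<lambda>n. Lp_norm p (\<lambda>t. x t - (\<Sum>i\<in>\<sigma> ` {..<n}. a i * F i t))) \<longlonglongrightarrow> 0)"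
  unfolding uncond_converges_to_def by (intro all_cong1 imp_cong refl) (simp add: sum_bij_image)

locale unconditional_basis_Lp =
  fixes p :: real and F :: "nat \<Rightarrow> real \<Rightarrow> real" and X :: "(real \<Rightarrow> real) set"
  assumes p: "p \<ge> 1" and X: "closed_subspace_Lp p X" and basis: "unconditional_basis p F X"
begin

lemma p_pos: "p > 0" using p by simp

lemma X_Lp: "x \<in> X \<Longrightarrow> x \<in> Lp p"
  using X by (auto simp: closed_subspace_Lp_def)

lemma X_0: "(\<lambda>t. 0) \<in> X"
  using X by (simp add: closed_subspace_Lp_def)

lemma X_lincomb: "x \<in> X \<Longrightarrow> y \<in> X \<Longrightarrow> (\<lambda>t. a * x t + b * y t) \<in> X"
  using X by (simp add: closed_subspace_Lp_def)

lemma X_closed: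
  "(\<And>n. s n \<in> X) \<Longrightarrow> g \<in> Lp p \<Longrightarrow> (\<lambda>n. Lp_norm p (\<lambda>t. s n t - g t)) \<longlonglongrightarrow> 0 \<Longrightarrow> g \<in> X"
  using X unfolding closed_subspace_Lp_def by blast

lemma F_X: "F i \<in> X"
  using basis by (simp add: unconditional_basis_def)

lemma X_sum: "(\<lambda>t. \<Sum>i\<in>G. a i * F i t) \<in> X"
proof (induction G rule: infinite_finite_induct)
  case (insert i G)
  then show ?case using X_lincomb[OF F_X insert.IH, of "a i" i 1] by simp
qed (simp_all add: X_0)

abbreviation expands :: "(nat \<Rightarrow> real) \<Rightarrow> (real \<Rightarrow> real) \<Rightarrow> bool" where
  "expands a x \<equiv> uncond_converges_to p a F x"

lemma ex1_expands: "x \<in> X \<Longrightarrow> \<exists>!a. expands a x"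
  using basis by (simp add: unconditional_basis_def)

lemma expands_lincomb:
  assumes "expands a x" "expands b y" "x \<in> X" "y \<in> X"
  shows "expands (\<lambda>i. \<alpha> * a i + \<beta> * b i) (\<lambda>t. \<alpha> * x t + \<beta> * y t)"
  unfolding uncond_converges_to_iff
proof (intro allI impI)
  fix \<sigma> :: "nat \<Rightarrow> nat" assume \<sigma>: "bij \<sigma>"
  let ?u = "\<lambda>n t. x t - (\<Sum>i\<in>\<sigma> ` {..<n}. a i * F i t)" and ?v = "\<lambda>n t. y t - (\<Sum>i\<in>\<sigma> ` {..<n}. b i * F i t)"
  have L: "?u n \<in> Lp p" "?v n \<in> Lp p" for n
    by (rule Lp_diff[OF p_pos X_Lp[OF assms(3)] X_Lp[OF X_sum]], rule Lp_diff[OF p_pos X_Lp[OF assms(4)] X_Lp[OF X_sum]])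
  have "(\<lambda>n. \<bar>\<alpha>\<bar> * Lp_norm p (?u n) + \<bar>\<beta>\<bar> * Lp_norm p (?v n)) \<longlonglongrightarrow> \<bar>\<alpha>\<bar> * 0 + \<bar>\<beta>\<bar> * 0"
    using assms(1,2) \<sigma> unfolding uncond_converges_to_iff by (intro tendsto_intros) auto
  then have lim: "(\<lambda>n. \<bar>\<alpha>\<bar> * Lp_norm p (?u n) + \<bar>\<beta>\<bar> * Lp_norm p (?v n)) \<longlonglongrightarrow> 0" by simp
  show "(\<lambda>n. Lp_norm p (\<lambda>t. \<alpha> * x t + \<beta> * y t - (\<Sum>i\<in>\<sigma> ` {..<n}. (\<alpha> * a i + \<beta> * b i) * F i t))) \<longlonglongrightarrow> 0"
  proof (rule Lim_null_comparison[OF always_eventually lim], rule allI)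
    fix n
    have "(\<lambda>t. \<alpha> * x t + \<beta> * y t - (\<Sum>i\<in>\<sigma> ` {..<n}. (\<alpha> * a i + \<beta> * b i) * F i t))
        = (\<lambda>t. \<alpha> * ?u n t + \<beta> * ?v n t)"
      by (simp add: sum.distrib sum_distrib_left algebra_simps)
    then show "norm (Lp_norm p (\<lambda>t. \<alpha> * x t + \<beta> * y t - (\<Sum>i\<in>\<sigma> ` {..<n}. (\<alpha> * a i + \<beta> * b i) * F i t)))
        \<le> \<bar>\<alpha>\<bar> * Lp_norm p (?u n) + \<bar>\<beta>\<bar> * Lp_norm p (?v n)"
      using Minkowski[OF p Lp_scale[OF L(1)] Lp_scale[OF L(2)], of \<alpha> n \<beta> n]
      by (simp add: Lp_norm_scale[OF p_pos] Lp_norm_nonneg)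
  qed
qed

lemma expands_trunc:
  assumes G: "finite G"
  shows "expands (trunc G b) (\<lambda>t. \<Sum>i\<in>G. b i * F i t)"
  unfolding uncond_converges_to_iff
proof (intro allI impI)
  fix \<sigma> :: "nat \<Rightarrow> nat" assume \<sigma>: "bij \<sigma>"
  \<comment> \<open>From \<open>n0\<close> on, every index of \<open>G\<close> has been listed, so
    the partial sum is exact; the inserted 0 covers the empty \<open>G\<close>.\<close>
  define n0 where "n0 = Suc (Max (insert 0 (inv \<sigma> ` G)))"
  have "Lp_norm p (\<lambda>t. (\<Sum>i\<in>G. b i * F i t) - (\<Sum>i\<in>\<sigma> ` {..<n}. trunc G b i * F i t)) = 0" if "n \<ge> n0" for n
  proof -
    have "G \<subseteq> \<sigma> ` {..<n}"
    proof
      fix i assume "i \<in> G"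
      then have "inv \<sigma> i \<le> Max (insert 0 (inv \<sigma> ` G))" using G by (intro Max_ge) auto
      then have "inv \<sigma> i < n" using that by (simp add: n0_def)
      then have "\<sigma> (inv \<sigma> i) \<in> \<sigma> ` {..<n}" by simp
      then show "i \<in> \<sigma> ` {..<n}" by (simp only: surj_f_inv_f[OF bij_is_surj[OF \<sigma>]])
    qed
    then have "(\<Sum>i\<in>G. b i * F i t) = (\<Sum>i\<in>\<sigma> ` {..<n}. trunc G b i * F i t)" for t
      by (intro sum.mono_neutral_cong_left) (auto simp: trunc_def)
    then show ?thesis by (simp add: Lp_norm_0)
  qed
  then show "(\<lambda>n. Lp_norm p (\<lambda>t. (\<Sum>i\<in>G. b i * F i t) - (\<Sum>i\<in>\<sigma> ` {..<n}. trunc G b i * F i t))) \<longlonglongrightarrow> 0"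
    by (intro tendsto_eventually eventually_sequentiallyI[of n0]) auto
qed

text \<open>A null function need not be the zero function, yet its expansion also converges to 0 in
  norm, and the expansion of the zero function is unique. Hence the coefficient norm is definite
  although \<open>Lp_norm\<close> is not.\<close>

lemma expands_null:
  assumes a: "expands a x" and x: "x \<in> X" "Lp_norm p x = 0"
  shows "a = (\<lambda>i. 0)"
proof -
  have "expands a (\<lambda>t. 0)"
    unfolding uncond_converges_to_iff
  proof (intro allI impI)
    fix \<sigma> :: "nat \<Rightarrow> nat" assume \<sigma>: "bij \<sigma>"
    have lim: "(\<lambda>n. Lp_norm p (\<lambda>t. x t - (\<Sum>i\<in>\<sigma> ` {..<n}. a i * F i t))) \<longlonglongrightarrow> 0"
      using a \<sigma> by (simp add: uncond_converges_to_iff)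
    show "(\<lambda>n. Lp_norm p (\<lambda>t. 0 - (\<Sum>i\<in>\<sigma> ` {..<n}. a i * F i t))) \<longlonglongrightarrow> 0"
    proof (rule Lim_null_comparison[OF always_eventually lim], rule allI)
      fix n
      have "Lp_norm p (\<lambda>t. 0 - (\<Sum>i\<in>\<sigma> ` {..<n}. a i * F i t))
          \<le> Lp_norm p (\<lambda>t. 0 - x t) + Lp_norm p (\<lambda>t. x t - (\<Sum>i\<in>\<sigma> ` {..<n}. a i * F i t))"
        by (intro Lp_norm_triangle p Lp_0 X_Lp x X_sum)
      then show "norm (Lp_norm p (\<lambda>t. 0 - (\<Sum>i\<in>\<sigma> ` {..<n}. a i * F i t)))
          \<le> Lp_norm p (\<lambda>t. x t - (\<Sum>i\<in>\<sigma> ` {..<n}. a i * F i t))"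
        using x Lp_norm_uminus[OF p_pos, of x] by (simp add: Lp_norm_nonneg)
    qed
  qed
  moreover have "expands (\<lambda>i. 0) (\<lambda>t. 0)"
    using expands_trunc[of "{}"] by (simp add: trunc_def)
  ultimately show ?thesis using ex1_expands[OF X_0] by blast
qed

definition coeff_space :: "(nat \<Rightarrow> real) set" where
  "coeff_space = {a. \<exists>x\<in>X. expands a x}"

text \<open>An expansion determines its sum only almost everywhere, so the norm is read off the partial
  sums.\<close>

definition coeff_norm :: "(nat \<Rightarrow> real) \<Rightarrow> real" where
  "coeff_norm a = lim (\<lambda>n. Lp_norm p (\<lambda>t. \<Sum>i<n. a i * F i t))"

lemma partial_sums_tendsto:
  assumes "expands a x"
  shows "(\<lambda>n. Lp_norm p (\<lambda>t. x t - (\<Sum>i<n. a i * F i t))) \<longlonglongrightarrow> 0"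
proof -
  have "(\<lambda>n. Lp_norm p (\<lambda>t. x t - (\<Sum>k<n. a (id k) * F (id k) t))) \<longlonglongrightarrow> 0"
    using assms bij_id unfolding uncond_converges_to_def by blast
  then show ?thesis by simp
qed

lemma coeff_norm_eq:
  assumes a: "expands a x" and x: "x \<in> X"
  shows "coeff_norm a = Lp_norm p x"
proof -
  have "(\<lambda>n. Lp_norm p (\<lambda>t. \<Sum>i<n. a i * F i t)) \<longlonglongrightarrow> Lp_norm p x"
  proof (rule LIM_zero_cancel, rule Lim_null_comparison[OF always_eventually partial_sums_tendsto[OF a]], rule allI)
    fix n
    let ?s = "\<lambda>t. \<Sum>i<n. a i * F i t"
    have L: "x \<in> Lp p" "?s \<in> Lp p" "(\<lambda>t. x t - ?s t) \<in> Lp p"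
      by (rule X_Lp[OF x], rule X_Lp[OF X_sum], rule Lp_diff[OF p_pos X_Lp[OF x] X_Lp[OF X_sum]])
    have "Lp_norm p x \<le> Lp_norm p (\<lambda>t. x t - ?s t) + Lp_norm p ?s"
      using Minkowski[OF p L(3,2)] by simp
    moreover have "Lp_norm p ?s \<le> Lp_norm p x + Lp_norm p (\<lambda>t. x t - ?s t)"
      using Lp_norm_diff_le[OF p L(1,3)] by simp
    ultimately show "norm (Lp_norm p ?s - Lp_norm p x) \<le> Lp_norm p (\<lambda>t. x t - ?s t)"
      by (simp add: abs_le_iff)
  qed
  then show ?thesis unfolding coeff_norm_def by (rule limI)
qed

lemma expands_add:
  "expands a x \<Longrightarrow> expands b y \<Longrightarrow> x \<in> X \<Longrightarrow> y \<in> X \<Longrightarrow> expands (\<lambda>i. a i + b i) (\<lambda>t. x t + y t)"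
  using expands_lincomb[of a x b y 1 1] by simp

lemma expands_diff:
  "expands a x \<Longrightarrow> expands b y \<Longrightarrow> x \<in> X \<Longrightarrow> y \<in> X \<Longrightarrow> expands (\<lambda>i. a i - b i) (\<lambda>t. x t - y t)"
  using expands_lincomb[of a x b y 1 "-1"] by simp

lemma expands_scale: "expands a x \<Longrightarrow> x \<in> X \<Longrightarrow> expands (\<lambda>i. c * a i) (\<lambda>t. c * x t)"
  using expands_lincomb[of a x a x c 0] by simp

lemma X_add: "x \<in> X \<Longrightarrow> y \<in> X \<Longrightarrow> (\<lambda>t. x t + y t) \<in> X"
  using X_lincomb[of x y 1 1] by simp

lemma X_diff: "x \<in> X \<Longrightarrow> y \<in> X \<Longrightarrow> (\<lambda>t. x t - y t) \<in> X"
  using X_lincomb[of x y 1 "-1"] by simp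

lemma X_scale: "x \<in> X \<Longrightarrow> (\<lambda>t. c * x t) \<in> X"
  using X_lincomb[of x x c 0] by simp

text \<open>Every axiom is transported from \<open>X\<close> by \<open>coeff_norm_eq\<close>. In the
  completeness axiom the limit supplied by \<open>Lp_complete\<close> must lie in \<open>X\<close>
  to have coefficients at all, and this is where closedness of \<open>X\<close> enters.\<close>

sublocale coeffs: unconditional_coefficients coeff_space coeff_norm
proof
  show "(\<lambda>i. a i + b i) \<in> coeff_space" if "a \<in> coeff_space" "b \<in> coeff_space" for a b
    using that expands_add X_add unfolding coeff_space_def by blast
  show "(\<lambda>i. c * a i) \<in> coeff_space" if "a \<in> coeff_space" for a c
    using that expands_scale X_scale unfolding coeff_space_def by blast
  show "trunc G b \<in> coeff_space" if "finite G" for G b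
    using expands_trunc[OF that] X_sum unfolding coeff_space_def by blast
  show "coeff_norm (\<lambda>i. a i + b i) \<le> coeff_norm a + coeff_norm b"
    if ab: "a \<in> coeff_space" "b \<in> coeff_space" for a b
  proof -
    obtain x y where xy: "expands a x" "expands b y" "x \<in> X" "y \<in> X"
      using ab unfolding coeff_space_def by blast
    have "coeff_norm (\<lambda>i. a i + b i) = Lp_norm p (\<lambda>t. x t + y t)"
      by (rule coeff_norm_eq[OF expands_add[OF xy] X_add[OF xy(3,4)]])
    then show ?thesis
      using Minkowski[OF p X_Lp[OF xy(3)] X_Lp[OF xy(4)]] coeff_norm_eq[OF xy(1,3)] coeff_norm_eq[OF xy(2,4)] by simp
  qed
  show "coeff_norm (\<lambda>i. c * a i) = \<bar>c\<bar> * coeff_norm a" if a: "a \<in> coeff_space" for a c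
  proof -
    obtain x where x: "expands a x" "x \<in> X" using a by (auto simp: coeff_space_def)
    show ?thesis
      using coeff_norm_eq[OF expands_scale[OF x] X_scale[OF x(2)]] coeff_norm_eq[OF x] Lp_norm_scale[OF p_pos] by simp
  qed
  show "a = (\<lambda>i. 0)" if a: "a \<in> coeff_space" "coeff_norm a = 0" for a
  proof -
    obtain x where x: "expands a x" "x \<in> X" using a by (auto simp: coeff_space_def)
    show ?thesis using expands_null[OF x] coeff_norm_eq[OF x] a by simp
  qed
  show "\<exists>a\<in>coeff_space. (\<lambda>n. coeff_norm (\<lambda>i. s n i - a i)) \<longlonglongrightarrow> 0"
    if s: "\<And>n. s n \<in> coeff_space"
      and c: "\<And>e. e > 0 \<Longrightarrow> \<exists>M. \<forall>m\<ge>M. \<forall>n\<ge>M. coeff_norm (\<lambda>i. s m i - s n i) < e" for s :: "nat \<Rightarrow> nat \<Rightarrow> real"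
  proof -
    have "\<exists>x. x \<in> X \<and> expands (s n) x" for n using s[of n] by (auto simp: coeff_space_def)
    then obtain x where x: "\<And>n. x n \<in> X" "\<And>n. expands (s n) (x n)" by metis
    have nm: "coeff_norm (\<lambda>i. s m i - s n i) = Lp_norm p (\<lambda>t. x m t - x n t)" for m n
      by (rule coeff_norm_eq[OF expands_diff X_diff]) (use x in auto)
    have "\<exists>h\<in>Lp p. (\<lambda>n. Lp_norm p (\<lambda>t. x n t - h t)) \<longlonglongrightarrow> 0"
      by (rule Lp_complete[OF p X_Lp[OF x(1)]]) (use c in \<open>simp add: nm\<close>)
    then obtain h where h: "h \<in> Lp p" "(\<lambda>n. Lp_norm p (\<lambda>t. x n t - h t)) \<longlonglongrightarrow> 0" by blast
    have hX: "h \<in> X" by (rule X_closed[OF x(1) h])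
    then obtain a where a: "expands a h" using ex1_expands by blast
    have "coeff_norm (\<lambda>i. s n i - a i) = Lp_norm p (\<lambda>t. x n t - h t)" for n
      by (rule coeff_norm_eq[OF expands_diff X_diff]) (use x a hX in auto)
    then show ?thesis using h(2) a hX by (intro bexI[of _ a]) (auto simp: coeff_space_def)
  qed
  have nt: "coeff_norm (\<lambda>i. a i - trunc (\<sigma> ` {..<n}) b i) = Lp_norm p (\<lambda>t. x t - (\<Sum>i\<in>\<sigma> ` {..<n}. b i * F i t))"
    if "expands a x" "x \<in> X" for a b x and \<sigma> :: "nat \<Rightarrow> nat" and n
    by (rule coeff_norm_eq[OF expands_diff X_diff]) (use that in \<open>auto intro!: expands_trunc X_sum\<close>)
  show "(\<lambda>n. coeff_norm (\<lambda>i. a i - trunc (\<sigma> ` {..<n}) a i)) \<longlonglongrightarrow> 0"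
    if a: "a \<in> coeff_space" "bij \<sigma>" for a \<sigma>
  proof -
    obtain x where x: "expands a x" "x \<in> X" using a by (auto simp: coeff_space_def)
    show ?thesis using x(1) a(2) by (simp add: nt[OF x] uncond_converges_to_iff)
  qed
  show "b = a" if a: "a \<in> coeff_space"
    and b: "\<And>\<sigma>. bij \<sigma> \<Longrightarrow> (\<lambda>n. coeff_norm (\<lambda>i. a i - trunc (\<sigma> ` {..<n}) b i)) \<longlonglongrightarrow> 0" for a b
  proof -
    obtain x where x: "expands a x" "x \<in> X" using a by (auto simp: coeff_space_def)
    have "expands b x" using b by (simp add: nt[OF x] uncond_converges_to_iff)
    then show ?thesis using ex1_expands[OF x(2)] x(1) by blast
  qed
qed

lemma coeff_norm_trunc: "finite G \<Longrightarrow> coeff_norm (trunc G a) = Lp_norm p (\<lambda>t. \<Sum>i\<in>G. a i * F i t)"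
  by (rule coeff_norm_eq[OF expands_trunc X_sum])

text \<open>A finite combination over \<open>H\<close> is itself an element of the coefficient
  space, and truncating it to \<open>G\<close> drops the other terms; the uniform bound then applies
  literally.\<close>

lemma unconditional_constant:
  "\<exists>K>0. \<forall>G H a. finite H \<longrightarrow> G \<subseteq> H \<longrightarrow>
    Lp_norm p (\<lambda>t. \<Sum>i\<in>G. a i * F i t) \<le> K * Lp_norm p (\<lambda>t. \<Sum>i\<in>H. a i * F i t)"
proof -
  obtain K where K: "K > 0" "\<And>u G. u \<in> coeff_space \<Longrightarrow> finite G \<Longrightarrow> coeff_norm (trunc G u) \<le> K * coeff_norm u"
    using coeffs.trunc_uniformly_bounded by blast
  have "Lp_norm p (\<lambda>t. \<Sum>i\<in>G. a i * F i t) \<le> K * Lp_norm p (\<lambda>t. \<Sum>i\<in>H. a i * F i t)"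
    if H: "finite H" "G \<subseteq> H" for G H a
  proof -
    have G: "finite G" using H by (rule rev_finite_subset)
    have "trunc G (trunc H a) = trunc G a" using H by (auto simp: trunc_def fun_eq_iff)
    then show ?thesis
      using K(2)[OF coeffs.V_trunc[OF H(1)] G, of a] by (simp add: coeff_norm_trunc G H(1))
  qed
  then show ?thesis using K(1) by blast
qed

lemma norm_F_pos: "Lp_norm p (F i) > 0"
  using coeffs.N_unit_pos[of i] coeff_norm_trunc[of "{i}" "\<lambda>_. 1"] by simp

definition coeff :: "(real \<Rightarrow> real) \<Rightarrow> nat \<Rightarrow> real" where
  "coeff x = (THE a. expands a x)"

lemma expands_coeff: "x \<in> X \<Longrightarrow> expands (coeff x) x"
  unfolding coeff_def by (rule theI'[OF ex1_expands])

lemma coeff_lincomb: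
  assumes "x \<in> X" "y \<in> X"
  shows "coeff (\<lambda>t. a * x t + b * y t) = (\<lambda>i. a * coeff x i + b * coeff y i)"
  unfolding coeff_def[of "\<lambda>t. a * x t + b * y t"]
proof (rule the1_equality)
  show "\<exists>!c. expands c (\<lambda>t. a * x t + b * y t)" by (intro ex1_expands X_lincomb assms)
  show "expands (\<lambda>i. a * coeff x i + b * coeff y i) (\<lambda>t. a * x t + b * y t)"
    by (intro expands_lincomb expands_coeff assms)
qed

end

text \<open>By invariance, the difference of two translates has the norm of \<open>f\<close> shifted
  by \<open>lam i - lam j\<close> minus \<open>f\<close>. Continuity of translation makes it smaller
  than the norm of \<open>f\<close> divided by \<open>K\<close> for close parameters, contradicting
  \<open>unc\<close>.\<close>

lemma translates_separated:
  assumes p: "p \<ge> 1" and f: "f \<in> Lp p" and K: "K > 0" and pos: "Lp_norm p f > 0"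
    and unc: "\<And>i j. i \<noteq> j \<Longrightarrow>
      Lp_norm p (translate f (lam i)) \<le> K * Lp_norm p (\<lambda>t. translate f (lam i) t - translate f (lam j) t)"
  shows "\<exists>\<delta>>0. \<forall>i j. i \<noteq> j \<longrightarrow> \<delta> \<le> \<bar>lam i - lam j\<bar>"
proof -
  have "Lp_norm p f / K > 0" using K pos by simp
  then obtain \<delta> where \<delta>: "\<delta> > 0" "\<And>s. \<bar>s\<bar> < \<delta> \<Longrightarrow> Lp_norm p (\<lambda>x. translate f s x - f x) < Lp_norm p f / K"
    using translation_continuous_Lp[OF p f] by blast
  have "\<delta> \<le> \<bar>lam i - lam j\<bar>" if "i \<noteq> j" for i j
  proof (rule ccontr)
    assume "\<not> ?thesis"
    then have lt: "Lp_norm p (\<lambda>x. translate f (lam i - lam j) x - f x) < Lp_norm p f / K" using \<delta>(2) by simp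
    have p0: "p > 0" using p by simp
    have "translate (\<lambda>x. translate f (lam i - lam j) x - f x) (lam j)
        = (\<lambda>t. translate f (lam i) t - translate f (lam j) t)"
      by (auto simp: translate_def)
    then have "Lp_norm p (\<lambda>t. translate f (lam i) t - translate f (lam j) t) < Lp_norm p f / K"
      using Lp_translate(3)[OF Lp_diff[OF p0 Lp_translate(1)[OF f] f], of "lam i - lam j" "lam j"] lt by simp
    then have "K * Lp_norm p (\<lambda>t. translate f (lam i) t - translate f (lam j) t) < Lp_norm p f"
      using K by (simp add: pos_less_divide_eq mult.commute)
    then show False using unc[OF that] Lp_translate(3)[OF f, of "lam i"] by simp
  qed
  then show ?thesis using \<delta>(1) by blast
qed

theorem theorem2p12:
  fixes p :: real and f :: "real \<Rightarrow> real" and lam :: "nat \<Rightarrow> real"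
    and X :: "(real \<Rightarrow> real) set"
  assumes "2 < p" and "p \<le> 4"
    and "f \<in> Lp p"
    and "closed_subspace_Lp p X"
    and "unconditional_basis p (\<lambda>i. translate f (lam i)) X"
  shows "embeds_into_lp p X"
proof -
  let ?F = "\<lambda>i. translate f (lam i)"
  have p: "p \<ge> 1" using assms(1) by simp
  interpret U: unconditional_basis_Lp p ?F X
    by unfold_locales (fact p assms)+
  have F: "?F i \<in> Lp p" "Lp_norm p (?F i) = Lp_norm p f" for i
    using Lp_translate[OF assms(3)] by auto
  have pos: "Lp_norm p f > 0" using U.norm_F_pos[of 0] by (simp only: F(2))
  obtain K where K: "K > 0" and unc: "\<And>G H a. finite H \<Longrightarrow> G \<subseteq> H \<Longrightarrow>
      Lp_norm p (\<lambda>t. \<Sum>i\<in>G. a i * ?F i t) \<le> K * Lp_norm p (\<lambda>t. \<Sum>i\<in>H. a i * ?F i t)"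
    using U.unconditional_constant by blast
  \<comment> \<open>Truncate the combination with coefficients 1 and -1 to its first term.\<close>
  have diff: "Lp_norm p (?F i) \<le> K * Lp_norm p (\<lambda>t. ?F i t - ?F j t)" if "i \<noteq> j" for i j
    using unc[of "{i, j}" "{i}" "\<lambda>k. if k = i then 1 else - 1"] that by simp
  have "\<exists>\<delta>>0. \<forall>i j. i \<noteq> j \<longrightarrow> \<delta> \<le> \<bar>lam i - lam j\<bar>"
    by (rule translates_separated[where lam = lam, OF p assms(3) K pos]) (rule diff)
  then obtain \<delta> where \<delta>: "\<delta> > 0" "\<And>i j. i \<noteq> j \<Longrightarrow> \<delta> \<le> \<bar>lam i - lam j\<bar>" by blast
  interpret L: locally_small_Lp p K ?F "Lp_norm p f"
  proof
    show "summable (\<lambda>i. mass p (?F i) {x. \<bar>x\<bar> < R})" for R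
      by (rule mass_translates_summable[OF assms(3) \<delta>])
  qed (fact assms(1,2) K F unc pos)+
  obtain T :: "(nat \<Rightarrow> real) \<Rightarrow> nat \<Rightarrow> real" and c C where c: "0 < c"
    and lin: "\<And>a b \<alpha> \<beta>. T (\<lambda>i. \<alpha> * a i + \<beta> * b i) = (\<lambda>n. \<alpha> * T a n + \<beta> * T b n)"
    and T: "\<And>a x. x \<in> Lp p \<Longrightarrow> (\<lambda>n. Lp_norm p (\<lambda>t. x t - L.comb {..<n} a t)) \<longlonglongrightarrow> 0 \<Longrightarrow>
      T a \<in> lp_seq p \<and> c * Lp_norm p x \<le> lp_norm p (T a) \<and> lp_norm p (T a) \<le> C * Lp_norm p x"
    by (rule L.coefficients_embed_into_lp) blast
  have T_X: "T (U.coeff x) \<in> lp_seq p \<and> c * Lp_norm p x \<le> lp_norm p (T (U.coeff x))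
      \<and> lp_norm p (T (U.coeff x)) \<le> C * Lp_norm p x" if "x \<in> X" for x
    using T[OF U.X_Lp[OF that]] U.partial_sums_tendsto[OF U.expands_coeff[OF that]]
    by (simp add: L.comb_def)
  show ?thesis
    unfolding embeds_into_lp_def
  proof (intro exI[of _ "\<lambda>x. T (U.coeff x)"] conjI ballI allI)
    \<comment> \<open>Uniqueness of expansions makes the coefficient map exactly linear on
      \<open>X\<close>, so the composite with \<open>T\<close> is linear with no exceptional null
      sets.\<close>
    show "T (U.coeff (\<lambda>t. a * x t + b * y t)) = (\<lambda>n. a * T (U.coeff x) n + b * T (U.coeff y) n)"
      if "x \<in> X" "y \<in> X" for x y a b
      using lin by (simp only: U.coeff_lincomb[OF that])
    show "T (U.coeff x) \<in> lp_seq p" if "x \<in> X" for x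
      using T_X[OF that] by blast
    show "\<exists>c C. 0 < c \<and> (\<forall>x\<in>X. c * Lp_norm p x \<le> lp_norm p (T (U.coeff x)) \<and>
        lp_norm p (T (U.coeff x)) \<le> C * Lp_norm p x)"
      using c T_X by blast
  qed
qed

end
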